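(* Let $A$ be a $k$-algebra with identity (not necessarily finite dimensional), where $k=\overline{\mathbb F}_q$, and let $F_A$ be a Frobenius morphism on $A$ with fixed-point algebra $A^F$. Then the abelian category $\mathrm{mod}^F\text{-}A$ of finite dimensional $F$-stable $A$-modules is equivalent to the category $\mathrm{mod}\text{-}A^F$ of finite dimensional $A^F$-modules.
   Context: Let $q$ be a prime power, $\mathbb F_q$ the field with $q$ elements and $k=\overline{\mathbb F}_q$ its algebraic closure. All modules are left modules, finite dimensional over the base field. A Frobenius map on a $k$-vector space $V$ is an $\mathbb F_q$-linear isomorphism $F:V\to V$ such that $F(\lambda v)=\lambda^qF(v)$ for all $\lambda\in k$, $v\in V$, and such that for every $v\in V$ there is $n>0$ with $F^n(v)=v$. Put $V^F=\{v\in V: F(v)=v\}$. A Frobenius morphism on a $k$-algebra $A$ (with $1$) is a Frobenius map $F_A$ on the vector space $A$ that is also an $\mathbb F_q$-algebra isomorphism $A\to A$ sending $1$ to $1$. Then $A^F=\{a\in A: F_A(a)=a\}$ is an $\mathbb F_q$-algebra. An $A$-module $M$ is $F$-stable if there is a Frobenius map $F_M$ on $M$ with $F_M(am)=F_A(a)F_M(m)$ for all $a\in A$, $m\in M$. The category $\mathrm{mod}^F\text{-}A$ has as objects the pairs $(M,F_M)$ with $M$ a finite dimensional $A$-module and $F_M$ such a Frobenius map; morphisms $(M_1,F_1)\to(M_2,F_2)$ are the $A$-module homomorphisms $\theta:M_1\to M_2$ with $\theta\circ F_1=F_2\circ\theta$. *)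

theory Defs
  imports "HOL-Computational_Algebra.Primes" "HOL-Algebra.Algebraic_Closure" "HOL-Library.FuncSet"
    "Jordan_Normal_Form.Missing_VectorSpace"
begin

section \<open>Categories\<close>

record ('o, 'm) cat =
  obj :: "'o set"
  arr :: "'m set"
  src :: "'m \<Rightarrow> 'o"
  tgt :: "'m \<Rightarrow> 'o"
  ident :: "'o \<Rightarrow> 'm"
  comp_arr :: "'m \<Rightarrow> 'm \<Rightarrow> 'm"  (infixl \<open>\<cdot>\<index>\<close> 70)

definition homset :: "('o, 'm, 'e) cat_scheme \<Rightarrow> 'o \<Rightarrow> 'o \<Rightarrow> 'm set" where
  "homset C U V = {f \<in> arr C. src C f = U \<and> tgt C f = V}"

locale category =
  fixes C (structure)
  assumes src_obj: "f \<in> arr C \<Longrightarrow> src C f \<in> obj C"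
    and tgt_obj: "f \<in> arr C \<Longrightarrow> tgt C f \<in> obj C"
    and ident_hom: "U \<in> obj C \<Longrightarrow> ident C U \<in> homset C U U"
    and comp_hom: "f \<in> homset C U V \<Longrightarrow> g \<in> homset C V Z \<Longrightarrow> g \<cdot> f \<in> homset C U Z"
    and ident_right: "f \<in> homset C U V \<Longrightarrow> f \<cdot> ident C U = f"
    and ident_left: "f \<in> homset C U V \<Longrightarrow> ident C V \<cdot> f = f"
    and comp_assoc: "f \<in> homset C W U \<Longrightarrow> g \<in> homset C U V \<Longrightarrow> h \<in> homset C V Z \<Longrightarrow>
      h \<cdot> (g \<cdot> f) = (h \<cdot> g) \<cdot> f"

locale cat_functor = C: category C + D: category D
  for C :: "('o1, 'm1, 'e1) cat_scheme" and D :: "('o2, 'm2, 'e2) cat_scheme" +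
  fixes Fo :: "'o1 \<Rightarrow> 'o2" and Fa :: "'m1 \<Rightarrow> 'm2"
  assumes map_obj: "U \<in> obj C \<Longrightarrow> Fo U \<in> obj D"
    and map_hom: "f \<in> homset C U V \<Longrightarrow> Fa f \<in> homset D (Fo U) (Fo V)"
    and map_ident: "U \<in> obj C \<Longrightarrow> Fa (ident C U) = ident D (Fo U)"
    and map_comp: "f \<in> homset C U V \<Longrightarrow> g \<in> homset C V Z \<Longrightarrow>
      Fa (g \<cdot>\<^bsub>C\<^esub> f) = Fa g \<cdot>\<^bsub>D\<^esub> Fa f"

definition iso_arr :: "('o, 'm, 'e) cat_scheme \<Rightarrow> 'o \<Rightarrow> 'o \<Rightarrow> 'm \<Rightarrow> bool" where
  "iso_arr C U V f \<longleftrightarrow> f \<in> homset C U V \<and>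
    (\<exists>g \<in> homset C V U. g \<cdot>\<^bsub>C\<^esub> f = ident C U \<and> f \<cdot>\<^bsub>C\<^esub> g = ident C V)"

definition natural_iso ::
  "('o1, 'm1, 'e1) cat_scheme \<Rightarrow> ('o2, 'm2, 'e2) cat_scheme \<Rightarrow>
   ('o1 \<Rightarrow> 'o2) \<Rightarrow> ('m1 \<Rightarrow> 'm2) \<Rightarrow> ('o1 \<Rightarrow> 'o2) \<Rightarrow> ('m1 \<Rightarrow> 'm2) \<Rightarrow> ('o1 \<Rightarrow> 'm2) \<Rightarrow> bool" where
  "natural_iso C D Fo Fa Go Ga \<eta> \<longleftrightarrow>
    (\<forall>U \<in> obj C. iso_arr D (Fo U) (Go U) (\<eta> U)) \<and>
    (\<forall>U V. \<forall>f \<in> homset C U V. Ga f \<cdot>\<^bsub>D\<^esub> \<eta> U = \<eta> V \<cdot>\<^bsub>D\<^esub> Fa f)"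

definition equivalent_categories ::
  "('o1, 'm1, 'e1) cat_scheme \<Rightarrow> ('o2, 'm2, 'e2) cat_scheme \<Rightarrow> bool" where
  "equivalent_categories C D \<longleftrightarrow> (\<exists>Fo Fa Go Ga \<eta> \<epsilon>.
    cat_functor C D Fo Fa \<and> cat_functor D C Go Ga \<and>
    natural_iso C C id id (Go \<circ> Fo) (Ga \<circ> Fa) \<eta> \<and>
    natural_iso D D (Fo \<circ> Go) (Fa \<circ> Ga) id id \<epsilon>)"


section \<open>Abelian categories\<close>

text \<open>\<open>pl\<close> is the addition of parallel arrows and \<open>zr U V\<close> the zero arrow from \<open>U\<close> to \<open>V\<close>.\<close>

locale preadditive_category = category C for C (structure) +
  fixes pl :: "'m \<Rightarrow> 'm \<Rightarrow> 'm" and zr :: "'o \<Rightarrow> 'o \<Rightarrow> 'm"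
  assumes hom_group: "U \<in> obj C \<Longrightarrow> V \<in> obj C \<Longrightarrow>
      comm_group \<lparr>carrier = homset C U V, monoid.mult = pl, one = zr U V\<rparr>"
    and comp_add_left: "f \<in> homset C U V \<Longrightarrow> g \<in> homset C V Z \<Longrightarrow> h \<in> homset C V Z \<Longrightarrow>
      pl g h \<cdot> f = pl (g \<cdot> f) (h \<cdot> f)"
    and comp_add_right: "f \<in> homset C U V \<Longrightarrow> g \<in> homset C U V \<Longrightarrow> h \<in> homset C V Z \<Longrightarrow>
      h \<cdot> pl f g = pl (h \<cdot> f) (h \<cdot> g)"

definition zero_object :: "('o, 'm, 'e) cat_scheme \<Rightarrow> 'o \<Rightarrow> bool" where
  "zero_object C Z \<longleftrightarrow> Z \<in> obj C \<and>
    (\<forall>U \<in> obj C. (\<exists>!f. f \<in> homset C U Z) \<and> (\<exists>!f. f \<in> homset C Z U))"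

definition biproduct ::
  "('o, 'm, 'e) cat_scheme \<Rightarrow> ('m \<Rightarrow> 'm \<Rightarrow> 'm) \<Rightarrow> 'o \<Rightarrow> 'o \<Rightarrow> 'o \<Rightarrow> 'm \<Rightarrow> 'm \<Rightarrow> 'm \<Rightarrow> 'm \<Rightarrow> bool" where
  "biproduct C pl U V P i\<^sub>1 i\<^sub>2 p\<^sub>1 p\<^sub>2 \<longleftrightarrow> P \<in> obj C \<and>
    i\<^sub>1 \<in> homset C U P \<and> i\<^sub>2 \<in> homset C V P \<and> p\<^sub>1 \<in> homset C P U \<and> p\<^sub>2 \<in> homset C P V \<and>
    p\<^sub>1 \<cdot>\<^bsub>C\<^esub> i\<^sub>1 = ident C U \<and> p\<^sub>2 \<cdot>\<^bsub>C\<^esub> i\<^sub>2 = ident C V \<and>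
    pl (i\<^sub>1 \<cdot>\<^bsub>C\<^esub> p\<^sub>1) (i\<^sub>2 \<cdot>\<^bsub>C\<^esub> p\<^sub>2) = ident C P"

definition is_kernel ::
  "('o, 'm, 'e) cat_scheme \<Rightarrow> ('o \<Rightarrow> 'o \<Rightarrow> 'm) \<Rightarrow> 'm \<Rightarrow> 'm \<Rightarrow> bool" where
  "is_kernel C zr f \<kappa> \<longleftrightarrow> f \<in> arr C \<and> \<kappa> \<in> homset C (src C \<kappa>) (src C f) \<and>
    f \<cdot>\<^bsub>C\<^esub> \<kappa> = zr (src C \<kappa>) (tgt C f) \<and>
    (\<forall>W. \<forall>h \<in> homset C W (src C f). f \<cdot>\<^bsub>C\<^esub> h = zr W (tgt C f) \<longrightarrow>
      (\<exists>!u. u \<in> homset C W (src C \<kappa>) \<and> \<kappa> \<cdot>\<^bsub>C\<^esub> u = h))"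

definition is_cokernel ::
  "('o, 'm, 'e) cat_scheme \<Rightarrow> ('o \<Rightarrow> 'o \<Rightarrow> 'm) \<Rightarrow> 'm \<Rightarrow> 'm \<Rightarrow> bool" where
  "is_cokernel C zr f \<gamma> \<longleftrightarrow> f \<in> arr C \<and> \<gamma> \<in> homset C (tgt C f) (tgt C \<gamma>) \<and>
    \<gamma> \<cdot>\<^bsub>C\<^esub> f = zr (src C f) (tgt C \<gamma>) \<and>
    (\<forall>W. \<forall>h \<in> homset C (tgt C f) W. h \<cdot>\<^bsub>C\<^esub> f = zr (src C f) W \<longrightarrow>
      (\<exists>!u. u \<in> homset C (tgt C \<gamma>) W \<and> u \<cdot>\<^bsub>C\<^esub> \<gamma> = h))"

definition mono_arr :: "('o, 'm, 'e) cat_scheme \<Rightarrow> 'm \<Rightarrow> bool" where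
  "mono_arr C f \<longleftrightarrow> f \<in> arr C \<and>
    (\<forall>W. \<forall>g \<in> homset C W (src C f). \<forall>h \<in> homset C W (src C f).
      f \<cdot>\<^bsub>C\<^esub> g = f \<cdot>\<^bsub>C\<^esub> h \<longrightarrow> g = h)"

definition epi_arr :: "('o, 'm, 'e) cat_scheme \<Rightarrow> 'm \<Rightarrow> bool" where
  "epi_arr C f \<longleftrightarrow> f \<in> arr C \<and>
    (\<forall>W. \<forall>g \<in> homset C (tgt C f) W. \<forall>h \<in> homset C (tgt C f) W.
      g \<cdot>\<^bsub>C\<^esub> f = h \<cdot>\<^bsub>C\<^esub> f \<longrightarrow> g = h)"

definition abelian_category :: "('o, 'm, 'e) cat_scheme \<Rightarrow> bool" where
  "abelian_category C \<longleftrightarrow> (\<exists>pl zr. preadditive_category C pl zr \<and>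
    (\<exists>Z. zero_object C Z) \<and>
    (\<forall>U \<in> obj C. \<forall>V \<in> obj C. \<exists>P i\<^sub>1 i\<^sub>2 p\<^sub>1 p\<^sub>2. biproduct C pl U V P i\<^sub>1 i\<^sub>2 p\<^sub>1 p\<^sub>2) \<and>
    (\<forall>f \<in> arr C. \<exists>\<kappa>. is_kernel C zr f \<kappa>) \<and>
    (\<forall>f \<in> arr C. \<exists>\<gamma>. is_cokernel C zr f \<gamma>) \<and>
    (\<forall>m. mono_arr C m \<longrightarrow> (\<exists>f. is_kernel C zr f m)) \<and>
    (\<forall>e. epi_arr C e \<longrightarrow> (\<exists>f. is_cokernel C zr f e)))"


section \<open>Algebras and modules\<close>

text \<open>The locale \<^locale>\<open>algebra\<close> of the library only covers commutative algebras, and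
  \<^locale>\<open>module\<close> only modules over commutative rings. The zero algebra is allowed.\<close>

locale assoc_algebra = vectorspace K A + A: ring A
  for K :: "('k, 'b) ring_scheme" and A :: "('k, 'a, 'c) module_scheme" +
  assumes smult_mult_left: "c \<in> carrier K \<Longrightarrow> x \<in> carrier A \<Longrightarrow> y \<in> carrier A \<Longrightarrow>
      (c \<odot>\<^bsub>A\<^esub> x) \<otimes>\<^bsub>A\<^esub> y = c \<odot>\<^bsub>A\<^esub> (x \<otimes>\<^bsub>A\<^esub> y)"
    and smult_mult_right: "c \<in> carrier K \<Longrightarrow> x \<in> carrier A \<Longrightarrow> y \<in> carrier A \<Longrightarrow>
      x \<otimes>\<^bsub>A\<^esub> (c \<odot>\<^bsub>A\<^esub> y) = c \<odot>\<^bsub>A\<^esub> (x \<otimes>\<^bsub>A\<^esub> y)"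

locale left_module = R: ring R + M: abelian_group M
  for R :: "('a, 'b) ring_scheme" and M :: "('a, 'v, 'd) module_scheme" +
  assumes act_closed: "a \<in> carrier R \<Longrightarrow> x \<in> carrier M \<Longrightarrow> a \<odot>\<^bsub>M\<^esub> x \<in> carrier M"
    and act_add_left: "a \<in> carrier R \<Longrightarrow> b \<in> carrier R \<Longrightarrow> x \<in> carrier M \<Longrightarrow>
      (a \<oplus>\<^bsub>R\<^esub> b) \<odot>\<^bsub>M\<^esub> x = a \<odot>\<^bsub>M\<^esub> x \<oplus>\<^bsub>M\<^esub> b \<odot>\<^bsub>M\<^esub> x"
    and act_add_right: "a \<in> carrier R \<Longrightarrow> x \<in> carrier M \<Longrightarrow> y \<in> carrier M \<Longrightarrow>
      a \<odot>\<^bsub>M\<^esub> (x \<oplus>\<^bsub>M\<^esub> y) = a \<odot>\<^bsub>M\<^esub> x \<oplus>\<^bsub>M\<^esub> a \<odot>\<^bsub>M\<^esub> y"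
    and act_mult: "a \<in> carrier R \<Longrightarrow> b \<in> carrier R \<Longrightarrow> x \<in> carrier M \<Longrightarrow>
      (a \<otimes>\<^bsub>R\<^esub> b) \<odot>\<^bsub>M\<^esub> x = a \<odot>\<^bsub>M\<^esub> (b \<odot>\<^bsub>M\<^esub> x)"
    and act_one: "x \<in> carrier M \<Longrightarrow> \<one>\<^bsub>R\<^esub> \<odot>\<^bsub>M\<^esub> x = x"

text \<open>The vector space underlying a module \<open>M\<close> over an algebra \<open>A\<close>, with scalars acting
  through \<open>c \<mapsto> c \<cdot> 1\<^sub>A\<close>. The fields \<^const>\<open>monoid.mult\<close> and \<^const>\<open>one\<close> of a module
  record have no meaning.\<close>

definition underlying_space ::
  "('k, 'a, 'c) module_scheme \<Rightarrow> ('a, 'v, 'd) module_scheme \<Rightarrow> ('k, 'v) module" where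
  "underlying_space A M =
    \<lparr>carrier = carrier M, monoid.mult = monoid.mult M, one = one M,
     zero = zero M, add = add M, smult = (\<lambda>c m. (c \<odot>\<^bsub>A\<^esub> \<one>\<^bsub>A\<^esub>) \<odot>\<^bsub>M\<^esub> m)\<rparr>"

definition fd_left_module ::
  "('k, 'b) ring_scheme \<Rightarrow> ('k, 'a, 'c) module_scheme \<Rightarrow> ('a, 'v, 'd) module_scheme \<Rightarrow> bool" where
  "fd_left_module K A M \<longleftrightarrow>
    left_module A M \<and> vectorspace.fin_dim K (underlying_space A M)"

text \<open>Arrows are triples \<open>(M, \<theta>, N)\<close> of source, map and target. The map is extensional on the
  carrier of its source, so that arrows are equal iff they agree as maps on the carrier.
  All modules have their carrier inside one fixed type \<open>'v\<close>. If \<open>K\<close> is countable, as the algebraic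
  closure of a finite field is, every finite-dimensional module is isomorphic to one with carrier
  in any given infinite type, so the only condition needed on \<open>'v\<close> is that it be infinite.\<close>

definition mod_cat ::
  "('k, 'b) ring_scheme \<Rightarrow> ('k, 'a, 'c) module_scheme \<Rightarrow>
   (('a, 'v) module, ('a, 'v) module \<times> ('v \<Rightarrow> 'v) \<times> ('a, 'v) module) cat" where
  "mod_cat K A =
    \<lparr>obj = {M. fd_left_module K A M},
     arr = {(M, \<theta>, N). fd_left_module K A M \<and> fd_left_module K A N \<and>
       \<theta> \<in> module_hom A M N \<and> \<theta> \<in> extensional (carrier M)},
     src = (\<lambda>(M, \<theta>, N). M),
     tgt = (\<lambda>(M, \<theta>, N). N),
     ident = (\<lambda>M. (M, \<lambda>m \<in> carrier M. m, M)),
     comp_arr = (\<lambda>(M', \<theta>', N') (M, \<theta>, N). (M, compose (carrier M) \<theta>' \<theta>, N'))\<rparr>"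


section \<open>Frobenius maps\<close>

definition frobenius_map ::
  "('k, 'b) ring_scheme \<Rightarrow> 'k set \<Rightarrow> ('k, 'v, 'c) module_scheme \<Rightarrow> ('v \<Rightarrow> 'v) \<Rightarrow> bool" where
  "frobenius_map K Fq V F \<longleftrightarrow>
    linear_map (K\<lparr>carrier := Fq\<rparr>) V V F \<and> bij_betw F (carrier V) (carrier V) \<and>
    (\<forall>c \<in> carrier K. \<forall>v \<in> carrier V. F (c \<odot>\<^bsub>V\<^esub> v) = (c [^]\<^bsub>K\<^esub> card Fq) \<odot>\<^bsub>V\<^esub> F v) \<and>
    (\<forall>v \<in> carrier V. \<exists>n>0. (F ^^ n) v = v)"

definition frobenius_morphism ::
  "('k, 'b) ring_scheme \<Rightarrow> 'k set \<Rightarrow> ('k, 'a, 'c) module_scheme \<Rightarrow> ('a \<Rightarrow> 'a) \<Rightarrow> bool" where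
  "frobenius_morphism K Fq A F \<longleftrightarrow> frobenius_map K Fq A F \<and> F \<in> ring_iso A A"

definition fixed_algebra ::
  "('k, 'a, 'c) module_scheme \<Rightarrow> ('a \<Rightarrow> 'a) \<Rightarrow> ('k, 'a, 'c) module_scheme" where
  "fixed_algebra A F = A\<lparr>carrier := {a \<in> carrier A. F a = a}\<rparr>"

definition F_module ::
  "('k, 'b) ring_scheme \<Rightarrow> 'k set \<Rightarrow> ('k, 'a, 'c) module_scheme \<Rightarrow> ('a \<Rightarrow> 'a) \<Rightarrow>
   ('a, 'v) module \<times> ('v \<Rightarrow> 'v) \<Rightarrow> bool" where
  "F_module K Fq A FA = (\<lambda>(M, FM). fd_left_module K A M \<and>
    frobenius_map K Fq (underlying_space A M) FM \<and>
    (\<forall>a \<in> carrier A. \<forall>m \<in> carrier M. FM (a \<odot>\<^bsub>M\<^esub> m) = FA a \<odot>\<^bsub>M\<^esub> FM m))"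

definition modF_cat ::
  "('k, 'b) ring_scheme \<Rightarrow> 'k set \<Rightarrow> ('k, 'a, 'c) module_scheme \<Rightarrow> ('a \<Rightarrow> 'a) \<Rightarrow>
   (('a, 'v) module \<times> ('v \<Rightarrow> 'v),
    (('a, 'v) module \<times> ('v \<Rightarrow> 'v)) \<times> ('v \<Rightarrow> 'v) \<times> (('a, 'v) module \<times> ('v \<Rightarrow> 'v))) cat" where
  "modF_cat K Fq A FA =
    \<lparr>obj = {U. F_module K Fq A FA U},
     arr = {((M, F), \<theta>, (M', F')). F_module K Fq A FA (M, F) \<and> F_module K Fq A FA (M', F') \<and>
       \<theta> \<in> module_hom A M M' \<and> \<theta> \<in> extensional (carrier M) \<and>
       (\<forall>m \<in> carrier M. \<theta> (F m) = F' (\<theta> m))},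
     src = (\<lambda>(U, \<theta>, V). U),
     tgt = (\<lambda>(U, \<theta>, V). V),
     ident = (\<lambda>U. (U, \<lambda>m \<in> carrier (fst U). m, U)),
     comp_arr = (\<lambda>(U', \<theta>', V') (U, \<theta>, V). (U, compose (carrier (fst U)) \<theta>' \<theta>, V'))\<rparr>"

end

theory Submission
  imports Defs "HOL-Algebra.Multiplicative_Group" "HOL-Library.Countable_Set"
begin

text \<open>Let \<open>V\<close> be a \<open>k\<close>-space with a Frobenius map \<open>F\<close>. If \<open>F\<^sup>N v = v\<close>, then for every \<open>l\<close> in the field with
  \<open>q\<^sup>N\<close> elements the trace \<open>Tr (l v) = \<Sum>\<^bsub>j < N\<^esub> F\<^sup>j (l v)\<close> is a fixed point, and since
  \<open>\<Sum>\<^bsub>l \<noteq> 0\<^esub> - l\<inverse> l\<^bsup>q^j\<^esup>\<close> is \<open>1\<close> for \<open>j = 0\<close> and \<open>0\<close> for \<open>0 < j < N\<close>, we get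
  \<open>v = \<Sum>\<^bsub>l \<noteq> 0\<^esub> - l\<inverse> Tr (l v)\<close>. This one formula shows that \<open>V\<close> is spanned by its fixed points, that
  every \<open>F\<^sub>q\<close>-linear map on the fixed points has a unique \<open>k\<close>-linear extension to \<open>V\<close>, that \<open>V\<close> is finite
  dimensional iff its set of fixed points is finite, and that surjections compatible with \<open>F\<close> remain
  surjective on fixed points.

  Consequently taking fixed points is a fully faithful functor on \<open>F\<close>-stable modules. It is essentially
  surjective because for an \<open>A\<^sup>F\<close>-module with basis \<open>S\<close> over \<open>F\<^sub>q\<close> the action of \<open>A\<^sup>F\<close> on \<open>F\<^sub>q\<^sup>S\<close> extends to an
  action of \<open>A\<close> on \<open>k\<^sup>S\<close>. Kernels, cokernels and biproducts of \<open>F\<close>-stable modules are the usual ones.\<close>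

section \<open>Finite subfields of the algebraic closure\<close>

lemma (in domain) nat_pow_eq_zero:
  "x \<in> carrier R \<Longrightarrow> x [^] (n::nat) = \<zero> \<Longrightarrow> x = \<zero>"
  by (induction n) (auto simp: integral_iff)

lemma (in cring) binomial_expansion:
  assumes x: "x \<in> carrier R" and y: "y \<in> carrier R"
  shows "(x \<oplus> y) [^] (n::nat) =
    (\<Oplus>k\<in>{..n}. [(n choose k)] \<cdot> (x [^] k \<otimes> y [^] (n - k)))"
proof (induction n)
  case 0
  show ?case using x y by (simp add: Pi_def)
next
  case (Suc n)
  define a where "a k = [(n choose k)] \<cdot> (x [^] Suc k \<otimes> y [^] (n - k))" for k
  define b where "b k = [(n choose k)] \<cdot> (x [^] k \<otimes> y [^] (Suc n - k))" for k
  have ac: "a k \<in> carrier R" and bc: "b k \<in> carrier R" for k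
    using x y by (simp_all add: a_def b_def)
  have xa: "[(n choose k)] \<cdot> (x [^] k \<otimes> y [^] (n - k)) \<otimes> x = a k" for k
  proof -
    have "[(n choose k)] \<cdot> (x [^] k \<otimes> y [^] (n - k)) \<otimes> x
        = [(n choose k)] \<cdot> (x [^] k \<otimes> y [^] (n - k) \<otimes> x)"
      using x y by (simp add: add_pow_ldistr)
    moreover have "x [^] k \<otimes> y [^] (n - k) \<otimes> x = x [^] Suc k \<otimes> y [^] (n - k)"
      using x y by (simp add: m_ac)
    ultimately show ?thesis by (simp add: a_def)
  qed
  have yb: "[(n choose k)] \<cdot> (x [^] k \<otimes> y [^] (n - k)) \<otimes> y = b k" if "k \<le> n" for k
  proof -
    have "[(n choose k)] \<cdot> (x [^] k \<otimes> y [^] (n - k)) \<otimes> y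
        = [(n choose k)] \<cdot> (x [^] k \<otimes> y [^] (n - k) \<otimes> y)"
      using x y by (simp add: add_pow_ldistr)
    moreover have "x [^] k \<otimes> y [^] (n - k) \<otimes> y = x [^] k \<otimes> y [^] (Suc n - k)"
      using x y that by (simp add: m_assoc Suc_diff_le)
    ultimately show ?thesis by (simp add: b_def)
  qed
  let ?t = "\<lambda>k. [(n choose k)] \<cdot> (x [^] k \<otimes> y [^] (n - k))"
  have "(x \<oplus> y) [^] Suc n = (\<Oplus>k\<in>{..n}. ?t k) \<otimes> (x \<oplus> y)"
    using Suc.IH by simp
  also have "\<dots> = (\<Oplus>k\<in>{..n}. ?t k) \<otimes> x \<oplus> (\<Oplus>k\<in>{..n}. ?t k) \<otimes> y"
    using x y by (simp add: r_distr Pi_def)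
  also have "(\<Oplus>k\<in>{..n}. ?t k) \<otimes> x = (\<Oplus>k\<in>{..n}. a k)"
    using x y by (subst finsum_ldistr) (auto simp: Pi_def xa)
  also have "(\<Oplus>k\<in>{..n}. ?t k) \<otimes> y = (\<Oplus>k\<in>{..n}. ?t k \<otimes> y)"
    using x y by (subst finsum_ldistr) (auto simp: Pi_def)
  also have "\<dots> = (\<Oplus>k\<in>{..n}. b k)"
    by (rule finsum_cong') (auto simp: yb bc)
  \<comment> \<open>The new term carries the coefficient \<open>n choose Suc n = 0\<close>. It is
    added so that the sum of \<open>b\<close> can be shifted by one and matched with the sum of
    \<open>a\<close>.\<close>
  also have "\<dots> = (\<Oplus>k\<in>{..Suc n}. b k)"
    using bc by (simp add: Pi_def b_def[of "Suc n"] binomial_eq_0)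
  also have "\<dots> = (\<Oplus>k\<in>{..n}. b (Suc k)) \<oplus> b 0"
    using bc by (subst finsum_Suc2) auto
  also have "(\<Oplus>k\<in>{..n}. a k) \<oplus> ((\<Oplus>k\<in>{..n}. b (Suc k)) \<oplus> b 0)
      = (\<Oplus>k\<in>{..n}. a k \<oplus> b (Suc k)) \<oplus> b 0"
    using ac bc by (simp add: finsum_addf Pi_def a_assoc)
  \<comment> \<open>Pascal's rule, term by term.\<close>
  also have "(\<Oplus>k\<in>{..n}. a k \<oplus> b (Suc k))
      = (\<Oplus>k\<in>{..n}. [(Suc n choose Suc k)] \<cdot> (x [^] Suc k \<otimes> y [^] (Suc n - Suc k)))"
    using x y by (intro finsum_cong') (auto simp: a_def b_def add.nat_pow_mult add.commute)
  also have "b 0 = [(Suc n choose 0)] \<cdot> (x [^] (0::nat) \<otimes> y [^] (Suc n - 0))"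
    by (simp add: b_def)
  also have "(\<Oplus>k\<in>{..n}. [(Suc n choose Suc k)] \<cdot> (x [^] Suc k \<otimes> y [^] (Suc n - Suc k)))
      \<oplus> [(Suc n choose 0)] \<cdot> (x [^] (0::nat) \<otimes> y [^] (Suc n - 0))
      = (\<Oplus>k\<in>{..Suc n}. [(Suc n choose k)] \<cdot> (x [^] k \<otimes> y [^] (Suc n - k)))"
    by (rule finsum_Suc2[symmetric]) (use x y in auto)
  finally show ?case .
qed

text \<open>\<open>p\<close> divides the inner binomial coefficients, so only the two end terms
  survive. A commutative ring is taken instead of a field because the identity is applied in
  \<open>K\<close> and again in \<open>K[X]\<close>, where the roots of \<open>X^Q - X\<close> are
  counted.\<close>

lemma (in cring) prime_char_add_pow:
  assumes p: "Factorial_Ring.prime (p::nat)" and char: "[p] \<cdot> \<one> = \<zero>"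
    and x: "x \<in> carrier R" and y: "y \<in> carrier R"
  shows "(x \<oplus> y) [^] p = x [^] p \<oplus> y [^] p"
proof -
  define f where "f k = [(p choose k)] \<cdot> (x [^] k \<otimes> y [^] (p - k))" for k
  have fc: "f k \<in> carrier R" for k using x y by (simp add: f_def)
  have f0: "f k = \<zero>" if "0 < k" "k < p" for k
  proof -
    have "p dvd (p choose k)" using p that by (intro dvd_choose_prime) auto
    then obtain m where m: "p choose k = p * m" by blast
    let ?z = "x [^] k \<otimes> y [^] (p - k)"
    have z: "?z \<in> carrier R" using x y by simp
    have "[p] \<cdot> ?z = [p] \<cdot> \<one> \<otimes> ?z"
      using z by (simp add: add_pow_ldistr)
    hence "[p] \<cdot> ?z = \<zero>" using char z by simp
    hence "[(p * m)] \<cdot> ?z = \<zero>"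
      using z add.nat_pow_pow[of ?z m p] by simp
    thus ?thesis by (simp add: f_def m)
  qed
  obtain p' where p': "p = Suc p'" using p by (metis not0_implies_Suc not_prime_0)
  have p'0: "p' \<noteq> 0" using p p' by (metis One_nat_def not_prime_1)
  have "(x \<oplus> y) [^] p = (\<Oplus>k\<in>{..p}. f k)"
    unfolding f_def by (rule binomial_expansion[OF x y])
  also have "\<dots> = f (Suc p') \<oplus> (\<Oplus>k\<in>{..p'}. f k)"
    unfolding p' using fc by (simp add: Pi_def)
  also have "(\<Oplus>k\<in>{..p'}. f k) = (\<Oplus>k\<in>{..p'}. if k = 0 then f k else \<zero>)"
    by (rule finsum_cong') (auto simp: fc f0 p')
  also have "\<dots> = f 0"
    using fc add.finprod_singleton[of 0 "{..p'}" f] by simp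
  finally show ?thesis using x y by (simp add: f_def p')
qed

lemma (in cring) prime_char_add_pow_pow:
  assumes p: "Factorial_Ring.prime (p::nat)" and char: "[p] \<cdot> \<one> = \<zero>"
    and x: "x \<in> carrier R" and y: "y \<in> carrier R"
  shows "(x \<oplus> y) [^] (p ^ n) = x [^] (p ^ n) \<oplus> y [^] (p ^ n)"
proof (induction n)
  case 0
  show ?case using x y by simp
next
  case (Suc n)
  have e: "z [^] (p ^ Suc n) = (z [^] (p ^ n)) [^] p" if "z \<in> carrier R" for z
    using that by (simp add: nat_pow_pow mult.commute)
  show ?case using x y Suc.IH prime_char_add_pow[OF p char] by (simp only: e a_closed nat_pow_closed)
qed

section \<open>The algebraic closure of \<open>Fq\<close> and the powers of its Frobenius
  map\<close>

locale finite_base = algebraic_closure K Fq for K (structure) and Fq +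
  fixes p r :: nat
  assumes prime_p: "Factorial_Ring.prime p" and r_pos: "r > 0" and card_Fq: "card Fq = p ^ r"
begin

abbreviation q :: nat where "q \<equiv> card Fq"

lemma q_gt_1: "q > 1"
  using prime_p r_pos card_Fq prime_gt_1_nat by (metis one_less_power)

lemma finite_Fq: "finite Fq"
  using q_gt_1 by (metis card.infinite not_less_zero)

lemma Fq_subring: "subring Fq K"
  using subfield_axioms subfieldE(1) by blast

lemma Fq_field: "field (K\<lparr>carrier := Fq\<rparr>)"
  using subfield_iff(2)[OF subfield_axioms] .

lemma Fq_carrier: "x \<in> Fq \<Longrightarrow> x \<in> carrier K"
  using subringE(1)[OF Fq_subring] by blast

text \<open>Lagrange's theorem in the additive group of \<open>Fq\<close> gives
  \<open>p^r . 1 = 0\<close>. This element is the \<open>r\<close>-th power of \<open>p . 1\<close>,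
  and a field has no nonzero nilpotent elements.\<close>

lemma char_p: "[p] \<cdot> \<one> = \<zero>"
proof -
  interpret F: field "K\<lparr>carrier := Fq\<rparr>" by (rule Fq_field)
  have "[q] \<cdot>\<^bsub>K\<lparr>carrier := Fq\<rparr>\<^esub> \<one> = \<zero>"
    using F.add.pow_order_eq_1[of "\<one>"] F.one_closed by (simp add: Coset.order_def)
  moreover have "[n] \<cdot>\<^bsub>K\<lparr>carrier := Fq\<rparr>\<^esub> x = [n] \<cdot> x" for n :: nat and x
    by (simp add: add_pow_def nat_pow_def)
  ultimately have "[(p ^ r)] \<cdot> \<one> = \<zero>" by (simp add: card_Fq)
  moreover have "[(p ^ n)] \<cdot> \<one> = ([p] \<cdot> \<one>) [^] n" for n
  proof (induction n)
    case (Suc n)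
    have "[(p ^ Suc n)] \<cdot> \<one> = [p] \<cdot> ([(p ^ n)] \<cdot> \<one>)"
      by (simp add: add.nat_pow_pow mult.commute)
    also have "\<dots> = [p] \<cdot> (\<one> \<otimes> ([p] \<cdot> \<one>) [^] n)" using Suc by simp
    also have "\<dots> = ([p] \<cdot> \<one>) \<otimes> ([p] \<cdot> \<one>) [^] n" by (rule add_pow_ldistr[symmetric]) auto
    finally show ?case by (simp add: m_comm)
  qed auto
  ultimately have "([p] \<cdot> \<one>) [^] r = \<zero>" by simp
  thus ?thesis using nat_pow_eq_zero[of "[p] \<cdot> \<one>" r] by simp
qed

lemma q_pow_p: "q ^ n = p ^ (r * n)"
  by (simp add: card_Fq power_mult)

lemma frob_add:
  "x \<in> carrier K \<Longrightarrow> y \<in> carrier K \<Longrightarrow> (x \<oplus> y) [^] (q ^ n) = x [^] (q ^ n) \<oplus> y [^] (q ^ n)"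
  unfolding q_pow_p by (rule prime_char_add_pow_pow[OF prime_p char_p])

lemma frob_zero: "\<zero> [^] (q ^ n) = \<zero>"
  using q_gt_1 by (simp add: nat_pow_zero)

lemma frob_frob: "x \<in> carrier K \<Longrightarrow> (x [^] (q ^ n)) [^] (q ^ m) = x [^] (q ^ (n + m))"
  by (simp add: nat_pow_pow power_add)

lemma frob_minus: "x \<in> carrier K \<Longrightarrow> (\<ominus> x) [^] (q ^ n) = \<ominus> (x [^] (q ^ n))"
  using frob_add[of "\<ominus> x" x n] frob_zero by (simp add: l_neg minus_equality)

lemma frob_inj:
  assumes "x \<in> carrier K" "y \<in> carrier K" "x [^] (q ^ n) = y [^] (q ^ n)"
  shows "x = y"
proof -
  have "(x \<oplus> \<ominus> y) [^] (q ^ n) = \<zero>"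
    using assms by (simp add: frob_add frob_minus r_neg)
  hence "x \<oplus> \<ominus> y = \<zero>" using assms nat_pow_eq_zero[of "x \<oplus> \<ominus> y" "q ^ n"] by simp
  thus ?thesis using assms by (simp add: minus_equality[symmetric] minus_minus add.inv_solve_right')
qed

lemma frob_finsum:
  assumes "finite I" "f \<in> I \<rightarrow> carrier K"
  shows "(\<Oplus>i\<in>I. f i) [^] (q ^ n) = (\<Oplus>i\<in>I. f i [^] (q ^ n))"
  using assms by (induction I) (auto simp: frob_zero frob_add Pi_def)

text \<open>Lagrange's theorem in the multiplicative group of \<open>Fq\<close>, with zero treated
  apart.\<close>

lemma Fq_frob: assumes "x \<in> Fq" shows "x [^] q = x"
proof (cases "x = \<zero>")
  case True
  thus ?thesis using frob_zero[of 1] by simp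
next
  case False
  interpret F: field "K\<lparr>carrier := Fq\<rparr>" by (rule Fq_field)
  have pw: "y [^]\<^bsub>Multiplicative_Group.mult_of (K\<lparr>carrier := Fq\<rparr>)\<^esub> (n::nat) = y [^] n" for y n
    by (simp add: nat_pow_def)
  have "x [^]\<^bsub>Multiplicative_Group.mult_of (K\<lparr>carrier := Fq\<rparr>)\<^esub> Coset.order (Multiplicative_Group.mult_of (K\<lparr>carrier := Fq\<rparr>))
      = \<one>\<^bsub>Multiplicative_Group.mult_of (K\<lparr>carrier := Fq\<rparr>)\<^esub>"
    by (rule group.pow_order_eq_1[OF F.field_mult_group]) (use assms False in simp)
  hence "x [^] (q - 1) = \<one>"
    using finite_Fq F.zero_closed by (simp add: pw Coset.order_def card_Diff_singleton)
  hence "x [^] Suc (q - 1) = x" using Fq_carrier[OF assms] by simp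
  thus ?thesis using q_gt_1 by simp
qed

lemma eval_frob:
  assumes "set P \<subseteq> Fq" "x \<in> carrier K"
  shows "eval P (x [^] q) = (eval P x) [^] q"
  using assms
proof (induction P)
  case Nil
  then show ?case using frob_zero[of 1] by simp
next
  case (Cons a P)
  have a: "a \<in> carrier K" and P: "set P \<subseteq> carrier K" using Cons.prems Fq_carrier by auto
  have "(a \<otimes> x [^] length P \<oplus> eval P x) [^] q = (a \<otimes> x [^] length P) [^] q \<oplus> (eval P x) [^] q"
    using frob_add[of "a \<otimes> x [^] length P" "eval P x" 1] a P Cons.prems(2) eval_in_carrier by simp
  also have "(a \<otimes> x [^] length P) [^] q = a [^] q \<otimes> (x [^] length P) [^] q"
    using a Cons.prems by (simp add: nat_pow_distrib)
  also have "(x [^] length P) [^] q = (x [^] q) [^] length P"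
    using Cons.prems by (simp add: nat_pow_pow mult.commute)
  finally show ?case using Cons Fq_frob[of a] by simp
qed

text \<open>The map \<open>x \<mapsto> x^q\<close> preserves the finite root set of a polynomial
  over \<open>Fq\<close> that annihilates \<open>x\<close>. Hence two iterates of \<open>x\<close>
  coincide, and injectivity of Frobenius cancels the smaller exponent.\<close>

lemma scalar_periodic:
  assumes x: "x \<in> carrier K" shows "\<exists>N>0. x [^] (q ^ N) = x"
proof -
  obtain P where P: "P \<in> carrier (Fq [X])" "P \<noteq> []" "eval P x = \<zero>"
    using algebraicE[OF Fq_subring x algebraic_extension[OF x]] by blast
  have PF: "set P \<subseteq> Fq" using P by (metis polynomial_incl univ_poly_carrier)
  have Pc: "P \<in> carrier (poly_ring K)"
    using P(1) carrier_polynomial[OF Fq_subring] univ_poly_carrier by blast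
  have rt: "is_root P (x [^] (q ^ i))" for i
  proof (induction i)
    case 0
    then show ?case using x P by (simp add: is_root_def)
  next
    case (Suc i)
    have "eval P ((x [^] (q ^ i)) [^] q) = (eval P (x [^] (q ^ i))) [^] q"
      using eval_frob[OF PF] x by simp
    hence "eval P (x [^] (q ^ Suc i)) = \<zero>"
      using Suc frob_zero[of 1] frob_frob[OF x, of i 1] by (simp add: is_root_def mult.commute)
    thus ?case using x P(2) by (simp add: is_root_def)
  qed
  have "finite (range (\<lambda>i. x [^] (q ^ i)))"
    by (rule finite_subset[OF _ finite_number_of_roots[OF Pc]]) (use rt in auto)
  hence "\<not> inj (\<lambda>i. x [^] (q ^ i))" using finite_imageD infinite_UNIV_nat by blast
  then obtain i j :: nat where "i \<noteq> j" "x [^] (q ^ i) = x [^] (q ^ j)"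
    unfolding inj_on_def by blast
  then obtain i j :: nat where ij: "i < j" "x [^] (q ^ i) = x [^] (q ^ j)"
    by (metis linorder_neqE_nat)
  have "x [^] (q ^ j) = (x [^] (q ^ (j - i))) [^] (q ^ i)"
    using frob_frob[OF x, of "j - i" i] ij(1) by simp
  hence "x [^] (q ^ i) = (x [^] (q ^ (j - i))) [^] (q ^ i)" by (simp only: ij(2))
  hence "x = x [^] (q ^ (j - i))"
    by (rule frob_inj[rotated 2]) (use x in simp_all)
  hence "x [^] (q ^ (j - i)) = x" by (rule sym)
  moreover have "j - i > 0" using ij(1) by simp
  ultimately show ?thesis by blast
qed

section \<open>The subfields fixed by powers of Frobenius\<close>

definition E :: "nat \<Rightarrow> 'a set" where
  "E N = {x \<in> carrier K. x [^] (q ^ N) = x}"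


lemma E_carrier: "x \<in> E N \<Longrightarrow> x \<in> carrier K" by (simp add: E_def)

lemma E_zero: "\<zero> \<in> E N" by (simp add: E_def frob_zero)

lemma E_one: "\<one> \<in> E N" by (simp add: E_def)

lemma E_mult: "x \<in> E N \<Longrightarrow> y \<in> E N \<Longrightarrow> x \<otimes> y \<in> E N"
  by (simp add: E_def nat_pow_distrib)

lemma E_inv:
  assumes "x \<in> E N" "x \<noteq> \<zero>" shows "inv x \<in> E N"
proof -
  have x: "x \<in> Units K" "x \<in> carrier K" "x [^] (q ^ N) = x"
    using assms by (auto simp: E_def field_Units)
  have "(inv x) [^] (q ^ N) \<otimes> x = (inv x \<otimes> x) [^] (q ^ N)"
  proof -
    have "(inv x \<otimes> x) [^] (q ^ N) = (inv x) [^] (q ^ N) \<otimes> x [^] (q ^ N)"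
      by (rule nat_pow_distrib) (use x in auto)
    thus ?thesis by (simp only: x(3))
  qed
  also have "\<dots> = inv x \<otimes> x" using x by simp
  finally have "(inv x) [^] (q ^ N) \<otimes> x = inv x \<otimes> x" .
  hence "(inv x) [^] (q ^ N) = inv x"
    by (subst (asm) m_rcancel) (use x assms(2) in auto)
  thus ?thesis using x by (simp add: E_def)
qed

text \<open>Passing to a multiple of \<open>N\<close> loses nothing; this lets finitely many scalars
  share one exponent, namely the product of their own.\<close>

lemma E_dvd:
  assumes "x \<in> E N" "N dvd M" shows "x \<in> E M"
proof -
  obtain d where d: "M = N * d" using assms by blast
  have "x [^] (q ^ (N * d)) = x"
  proof (induction d)
    case (Suc d)
    thus ?case using assms(1) frob_frob[of x N "N * d"] by (simp add: E_def)
  qed (use assms E_carrier in simp)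
  thus ?thesis using assms d by (simp add: E_def)
qed

text \<open>\<open>E N\<close> is the root set of \<open>P = X^Q - X\<close>, which splits in
  \<open>K\<close>, so it remains to see that the roots are simple. No derivative is taken: at a
  root \<open>a\<close> put \<open>Y = X - a\<close>. Frobenius in \<open>K[X]\<close> gives
  \<open>P = Y^Q - Y = Y (Y^(Q-1) - 1)\<close>, and the second factor takes the value
  \<open>-1\<close> at \<open>a\<close>. The assumption \<open>N > 0\<close> excludes
  \<open>E 0\<close>, which is all of \<open>K\<close>.\<close>

lemma card_E:
  assumes N: "N > 0" shows "card (E N) = q ^ N" and "finite (E N)"
proof -
  define Q where "Q = q ^ N"
  have Q: "Q > 1" unfolding Q_def using q_gt_1 N by (rule one_less_power)
  let ?UP = "poly_ring K"
  interpret UP: domain ?UP by (rule univ_poly_is_domain[OF carrier_is_subring])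
  interpret c: ring_hom_ring K ?UP poly_of_const
    using canonical_embedding_ring_hom[OF carrier_is_subring] by simp
  define P where "P = poly_add (monom \<one> Q) (monom (\<ominus> \<one>) 1)"
  have m1: "\<ominus> \<one> \<noteq> \<zero>" using add.inv_eq_1_iff by auto
  have pol: "polynomial Fq (monom \<one> Q)" "polynomial Fq (monom (\<ominus> \<one>) 1)"
    using subringE(3,5)[OF Fq_subring] m1
    by (auto intro!: monom_is_polynomial[OF Fq_subring])
  \<comment> \<open>That the coefficients lie in \<open>Fq\<close> matters:
    \<open>roots_over_subfield\<close> splits polynomials over the base field.\<close>
  have P_Fq: "P \<in> carrier (Fq [X])"
    unfolding P_def univ_poly_carrier[symmetric]
    by (rule poly_add_closed[OF Fq_subring pol])
  have P: "P \<in> carrier ?UP"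
    using P_Fq carrier_polynomial[OF Fq_subring] univ_poly_carrier by blast
  have deg: "degree P = Q"
    unfolding P_def using poly_add_degree_eq[OF Fq_subring pol] Q by (simp add: monom_def)
  hence P0: "P \<noteq> []" using Q by auto
  have ev: "eval P x = x [^] Q \<oplus> \<ominus> x" if x: "x \<in> carrier K" for x
  proof -
    have "eval P x = eval (monom \<one> Q) x \<oplus> eval (monom (\<ominus> \<one>) 1) x"
      unfolding P_def by (rule eval_poly_add) (auto simp: monom_def x)
    thus ?thesis using x by (simp add: eval_monom l_minus)
  qed
  have root: "is_root P x \<longleftrightarrow> x \<in> E N" for x
  proof (cases "x \<in> carrier K")
    case True
    have "x [^] Q \<oplus> \<ominus> x = \<zero> \<longleftrightarrow> x [^] Q = x"
      using True r_neg minus_equality minus_minus by (metis a_inv_closed nat_pow_closed)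
    thus ?thesis using True P0 ev by (simp add: is_root_def E_def Q_def)
  qed (simp add: is_root_def E_def)
  let ?Xv = "X" and ?c = poly_of_const
  have X: "X \<in> carrier ?UP" by (rule var_closed[OF carrier_is_subring])
  \<comment> \<open>The form with \<open>monom\<close> suits degree and evaluation; this one is a
    ring expression, to which Frobenius in \<open>K[X]\<close> applies.\<close>
  have P_eq: "P = X [^]\<^bsub>?UP\<^esub> Q \<oplus>\<^bsub>?UP\<^esub> \<ominus>\<^bsub>?UP\<^esub> X"
  proof -
    have "monom (\<ominus> \<one>) 1 = [\<ominus> \<one>] \<otimes>\<^bsub>?UP\<^esub> X [^]\<^bsub>?UP\<^esub> (1::nat)"
      using monom_eq_var_pow[OF carrier_is_subring, of "\<ominus> \<one>" 1] m1 by simp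
    also have "[\<ominus> \<one>] = ?c (\<ominus> \<one>)" using m1 by (simp add: poly_of_const_def)
    also have "\<dots> = \<ominus>\<^bsub>?UP\<^esub> \<one>\<^bsub>?UP\<^esub>" by simp
    finally have "monom (\<ominus> \<one>) 1 = \<ominus>\<^bsub>?UP\<^esub> X" using X by (simp add: UP.l_minus)
    thus ?thesis
      unfolding P_def using unitary_monom_eq_var_pow[OF carrier_is_subring, of Q]
      by (simp add: univ_poly_add)
  qed
  have char: "[p] \<cdot>\<^bsub>?UP\<^esub> \<one>\<^bsub>?UP\<^esub> = \<zero>\<^bsub>?UP\<^esub>"
  proof -
    have "?c ([n] \<cdot> \<one>) = [n] \<cdot>\<^bsub>?UP\<^esub> \<one>\<^bsub>?UP\<^esub>" for n :: nat
      by (induction n) (auto simp: add.nat_pow_Suc UP.add.nat_pow_Suc simp del: UP.add.nat_pow_Suc2)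
    from this[of p] show ?thesis using char_p by simp
  qed
  have simple: "alg_mult P a \<le> 1" if a: "a \<in> E N" for a
  proof (rule ccontr)
    have aK: "a \<in> carrier K" using a E_carrier by blast
    let ?Y = "[\<one>, \<ominus> a]"
    have Y: "?Y \<in> carrier ?UP"
      using aK unfolding sym[OF univ_poly_carrier] polynomial_def by auto
    have ca: "?c a \<in> carrier ?UP" using aK by simp
    assume "\<not> alg_mult P a \<le> 1"
    hence "(?Y [^]\<^bsub>?UP\<^esub> (2::nat)) pdivides P"
      by (intro le_alg_mult_imp_pdivides[OF aK P]) simp
    then obtain g where g: "g \<in> carrier ?UP" "P = ?Y [^]\<^bsub>?UP\<^esub> (2::nat) \<otimes>\<^bsub>?UP\<^esub> g"
      unfolding pdivides_def factor_def by blast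
    have XY: "X = ?Y \<oplus>\<^bsub>?UP\<^esub> ?c a"
      using aK by (auto simp: univ_poly_add poly_of_const_def var_def l_neg)
    have "X [^]\<^bsub>?UP\<^esub> Q = ?Y [^]\<^bsub>?UP\<^esub> Q \<oplus>\<^bsub>?UP\<^esub> (?c a) [^]\<^bsub>?UP\<^esub> Q"
      unfolding XY Q_def q_pow_p
      by (rule UP.prime_char_add_pow_pow[OF prime_p char Y ca])
    also have "(?c a) [^]\<^bsub>?UP\<^esub> Q = ?c a"
      using c.hom_nat_pow[OF aK, of Q] a by (simp add: E_def Q_def)
    finally have PY: "P = ?Y [^]\<^bsub>?UP\<^esub> Q \<oplus>\<^bsub>?UP\<^esub> \<ominus>\<^bsub>?UP\<^esub> ?Y"
      unfolding P_eq using Y ca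
      by (simp add: XY UP.minus_add UP.a_ac UP.r_neg) (simp add: UP.a_assoc[symmetric] UP.r_neg)
    have "?Y \<otimes>\<^bsub>?UP\<^esub> (?Y [^]\<^bsub>?UP\<^esub> (Q - 1) \<oplus>\<^bsub>?UP\<^esub> \<ominus>\<^bsub>?UP\<^esub> \<one>\<^bsub>?UP\<^esub>) = P"
    proof -
      have "?Y \<otimes>\<^bsub>?UP\<^esub> ?Y [^]\<^bsub>?UP\<^esub> (Q - 1) = ?Y [^]\<^bsub>?UP\<^esub> Suc (Q - 1)"
        using Y UP.nat_pow_Suc2 by metis
      thus ?thesis using Y Q by (simp add: PY UP.r_distr UP.r_minus)
    qed
    also have "P = ?Y \<otimes>\<^bsub>?UP\<^esub> (?Y \<otimes>\<^bsub>?UP\<^esub> g)"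
      using g Y by (simp add: numeral_2_eq_2 UP.m_assoc)
    finally have "?Y [^]\<^bsub>?UP\<^esub> (Q - 1) \<oplus>\<^bsub>?UP\<^esub> \<ominus>\<^bsub>?UP\<^esub> \<one>\<^bsub>?UP\<^esub> = ?Y \<otimes>\<^bsub>?UP\<^esub> g"
      by (subst (asm) UP.m_lcancel) (use Y g in \<open>auto simp: univ_poly_zero\<close>)
    moreover interpret e: ring_hom_ring ?UP K "\<lambda>P. eval P a"
      by (rule eval_ring_hom[OF carrier_is_subring aK])
    have "eval ?Y a = \<zero>" using aK by (simp add: r_neg)
    \<comment> \<open>If \<open>Y^2\<close> divides \<open>P\<close>, cancelling one
      \<open>Y\<close> and evaluating at \<open>a\<close> leaves this. It is absurd because
      \<open>Q > 1\<close> makes the power of zero vanish.\<close>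
    ultimately have "\<zero> [^] (Q - 1) \<oplus> \<ominus> \<one> = \<zero>"
      using e.hom_add[of "?Y [^]\<^bsub>?UP\<^esub> (Q - 1)" "\<ominus>\<^bsub>?UP\<^esub> \<one>\<^bsub>?UP\<^esub>"] e.hom_mult[OF Y g(1)]
        e.hom_nat_pow[OF Y, of "Q - 1"] Y g(1)
      by (simp del: eval.simps)
    thus False using Q m1 by (simp add: nat_pow_zero)
  qed
  have set: "set_mset (roots P) = E N"
    using roots_mem_iff_is_root[OF P] root by blast
  show "finite (E N)" unfolding set[symmetric] by simp
  have "count (roots P) a = 1" if "a \<in> E N" for a
  proof -
    have "a \<in># roots P" using that set by simp
    hence "0 < count (roots P) a" by (simp only: count_greater_zero_iff)
    moreover have "count (roots P) a \<le> 1"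
      using simple[OF that] alg_mult_eq_count_roots[OF P] by simp
    ultimately show ?thesis by linarith
  qed
  hence "(\<Sum>a\<in>E N. count (roots P) a) = (\<Sum>a\<in>E N. 1)" by (intro sum.cong) auto
  hence "size (roots P) = card (E N)"
    using size_multiset_overloaded_eq[of "roots P"] set by simp
  moreover have "size (roots P) = Q"
    using roots_over_subfield[OF P_Fq] deg by (simp add: splitted_def)
  ultimately show "card (E N) = q ^ N" by (simp add: Q_def)
qed

text \<open>\<open>Fq\<close> is contained in \<open>E 1\<close>, and both have \<open>q\<close>
  elements.\<close>

lemma Fq_iff: "x \<in> Fq \<longleftrightarrow> x \<in> E 1"
proof -
  have "Fq = E 1"
  proof (rule card_subset_eq)
    show "Fq \<subseteq> E 1"
    proof
      fix x assume "x \<in> Fq"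
      thus "x \<in> E 1" using Fq_frob[of x] Fq_carrier[of x] by (simp add: E_def)
    qed
    show "finite (E 1)" by (rule card_E) simp
    show "card Fq = card (E 1)" using card_E(1)[of 1] by simp
  qed
  thus ?thesis by blast
qed

text \<open>A power sum over the nonzero elements \<open>l\<close> of \<open>E N\<close>: it makes \<open>- l\<inverse>\<close> the coefficients that recover
  a vector from the traces of its multiples by \<open>l\<close>.\<close>

lemma dual_sum:
  assumes j: "j < N"
  shows "(\<Oplus>l\<in>E N - {\<zero>}. (\<ominus> (inv l)) \<otimes> l [^] (q ^ j)) = (if j = 0 then \<one> else \<zero>)"
proof -
  have N: "N > 0" using j by simp
  have fin: "finite (E N - {\<zero>})" using card_E[OF N] by simp
  have inE: "inv l \<in> carrier K" "l \<in> carrier K" "l \<in> Units K" if "l \<in> E N - {\<zero>}" for l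
    using that E_carrier by (auto simp: field_Units)
  show ?thesis
  proof (cases "j = 0")
    case True
    have "(\<Oplus>l\<in>E N - {\<zero>}. (\<ominus> (inv l)) \<otimes> l [^] (q ^ j)) = (\<Oplus>l\<in>E N - {\<zero>}. \<ominus> \<one>)"
      using True inE by (intro finsum_cong') (auto simp: l_minus)
    also have "\<dots> = [card (E N - {\<zero>})] \<cdot> (\<ominus> \<one>)"
      by (rule add.finprod_const) simp
    also have "card (E N - {\<zero>}) = q ^ N - 1"
      using card_E[OF N] E_zero by (simp add: card_Diff_singleton)
    \<comment> \<open>\<open>q^N\<close> is a multiple of the characteristic, so one copy of
      \<open>-1\<close> less than \<open>q^N\<close> copies add up to \<open>1\<close>. This is the
      origin of the minus sign in \<open>- inv l\<close>.\<close>
    also have "[(q ^ N - 1)] \<cdot> (\<ominus> \<one>) = \<one>"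
    proof -
      have "[(q ^ N - 1)] \<cdot> (\<ominus> \<one>) \<oplus> \<ominus> \<one> = [Suc (q ^ N - 1)] \<cdot> (\<ominus> \<one>)"
        by (rule add.nat_pow_Suc[symmetric])
      also have "Suc (q ^ N - 1) = p * p ^ (r * N - 1)"
      proof -
        have "r * N = Suc (r * N - 1)" using N r_pos by simp
        hence "q ^ N = p * p ^ (r * N - 1)" unfolding q_pow_p by (metis power_Suc)
        moreover have "0 < q ^ N" using q_gt_1 by simp
        hence "Suc (q ^ N - 1) = q ^ N" by (rule Suc_diff_1)
        ultimately show ?thesis by (simp only:)
      qed
      also have "[(p * p ^ (r * N - 1))] \<cdot> (\<ominus> \<one>) = [(p ^ (r * N - 1))] \<cdot> ([p] \<cdot> (\<ominus> \<one>))"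
        using add.nat_pow_pow[of "\<ominus> \<one>" "p ^ (r * N - 1)" p] by simp
      also have "[p] \<cdot> (\<ominus> \<one>) = \<zero>"
        using add_pow_ldistr[of \<one> "\<ominus> \<one>" p] char_p by simp
      finally show ?thesis
        using minus_equality[of "[(q ^ N - 1)] \<cdot> (\<ominus> \<one>)" "\<ominus> \<one>"] by (simp add: minus_minus)
    qed
    finally show ?thesis using True by simp
  next
    case False
    \<comment> \<open>The sets have \<open>q^N > q^j\<close> elements, so some \<open>m\<close> in
      \<open>E N\<close> has \<open>m^(q^j) \<noteq> m\<close>. Replacing \<open>l\<close> by
      \<open>m l\<close> permutes the index set and multiplies the sum by \<open>inv m\<close> times
      \<open>m^(q^j)\<close>, which is not \<open>1\<close>; hence the sum is zero.\<close>
    have "\<not> E N \<subseteq> E j"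
    proof
      assume "E N \<subseteq> E j"
      hence "q ^ N \<le> q ^ j" using card_E[OF N] card_E[of j] False card_mono[of "E j" "E N"] by simp
      thus False using j q_gt_1 by simp
    qed
    then obtain m where m: "m \<in> E N" "m \<notin> E j" by blast
    have m0: "m \<noteq> \<zero>" using m E_zero by auto
    have mE: "m \<in> E N - {\<zero>}" using m m0 by simp
    note mc = inE[OF mE]
    define f where "f l = (\<ominus> (inv l)) \<otimes> l [^] (q ^ j)" for l
    have fc: "f l \<in> carrier K" if "l \<in> E N - {\<zero>}" for l using inE[OF that] by (simp add: f_def)
    have cancel: "m \<otimes> x = m \<otimes> y \<longleftrightarrow> x = y" if "x \<in> E N" "y \<in> E N" for x y
      using m_lcancel[OF m0 mc(2)] that E_carrier by blast
    have bij: "(\<lambda>l. m \<otimes> l) ` (E N - {\<zero>}) = E N - {\<zero>}"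
    proof (rule endo_inj_surj[OF fin])
      show "(\<lambda>l. m \<otimes> l) ` (E N - {\<zero>}) \<subseteq> E N - {\<zero>}"
        using mc m0 m(1) E_mult inE by (auto simp: integral_iff)
      show "inj_on (\<lambda>l. m \<otimes> l) (E N - {\<zero>})"
        by (auto intro!: inj_onI simp: cancel)
    qed
    define S where "S = (\<Oplus>l\<in>E N - {\<zero>}. f l)"
    have Sc: "S \<in> carrier K" unfolding S_def using fc by (simp add: Pi_def)
    have "S = (\<Oplus>l\<in>(\<lambda>l. m \<otimes> l) ` (E N - {\<zero>}). f l)" by (simp add: bij S_def)
    also have "\<dots> = (\<Oplus>l\<in>E N - {\<zero>}. f (m \<otimes> l))"
      by (rule finsum_reindex) (use fc bij in \<open>auto intro!: inj_onI simp: cancel\<close>)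
    also have "\<dots> = (\<Oplus>l\<in>E N - {\<zero>}. (inv m \<otimes> m [^] (q ^ j)) \<otimes> f l)"
    proof (rule finsum_cong')
      fix l assume l: "l \<in> E N - {\<zero>}"
      have "inv (m \<otimes> l) = inv m \<otimes> inv l"
        using mc inE[OF l] by (intro inv_unique'[symmetric]) (auto simp: m_ac)
      thus "f (m \<otimes> l) = (inv m \<otimes> m [^] (q ^ j)) \<otimes> f l"
        using mc inE[OF l] by (simp add: f_def nat_pow_distrib l_minus r_minus m_ac)
    qed (use fc mc in auto)
    also have "\<dots> = (inv m \<otimes> m [^] (q ^ j)) \<otimes> S"
      unfolding S_def by (rule finsum_rdistr[symmetric]) (use fc mc fin in auto)
    finally have eq: "S = (inv m \<otimes> m [^] (q ^ j)) \<otimes> S" .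
    have "S = \<zero>"
    proof (rule ccontr)
      assume S0: "S \<noteq> \<zero>"
      have "\<one> \<otimes> S = (inv m \<otimes> m [^] (q ^ j)) \<otimes> S" using eq Sc by simp
      hence "\<one> = inv m \<otimes> m [^] (q ^ j)" using S0 Sc mc by (subst (asm) m_rcancel) auto
      hence "m \<otimes> \<one> = m \<otimes> (inv m \<otimes> m [^] (q ^ j))" by simp
      hence "m = m [^] (q ^ j)" using mc by (simp add: m_assoc[symmetric])
      thus False using m mc by (simp add: E_def)
    qed
    thus ?thesis using False by (simp add: S_def f_def)
  qed
qed


end

section \<open>Frobenius spaces\<close>

lemma (in abelian_monoid) finsum_commute:
  assumes "finite I" "finite J" "\<And>i j. i \<in> I \<Longrightarrow> j \<in> J \<Longrightarrow> f i j \<in> carrier G"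
  shows "(\<Oplus>i\<in>I. \<Oplus>j\<in>J. f i j) = (\<Oplus>j\<in>J. \<Oplus>i\<in>I. f i j)"
  using assms(1,3)
proof (induction I)
  case empty
  then show ?case using assms(2) by simp
next
  case (insert x I)
  have "(\<Oplus>i\<in>insert x I. \<Oplus>j\<in>J. f i j) = (\<Oplus>j\<in>J. f x j) \<oplus> (\<Oplus>i\<in>I. \<Oplus>j\<in>J. f i j)"
    using insert by (intro finsum_insert) auto
  also have "\<dots> = (\<Oplus>j\<in>J. f x j) \<oplus> (\<Oplus>j\<in>J. \<Oplus>i\<in>I. f i j)"
    using insert by simp
  also have "\<dots> = (\<Oplus>j\<in>J. f x j \<oplus> (\<Oplus>i\<in>I. f i j))"
    using insert by (intro finsum_addf[symmetric]) auto
  also have "\<dots> = (\<Oplus>j\<in>J. \<Oplus>i\<in>insert x I. f i j)"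
    using insert by (intro finsum_cong') auto
  finally show ?case .
qed

lemma (in abelian_monoid) finsum_induct:
  assumes "finite I" "\<And>i. i \<in> I \<Longrightarrow> f i \<in> carrier G \<and> P (f i)" "P \<zero>"
    "\<And>x y. x \<in> carrier G \<Longrightarrow> y \<in> carrier G \<Longrightarrow> P x \<Longrightarrow> P y \<Longrightarrow> P (x \<oplus> y)"
  shows "P (\<Oplus>i\<in>I. f i)"
  using assms(1,2)
proof (induction I)
  case empty
  then show ?case using assms(3) by simp
next
  case (insert x I)
  have "(\<Oplus>i\<in>insert x I. f i) = f x \<oplus> (\<Oplus>i\<in>I. f i)"
    using insert by (intro finsum_insert) auto
  moreover have "(\<Oplus>i\<in>I. f i) \<in> carrier G" using insert by auto
  ultimately show ?case using insert assms(4) by auto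
qed

text \<open>The reason why traces are fixed: Frobenius moves every term of a trace to the next one,
  and periodicity brings the last back to the first.\<close>

lemma (in abelian_group) finsum_cyclic_shift:
  assumes f: "\<And>j. f j \<in> carrier G" and per: "f N = f (0::nat)"
  shows "(\<Oplus>j\<in>{..<N}. f (Suc j)) = (\<Oplus>j\<in>{..<N}. f j)"
proof (cases N)
  case (Suc M)
  have "(\<Oplus>j\<in>{..M}. f (Suc j)) \<oplus> f 0 = (\<Oplus>j\<in>{..Suc M}. f j)"
    using f by (intro finsum_Suc2[symmetric]) auto
  also have "\<dots> = f 0 \<oplus> (\<Oplus>j\<in>{..M}. f j)"
    using f per Suc by (simp add: Pi_def)
  also have "\<dots> = (\<Oplus>j\<in>{..M}. f j) \<oplus> f 0" using f by (simp add: a_comm)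
  finally show ?thesis
    using f Suc by (simp add: lessThan_Suc_atMost)
qed simp

lemma (in module) finsum_scalar_smult:
  assumes "finite A" "f \<in> A \<rightarrow> carrier R" "x \<in> carrier M"
  shows "(\<Oplus>\<^bsub>R\<^esub>i\<in>A. f i) \<odot>\<^bsub>M\<^esub> x = (\<Oplus>\<^bsub>M\<^esub>i\<in>A. f i \<odot>\<^bsub>M\<^esub> x)"
  using assms by (induction A) (auto simp: Pi_def smult_l_distr)

section \<open>Traces of scalars\<close>

context finite_base
begin

text \<open>For \<open>c\<close> in \<open>E N\<close> with \<open>N > 0\<close> this is the trace
  of the field extension from \<open>Fq\<close> to \<open>E N\<close>.\<close>

definition tr :: "nat \<Rightarrow> 'a \<Rightarrow> 'a" where
  "tr N c = (\<Oplus>j\<in>{..<N}. c [^] (q ^ j))"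

lemma tr_closed: "c \<in> carrier K \<Longrightarrow> tr N c \<in> carrier K"
  by (simp add: tr_def Pi_def)

lemma tr_Fq:
  assumes c: "c \<in> E N" shows "tr N c \<in> Fq"
proof -
  have cK: "c \<in> carrier K" using c E_carrier by blast
  have "(tr N c) [^] (q ^ 1) = (\<Oplus>j\<in>{..<N}. (c [^] (q ^ j)) [^] (q ^ 1))"
    unfolding tr_def by (rule frob_finsum) (use cK in auto)
  also have "\<dots> = (\<Oplus>j\<in>{..<N}. c [^] (q ^ Suc j))"
    by (simp only: frob_frob[OF cK] Suc_eq_plus1)
  also have "\<dots> = tr N c"
    unfolding tr_def by (rule finsum_cyclic_shift) (use c cK in \<open>auto simp: E_def\<close>)
  finally have "tr N c \<in> E 1" using tr_closed[OF cK] by (simp add: E_def)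
  thus ?thesis by (rule Fq_iff[THEN iffD2])
qed

lemma E_common:
  assumes "finite C" "C \<subseteq> carrier K" shows "\<exists>N>0. C \<subseteq> E N"
  using assms
proof (induction C)
  case (insert c C)
  obtain N where N: "N > 0" "C \<subseteq> E N" using insert by auto
  obtain M where M: "M > 0" "c \<in> E M"
    using scalar_periodic[of c] insert by (auto simp: E_def)
  have "insert c C \<subseteq> E (N * M)"
    using N(2) M(2) E_dvd[of _ N "N * M"] E_dvd[of c M "N * M"] by auto
  thus ?case using N(1) M(1) by (intro exI[of _ "N * M"]) simp
qed auto

lemma dual_carrier:
  assumes "l \<in> E N - {\<zero>}"
  shows "l \<in> carrier K" "\<ominus> (inv l) \<in> carrier K"
  using assms E_carrier by (auto simp: field_Units)

lemma dual_finite: "N > 0 \<Longrightarrow> finite (E N - {\<zero>})"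
  using card_E(2) by simp

text \<open>After the sums are exchanged, \<open>c^(q^j)\<close> has the coefficient computed in
  \<open>dual_sum\<close>, so only \<open>j = 0\<close> survives. This is the trace formula on the
  line \<open>K\<close>; it later collapses the formula for an extended map at a multiple of a fixed
  point.\<close>

lemma scalar_dual:
  assumes N: "N > 0" and c: "c \<in> E N"
  shows "(\<Oplus>l\<in>E N - {\<zero>}. \<ominus> (inv l) \<otimes> tr N (l \<otimes> c)) = c"
proof -
  have cK: "c \<in> carrier K" using c E_carrier by blast
  note [simp] = dual_carrier card_E(2)[OF N] cK
  have "(\<Oplus>l\<in>E N - {\<zero>}. \<ominus> (inv l) \<otimes> tr N (l \<otimes> c))
      = (\<Oplus>l\<in>E N - {\<zero>}. \<Oplus>j\<in>{..<N}. \<ominus> (inv l) \<otimes> l [^] (q ^ j) \<otimes> c [^] (q ^ j))"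
  proof (rule finsum_cong')
    fix l assume l: "l \<in> E N - {\<zero>}"
    have "\<ominus> (inv l) \<otimes> tr N (l \<otimes> c) = (\<Oplus>j\<in>{..<N}. \<ominus> (inv l) \<otimes> (l \<otimes> c) [^] (q ^ j))"
      unfolding tr_def by (rule finsum_rdistr) (use l in auto)
    also have "\<dots> = (\<Oplus>j\<in>{..<N}. \<ominus> (inv l) \<otimes> l [^] (q ^ j) \<otimes> c [^] (q ^ j))"
      using l by (intro finsum_cong') (auto simp: nat_pow_distrib m_assoc)
    finally show "\<ominus> (inv l) \<otimes> tr N (l \<otimes> c) =
      (\<Oplus>j\<in>{..<N}. \<ominus> (inv l) \<otimes> l [^] (q ^ j) \<otimes> c [^] (q ^ j))" .
  qed (auto intro!: finsum_closed)
  also have "\<dots> = (\<Oplus>j\<in>{..<N}. \<Oplus>l\<in>E N - {\<zero>}. \<ominus> (inv l) \<otimes> l [^] (q ^ j) \<otimes> c [^] (q ^ j))"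
    by (rule finsum_commute) auto
  also have "\<dots> = (\<Oplus>j\<in>{..<N}. if j = 0 then c [^] (q ^ j) else \<zero>)"
  proof (rule finsum_cong')
    fix j assume j: "j \<in> {..<N}"
    have "(\<Oplus>l\<in>E N - {\<zero>}. \<ominus> (inv l) \<otimes> l [^] (q ^ j) \<otimes> c [^] (q ^ j))
        = (\<Oplus>l\<in>E N - {\<zero>}. \<ominus> (inv l) \<otimes> l [^] (q ^ j)) \<otimes> c [^] (q ^ j)"
      by (rule finsum_ldistr[symmetric]) auto
    thus "(\<Oplus>l\<in>E N - {\<zero>}. \<ominus> (inv l) \<otimes> l [^] (q ^ j) \<otimes> c [^] (q ^ j))
        = (if j = 0 then c [^] (q ^ j) else \<zero>)"
      using dual_sum[of j N] j by simp
  qed auto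
  also have "\<dots> = c"
    using N add.finprod_singleton[of 0 "{..<N}" "\<lambda>j. c [^] (q ^ j)"] by simp
  finally show ?thesis .
qed

text \<open>If all these traces vanished, \<open>scalar_dual\<close> for \<open>c = 1\<close> would
  give \<open>1 = 0\<close>. Dividing by such a trace turns \<open>v \<mapsto> Tr N (l v)\<close>
  into a map that is the identity on fixed points.\<close>

lemma exists_tr_nonzero:
  assumes N: "N > 0" shows "\<exists>l\<in>E N. tr N l \<noteq> \<zero>"
proof (rule ccontr)
  assume "\<not> ?thesis"
  hence "\<And>l. l \<in> E N - {\<zero>} \<Longrightarrow> tr N (l \<otimes> \<one>) = \<zero>" using E_carrier by auto
  hence "(\<Oplus>l\<in>E N - {\<zero>}. \<ominus> (inv l) \<otimes> tr N (l \<otimes> \<one>)) = (\<Oplus>l\<in>E N - {\<zero>}. \<zero>)"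
    using dual_carrier by (intro finsum_cong') auto
  thus False using scalar_dual[OF N E_one] by simp
qed

lemma Fq_inv: "x \<in> Fq \<Longrightarrow> x \<noteq> \<zero> \<Longrightarrow> inv x \<in> Fq"
  unfolding Fq_iff by (rule E_inv)

end

text \<open>The dimension is left open so that the algebra \<open>A\<close> itself is an instance,
  beside the underlying spaces of modules and the coordinate spaces used for base change.\<close>

locale frob_space = finite_base K Fq p r + V: module K V
  for K :: "('k, 'e) ring_scheme" (structure) and Fq p r and V :: "('k, 'v, 'd) module_scheme" +
  fixes F :: "'v \<Rightarrow> 'v"
  assumes F_closed: "v \<in> carrier V \<Longrightarrow> F v \<in> carrier V"
    and F_add: "v \<in> carrier V \<Longrightarrow> w \<in> carrier V \<Longrightarrow> F (v \<oplus>\<^bsub>V\<^esub> w) = F v \<oplus>\<^bsub>V\<^esub> F w"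
    and F_smult: "c \<in> carrier K \<Longrightarrow> v \<in> carrier V \<Longrightarrow> F (c \<odot>\<^bsub>V\<^esub> v) = c [^] card Fq \<odot>\<^bsub>V\<^esub> F v"
    and F_periodic: "v \<in> carrier V \<Longrightarrow> \<exists>n>0. (F ^^ n) v = v"
begin

lemma F_zero: "F \<zero>\<^bsub>V\<^esub> = \<zero>\<^bsub>V\<^esub>"
  using F_add[of "\<zero>\<^bsub>V\<^esub>" "\<zero>\<^bsub>V\<^esub>"] F_closed[of "\<zero>\<^bsub>V\<^esub>"] V.add.r_cancel_one' by simp

lemma F_finsum:
  assumes "finite I" "f \<in> I \<rightarrow> carrier V"
  shows "F (\<Oplus>\<^bsub>V\<^esub>i\<in>I. f i) = (\<Oplus>\<^bsub>V\<^esub>i\<in>I. F (f i))"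
  using assms
proof (induction I)
  case (insert x I)
  thus ?case using F_closed by (simp add: F_add Pi_def)
qed (simp add: F_zero)

lemma Fpow_closed: "v \<in> carrier V \<Longrightarrow> (F ^^ n) v \<in> carrier V"
  by (induction n) (auto simp: F_closed)

lemma Fpow_add:
  "v \<in> carrier V \<Longrightarrow> w \<in> carrier V \<Longrightarrow> (F ^^ n) (v \<oplus>\<^bsub>V\<^esub> w) = (F ^^ n) v \<oplus>\<^bsub>V\<^esub> (F ^^ n) w"
  by (induction n) (auto simp: F_add Fpow_closed)

lemma Fpow_smult:
  assumes "c \<in> carrier K" "v \<in> carrier V"
  shows "(F ^^ n) (c \<odot>\<^bsub>V\<^esub> v) = c [^] (q ^ n) \<odot>\<^bsub>V\<^esub> (F ^^ n) v"
proof (induction n)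
  case (Suc n)
  thus ?case using assms frob_frob[of c n 1] by (simp add: F_smult Fpow_closed mult.commute)
qed (use assms in simp)

lemma Fpow_dvd:
  assumes "(F ^^ n) v = v" "n dvd m" shows "(F ^^ m) v = v"
proof -
  obtain d where d: "m = n * d" using assms by blast
  have "((F ^^ n) ^^ d) v = v" using assms(1) by (induction d) auto
  thus ?thesis by (simp add: d funpow_mult)
qed

section \<open>Fixed points and traces of vectors\<close>

definition fixed :: "'v set" where "fixed = {v \<in> carrier V. F v = v}"

lemma fixed_carrier: "u \<in> fixed \<Longrightarrow> u \<in> carrier V" by (simp add: fixed_def)

lemma fixed_Fpow: "u \<in> fixed \<Longrightarrow> (F ^^ n) u = u"
  by (induction n) (auto simp: fixed_def)

lemma fixed_zero: "\<zero>\<^bsub>V\<^esub> \<in> fixed" by (simp add: fixed_def F_zero)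

lemma fixed_add: "u \<in> fixed \<Longrightarrow> v \<in> fixed \<Longrightarrow> u \<oplus>\<^bsub>V\<^esub> v \<in> fixed"
  by (simp add: fixed_def F_add)

lemma fixed_smult: "c \<in> Fq \<Longrightarrow> u \<in> fixed \<Longrightarrow> c \<odot>\<^bsub>V\<^esub> u \<in> fixed"
  using Fq_frob[of c] Fq_carrier[of c] by (simp add: fixed_def F_smult)

definition Tr :: "nat \<Rightarrow> 'v \<Rightarrow> 'v" where
  "Tr N v = (\<Oplus>\<^bsub>V\<^esub>j\<in>{..<N}. (F ^^ j) v)"

lemma Tr_closed: "v \<in> carrier V \<Longrightarrow> Tr N v \<in> carrier V"
  by (simp add: Tr_def Pi_def Fpow_closed)

lemma Tr_fixed:
  assumes v: "v \<in> carrier V" and per: "(F ^^ N) v = v"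
  shows "Tr N v \<in> fixed"
proof -
  have "F (Tr N v) = (\<Oplus>\<^bsub>V\<^esub>j\<in>{..<N}. (F ^^ Suc j) v)"
    unfolding Tr_def using v by (subst F_finsum) (auto simp: Fpow_closed)
  also have "\<dots> = Tr N v"
    unfolding Tr_def by (rule V.finsum_cyclic_shift) (use v per Fpow_closed in auto)
  finally show ?thesis using Tr_closed[OF v] by (simp add: fixed_def)
qed

lemma Tr_add:
  "v \<in> carrier V \<Longrightarrow> w \<in> carrier V \<Longrightarrow> Tr N (v \<oplus>\<^bsub>V\<^esub> w) = Tr N v \<oplus>\<^bsub>V\<^esub> Tr N w"
  unfolding Tr_def by (simp add: Fpow_add V.finsum_addf Pi_def Fpow_closed)

lemma Tr_smult_fixed:
  assumes "c \<in> carrier K" "u \<in> fixed"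
  shows "Tr N (c \<odot>\<^bsub>V\<^esub> u) = tr N c \<odot>\<^bsub>V\<^esub> u"
proof -
  have "Tr N (c \<odot>\<^bsub>V\<^esub> u) = (\<Oplus>\<^bsub>V\<^esub>j\<in>{..<N}. c [^] (q ^ j) \<odot>\<^bsub>V\<^esub> u)"
    unfolding Tr_def using assms fixed_carrier
    by (intro V.finsum_cong') (auto simp: Fpow_smult fixed_Fpow)
  also have "\<dots> = tr N c \<odot>\<^bsub>V\<^esub> u"
    unfolding tr_def by (rule V.finsum_scalar_smult[symmetric]) (use assms fixed_carrier in auto)
  finally show ?thesis .
qed

lemma Fpow_E_smult:
  assumes "c \<in> E N" "v \<in> carrier V" "(F ^^ N) v = v"
  shows "(F ^^ N) (c \<odot>\<^bsub>V\<^esub> v) = c \<odot>\<^bsub>V\<^esub> v"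
  using assms by (simp add: Fpow_smult E_def)

text \<open>Exchanging the sums isolates \<open>F^j v\<close> with the coefficient from
  \<open>dual_sum\<close>. The identity is formal and holds for any \<open>N > 0\<close>; the period
  of \<open>v\<close> enters only when the traces are to be fixed points.\<close>

lemma trace_formula:
  assumes N: "N > 0" and v: "v \<in> carrier V"
  shows "(\<Oplus>\<^bsub>V\<^esub>l\<in>E N - {\<zero>}. \<ominus> (inv l) \<odot>\<^bsub>V\<^esub> Tr N (l \<odot>\<^bsub>V\<^esub> v)) = v"
proof -
  note [simp] = dual_carrier card_E(2)[OF N] v Fpow_closed
  have "(\<Oplus>\<^bsub>V\<^esub>l\<in>E N - {\<zero>}. \<ominus> (inv l) \<odot>\<^bsub>V\<^esub> Tr N (l \<odot>\<^bsub>V\<^esub> v))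
      = (\<Oplus>\<^bsub>V\<^esub>l\<in>E N - {\<zero>}. \<Oplus>\<^bsub>V\<^esub>j\<in>{..<N}. (\<ominus> (inv l) \<otimes> l [^] (q ^ j)) \<odot>\<^bsub>V\<^esub> (F ^^ j) v)"
  proof (rule V.finsum_cong')
    fix l assume l: "l \<in> E N - {\<zero>}"
    have "\<ominus> (inv l) \<odot>\<^bsub>V\<^esub> Tr N (l \<odot>\<^bsub>V\<^esub> v)
        = (\<Oplus>\<^bsub>V\<^esub>j\<in>{..<N}. \<ominus> (inv l) \<odot>\<^bsub>V\<^esub> (F ^^ j) (l \<odot>\<^bsub>V\<^esub> v))"
      unfolding Tr_def by (rule V.finsum_smult) (use l in auto)
    also have "\<dots> = (\<Oplus>\<^bsub>V\<^esub>j\<in>{..<N}. (\<ominus> (inv l) \<otimes> l [^] (q ^ j)) \<odot>\<^bsub>V\<^esub> (F ^^ j) v)"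
      using l by (intro V.finsum_cong') (auto simp: Fpow_smult V.smult_assoc1)
    finally show "\<ominus> (inv l) \<odot>\<^bsub>V\<^esub> Tr N (l \<odot>\<^bsub>V\<^esub> v) =
      (\<Oplus>\<^bsub>V\<^esub>j\<in>{..<N}. (\<ominus> (inv l) \<otimes> l [^] (q ^ j)) \<odot>\<^bsub>V\<^esub> (F ^^ j) v)" .
  qed (auto intro!: V.finsum_closed)
  also have "\<dots> = (\<Oplus>\<^bsub>V\<^esub>j\<in>{..<N}. \<Oplus>\<^bsub>V\<^esub>l\<in>E N - {\<zero>}. (\<ominus> (inv l) \<otimes> l [^] (q ^ j)) \<odot>\<^bsub>V\<^esub> (F ^^ j) v)"
    by (rule V.finsum_commute) auto
  also have "\<dots> = (\<Oplus>\<^bsub>V\<^esub>j\<in>{..<N}. if j = 0 then (F ^^ j) v else \<zero>\<^bsub>V\<^esub>)"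
  proof (rule V.finsum_cong')
    fix j assume j: "j \<in> {..<N}"
    have "(\<Oplus>\<^bsub>V\<^esub>l\<in>E N - {\<zero>}. (\<ominus> (inv l) \<otimes> l [^] (q ^ j)) \<odot>\<^bsub>V\<^esub> (F ^^ j) v)
        = (\<Oplus>l\<in>E N - {\<zero>}. \<ominus> (inv l) \<otimes> l [^] (q ^ j)) \<odot>\<^bsub>V\<^esub> (F ^^ j) v"
      by (rule V.finsum_scalar_smult[symmetric]) auto
    thus "(\<Oplus>\<^bsub>V\<^esub>l\<in>E N - {\<zero>}. (\<ominus> (inv l) \<otimes> l [^] (q ^ j)) \<odot>\<^bsub>V\<^esub> (F ^^ j) v)
        = (if j = 0 then (F ^^ j) v else \<zero>\<^bsub>V\<^esub>)"
      using dual_sum[of j N] j by simp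
  qed auto
  also have "\<dots> = v"
    using N V.add.finprod_singleton[of 0 "{..<N}" "\<lambda>j. (F ^^ j) v"] by simp
  finally show ?thesis .
qed

text \<open>Spanning by fixed points, put as an induction rule. Identities for extended maps are
  verified with it, first on multiples of fixed points and then on sums. Zero needs no case of its
  own, being a multiple of the fixed vector zero.\<close>

lemma frob_induct [consumes 1, case_names smult add]:
  assumes v: "v \<in> carrier V"
    and sm: "\<And>c u. c \<in> carrier K \<Longrightarrow> u \<in> fixed \<Longrightarrow> P (c \<odot>\<^bsub>V\<^esub> u)"
    and ad: "\<And>x y. x \<in> carrier V \<Longrightarrow> y \<in> carrier V \<Longrightarrow> P x \<Longrightarrow> P y \<Longrightarrow> P (x \<oplus>\<^bsub>V\<^esub> y)"
  shows "P v"
proof -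
  obtain n where n: "n > 0" "(F ^^ n) v = v" using F_periodic[OF v] by blast
  have "P (\<Oplus>\<^bsub>V\<^esub>l\<in>E n - {\<zero>}. \<ominus> (inv l) \<odot>\<^bsub>V\<^esub> Tr n (l \<odot>\<^bsub>V\<^esub> v))"
  proof (rule V.finsum_induct)
    show "finite (E n - {\<zero>})" by (rule dual_finite[OF n(1)])
    show "P \<zero>\<^bsub>V\<^esub>" using sm[OF zero_closed fixed_zero] by simp
    fix l assume l: "l \<in> E n - {\<zero>}"
    have "Tr n (l \<odot>\<^bsub>V\<^esub> v) \<in> fixed"
      using l v n dual_carrier[OF l] by (intro Tr_fixed Fpow_E_smult) auto
    thus "\<ominus> (inv l) \<odot>\<^bsub>V\<^esub> Tr n (l \<odot>\<^bsub>V\<^esub> v) \<in> carrier V \<and>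
        P (\<ominus> (inv l) \<odot>\<^bsub>V\<^esub> Tr n (l \<odot>\<^bsub>V\<^esub> v))"
      using dual_carrier[OF l] sm fixed_carrier by auto
  qed (use ad in auto)
  thus ?thesis using trace_formula[OF n(1) v] by simp
qed

text \<open>By the trace formula, a linear extension must send \<open>v\<close> to the sum of
  \<open>- inv l\<close> times \<open>f (Tr N (l v))\<close> for every positive \<open>N\<close>
  with \<open>F^N v = v\<close>. So the graph \<open>G\<close> of the extension can be written down
  in advance. It contains the pairs \<open>(c u, c f u)\<close> and is closed under sums, hence
  total by \<open>frob_induct\<close>; as it is single valued, it is a function.\<close>

lemma extend_from_fixed:
  fixes W :: "('k, 'w, 'c) module_scheme"
  assumes W: "module K W"
    and f: "\<And>u. u \<in> fixed \<Longrightarrow> f u \<in> carrier W"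
    and f_add: "\<And>u v. u \<in> fixed \<Longrightarrow> v \<in> fixed \<Longrightarrow> f (u \<oplus>\<^bsub>V\<^esub> v) = f u \<oplus>\<^bsub>W\<^esub> f v"
    and f_smult: "\<And>c u. c \<in> Fq \<Longrightarrow> u \<in> fixed \<Longrightarrow> f (c \<odot>\<^bsub>V\<^esub> u) = c \<odot>\<^bsub>W\<^esub> f u"
  shows "\<exists>g. g \<in> module_hom K V W \<and> (\<forall>u\<in>fixed. g u = f u)"
proof -
  interpret W: module K W by (rule W)
  define G where "G v w \<longleftrightarrow> w \<in> carrier W \<and> (\<exists>N0>0. \<forall>N>0. N0 dvd N \<longrightarrow> (F ^^ N) v = v \<and>
    w = (\<Oplus>\<^bsub>W\<^esub>l\<in>E N - {\<zero>}. \<ominus> (inv l) \<odot>\<^bsub>W\<^esub> f (Tr N (l \<odot>\<^bsub>V\<^esub> v))))" for v w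
  have Tr_in: "Tr N (l \<odot>\<^bsub>V\<^esub> v) \<in> fixed" if "v \<in> carrier V" "(F ^^ N) v = v" "l \<in> E N - {\<zero>}" for N l v
    using that dual_carrier[OF that(3)] by (intro Tr_fixed Fpow_E_smult) auto
  \<comment> \<open>\<open>G v w\<close> says that \<open>w\<close> is what the trace formula for \<open>v\<close> forces, for all sufficiently divisible \<open>N\<close>.\<close>
  have G_smult: "G (c \<odot>\<^bsub>V\<^esub> u) (c \<odot>\<^bsub>W\<^esub> f u)" if c: "c \<in> carrier K" and u: "u \<in> fixed" for c u
  proof -
    obtain N0 where N0: "N0 > 0" "c \<in> E N0" using scalar_periodic[OF c] c by (auto simp: E_def)
    have "(F ^^ N) (c \<odot>\<^bsub>V\<^esub> u) = c \<odot>\<^bsub>V\<^esub> u \<and> c \<odot>\<^bsub>W\<^esub> f u =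
      (\<Oplus>\<^bsub>W\<^esub>l\<in>E N - {\<zero>}. \<ominus> (inv l) \<odot>\<^bsub>W\<^esub> f (Tr N (l \<odot>\<^bsub>V\<^esub> (c \<odot>\<^bsub>V\<^esub> u))))"
      if N: "N > 0" "N0 dvd N" for N
    proof
      have cN: "c \<in> E N" using N0(2) N(2) by (rule E_dvd)
      show "(F ^^ N) (c \<odot>\<^bsub>V\<^esub> u) = c \<odot>\<^bsub>V\<^esub> u"
        using u by (intro Fpow_E_smult[OF cN] fixed_carrier fixed_Fpow)
      have "(\<Oplus>\<^bsub>W\<^esub>l\<in>E N - {\<zero>}. \<ominus> (inv l) \<odot>\<^bsub>W\<^esub> f (Tr N (l \<odot>\<^bsub>V\<^esub> (c \<odot>\<^bsub>V\<^esub> u))))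
        = (\<Oplus>\<^bsub>W\<^esub>l\<in>E N - {\<zero>}. (\<ominus> (inv l) \<otimes> tr N (l \<otimes> c)) \<odot>\<^bsub>W\<^esub> f u)"
      proof (rule W.finsum_cong')
        fix l assume l: "l \<in> E N - {\<zero>}"
        note lc = dual_carrier[OF l]
        have "Tr N (l \<odot>\<^bsub>V\<^esub> (c \<odot>\<^bsub>V\<^esub> u)) = tr N (l \<otimes> c) \<odot>\<^bsub>V\<^esub> u"
          using lc c u fixed_carrier by (simp add: V.smult_assoc1[symmetric] Tr_smult_fixed)
        \<comment> \<open>Only scalars from \<open>Fq\<close> may be moved through \<open>f\<close>.
          The factor \<open>c\<close> is arbitrary in \<open>K\<close>, but its weighted trace is
          such a scalar.\<close>
        moreover have "tr N (l \<otimes> c) \<in> Fq"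
          by (rule tr_Fq, rule E_mult) (use l cN in auto)
        ultimately show "\<ominus> (inv l) \<odot>\<^bsub>W\<^esub> f (Tr N (l \<odot>\<^bsub>V\<^esub> (c \<odot>\<^bsub>V\<^esub> u)))
          = (\<ominus> (inv l) \<otimes> tr N (l \<otimes> c)) \<odot>\<^bsub>W\<^esub> f u"
          using lc c u f f_smult tr_closed by (simp add: W.smult_assoc1)
      qed (use c u f tr_closed dual_carrier in auto)
      also have "\<dots> = (\<Oplus>l\<in>E N - {\<zero>}. \<ominus> (inv l) \<otimes> tr N (l \<otimes> c)) \<odot>\<^bsub>W\<^esub> f u"
        by (rule W.finsum_scalar_smult[symmetric])
          (use c u f tr_closed dual_carrier card_E(2)[OF N(1)] in auto)
      also have "\<dots> = c \<odot>\<^bsub>W\<^esub> f u" using scalar_dual[OF N(1) cN] by simp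
      finally show "c \<odot>\<^bsub>W\<^esub> f u =
        (\<Oplus>\<^bsub>W\<^esub>l\<in>E N - {\<zero>}. \<ominus> (inv l) \<odot>\<^bsub>W\<^esub> f (Tr N (l \<odot>\<^bsub>V\<^esub> (c \<odot>\<^bsub>V\<^esub> u))))" by (rule sym)
    qed
    thus ?thesis using N0(1) c u f unfolding G_def by blast
  qed
  have G_add: "G (x \<oplus>\<^bsub>V\<^esub> y) (x' \<oplus>\<^bsub>W\<^esub> y')" if xy: "x \<in> carrier V" "y \<in> carrier V" "G x x'" "G y y'" for x y x' y'
  proof -
    obtain N1 where N1: "N1 > 0" "\<And>N. N > 0 \<Longrightarrow> N1 dvd N \<Longrightarrow> (F ^^ N) x = x \<and>
      x' = (\<Oplus>\<^bsub>W\<^esub>l\<in>E N - {\<zero>}. \<ominus> (inv l) \<odot>\<^bsub>W\<^esub> f (Tr N (l \<odot>\<^bsub>V\<^esub> x)))"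
      using xy(3) unfolding G_def by blast
    obtain N2 where N2: "N2 > 0" "\<And>N. N > 0 \<Longrightarrow> N2 dvd N \<Longrightarrow> (F ^^ N) y = y \<and>
      y' = (\<Oplus>\<^bsub>W\<^esub>l\<in>E N - {\<zero>}. \<ominus> (inv l) \<odot>\<^bsub>W\<^esub> f (Tr N (l \<odot>\<^bsub>V\<^esub> y)))"
      using xy(4) unfolding G_def by blast
    \<comment> \<open>\<open>N1 * N2\<close> serves as a threshold for the sum: its multiples are
      multiples of both thresholds, so one \<open>N\<close> computes \<open>x'\<close> and
      \<open>y'\<close> together.\<close>
    have "(F ^^ N) (x \<oplus>\<^bsub>V\<^esub> y) = x \<oplus>\<^bsub>V\<^esub> y \<and> x' \<oplus>\<^bsub>W\<^esub> y' =
      (\<Oplus>\<^bsub>W\<^esub>l\<in>E N - {\<zero>}. \<ominus> (inv l) \<odot>\<^bsub>W\<^esub> f (Tr N (l \<odot>\<^bsub>V\<^esub> (x \<oplus>\<^bsub>V\<^esub> y))))"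
      if N: "N > 0" "N1 * N2 dvd N" for N
    proof
      have x: "(F ^^ N) x = x" "x' = (\<Oplus>\<^bsub>W\<^esub>l\<in>E N - {\<zero>}. \<ominus> (inv l) \<odot>\<^bsub>W\<^esub> f (Tr N (l \<odot>\<^bsub>V\<^esub> x)))"
        using N1(2)[OF N(1)] dvd_mult_left[OF N(2)] by auto
      have y: "(F ^^ N) y = y" "y' = (\<Oplus>\<^bsub>W\<^esub>l\<in>E N - {\<zero>}. \<ominus> (inv l) \<odot>\<^bsub>W\<^esub> f (Tr N (l \<odot>\<^bsub>V\<^esub> y)))"
        using N2(2)[OF N(1)] dvd_mult_right[OF N(2)] by auto
      show "(F ^^ N) (x \<oplus>\<^bsub>V\<^esub> y) = x \<oplus>\<^bsub>V\<^esub> y" using xy x y by (simp add: Fpow_add)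
      have "x' \<oplus>\<^bsub>W\<^esub> y' = (\<Oplus>\<^bsub>W\<^esub>l\<in>E N - {\<zero>}. \<ominus> (inv l) \<odot>\<^bsub>W\<^esub> f (Tr N (l \<odot>\<^bsub>V\<^esub> x))
          \<oplus>\<^bsub>W\<^esub> \<ominus> (inv l) \<odot>\<^bsub>W\<^esub> f (Tr N (l \<odot>\<^bsub>V\<^esub> y)))"
        unfolding x(2) y(2) by (rule W.finsum_addf[symmetric])
          (use xy x(1) y(1) Tr_in f dual_carrier in auto)
      also have "\<dots> = (\<Oplus>\<^bsub>W\<^esub>l\<in>E N - {\<zero>}. \<ominus> (inv l) \<odot>\<^bsub>W\<^esub> f (Tr N (l \<odot>\<^bsub>V\<^esub> (x \<oplus>\<^bsub>V\<^esub> y))))"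
      proof (rule W.finsum_cong')
        fix l assume l: "l \<in> E N - {\<zero>}"
        note lc = dual_carrier[OF l]
        have "Tr N (l \<odot>\<^bsub>V\<^esub> (x \<oplus>\<^bsub>V\<^esub> y)) = Tr N (l \<odot>\<^bsub>V\<^esub> x) \<oplus>\<^bsub>V\<^esub> Tr N (l \<odot>\<^bsub>V\<^esub> y)"
          using lc xy by (simp add: V.smult_r_distr Tr_add)
        thus "\<ominus> (inv l) \<odot>\<^bsub>W\<^esub> f (Tr N (l \<odot>\<^bsub>V\<^esub> x)) \<oplus>\<^bsub>W\<^esub> \<ominus> (inv l) \<odot>\<^bsub>W\<^esub> f (Tr N (l \<odot>\<^bsub>V\<^esub> y))
          = \<ominus> (inv l) \<odot>\<^bsub>W\<^esub> f (Tr N (l \<odot>\<^bsub>V\<^esub> (x \<oplus>\<^bsub>V\<^esub> y)))"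
          using lc f f_add Tr_in[OF xy(1) x(1) l] Tr_in[OF xy(2) y(1) l]
          by (simp add: W.smult_r_distr)
      next
        have "(F ^^ N) (x \<oplus>\<^bsub>V\<^esub> y) = x \<oplus>\<^bsub>V\<^esub> y" using xy x y by (simp add: Fpow_add)
        thus "(\<lambda>l. \<ominus> (inv l) \<odot>\<^bsub>W\<^esub> f (Tr N (l \<odot>\<^bsub>V\<^esub> (x \<oplus>\<^bsub>V\<^esub> y)))) \<in> E N - {\<zero>} \<rightarrow> carrier W"
          using xy Tr_in f dual_carrier by auto
      qed simp
      finally show "x' \<oplus>\<^bsub>W\<^esub> y' =
        (\<Oplus>\<^bsub>W\<^esub>l\<in>E N - {\<zero>}. \<ominus> (inv l) \<odot>\<^bsub>W\<^esub> f (Tr N (l \<odot>\<^bsub>V\<^esub> (x \<oplus>\<^bsub>V\<^esub> y))))" .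
    qed
    moreover have "N1 * N2 > 0" using N1(1) N2(1) by simp
    ultimately show ?thesis using xy unfolding G_def by blast
  qed
  \<comment> \<open>Uniqueness amounts to well-definedness of \<open>\<Sum> c\<^sub>i u\<^sub>i \<mapsto> \<Sum> c\<^sub>i f u\<^sub>i\<close>.\<close>
  have G_unique: "w = w'" if Gw: "G v w" and Gw': "G v w'" for v w w'
  proof -
    define S where "S N = (\<Oplus>\<^bsub>W\<^esub>l\<in>E N - {\<zero>}. \<ominus> (inv l) \<odot>\<^bsub>W\<^esub> f (Tr N (l \<odot>\<^bsub>V\<^esub> v)))" for N
    have GS: "\<exists>N0>0. \<forall>N>0. N0 dvd N \<longrightarrow> w = S N" if "G v w" for w
      using that unfolding G_def S_def[symmetric] by blast
    obtain N1 where N1: "N1 > 0" "\<forall>N>0. N1 dvd N \<longrightarrow> w = S N" using GS[OF Gw] by blast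
    obtain N2 where N2: "N2 > 0" "\<forall>N>0. N2 dvd N \<longrightarrow> w' = S N" using GS[OF Gw'] by blast
    have "N1 * N2 > 0" using N1(1) N2(1) by simp
    hence "w = S (N1 * N2)" "w' = S (N1 * N2)" using N1(2) N2(2) by simp_all
    thus ?thesis by simp
  qed
  have G_ex: "\<exists>w. G v w" if "v \<in> carrier V" for v
    using that
  proof (induction rule: frob_induct)
    case (smult c u)
    then show ?case using G_smult by blast
  next
    case (add x y)
    then show ?case using G_add by blast
  qed
  define g where "g v = (THE w. G v w)" for v
  have Gg: "G v (g v)" if vV: "v \<in> carrier V" for v
  proof -
    obtain w where w: "G v w" using G_ex[OF vV] by blast
    show ?thesis unfolding g_def by (rule theI[of "G v", OF w]) (rule G_unique[OF _ w])
  qed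
  have gI: "g v = w" if "G v w" for v w
    unfolding g_def by (rule the_equality[of "G v", OF that]) (rule G_unique[OF _ that])
  have g_closed: "g v \<in> carrier W" if "v \<in> carrier V" for v
    using Gg[OF that] unfolding G_def by blast
  have g_add: "g (x \<oplus>\<^bsub>V\<^esub> y) = g x \<oplus>\<^bsub>W\<^esub> g y" if "x \<in> carrier V" "y \<in> carrier V" for x y
    using that Gg by (intro gI G_add)
  have g_fixed: "g (c \<odot>\<^bsub>V\<^esub> u) = c \<odot>\<^bsub>W\<^esub> f u" if "c \<in> carrier K" "u \<in> fixed" for c u
    using that by (intro gI G_smult)
  have g_smult: "g (c \<odot>\<^bsub>V\<^esub> v) = c \<odot>\<^bsub>W\<^esub> g v" if c: "c \<in> carrier K" and v: "v \<in> carrier V" for c v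
    using v
  proof (induction rule: frob_induct)
    case (smult d u)
    thus ?case using c f fixed_carrier g_fixed[of "c \<otimes> d" u] g_fixed[of d u]
      by (simp add: V.smult_assoc1 W.smult_assoc1)
  next
    case (add x y)
    thus ?case using c g_closed by (simp add: V.smult_r_distr W.smult_r_distr g_add)
  qed
  have "g u = f u" if "u \<in> fixed" for u
    using g_fixed[of "\<one>" u] that f fixed_carrier by simp
  moreover have "g \<in> module_hom K V W"
    unfolding module_hom_def using g_closed g_add g_smult by auto
  ultimately show ?thesis by blast
qed

text \<open>Averaging \<open>v\<close> over its orbit would divide by the period \<open>N\<close>,
  which may be zero in \<open>K\<close>. A weight \<open>l\<close> with nonzero trace avoids this:
  \<open>Tr N (l v)\<close> divided by \<open>tr N l\<close> is fixed, and since \<open>h\<close>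
  commutes with the Frobenius maps and \<open>h v\<close> is fixed, its image is \<open>h v\<close>
  again.\<close>

lemma fixed_lift:
  fixes W :: "('k, 'w, 'c) module_scheme"
  assumes W: "frob_space K Fq p r W FW"
    and h: "h \<in> module_hom K V W" and comm: "\<And>v. v \<in> carrier V \<Longrightarrow> h (F v) = FW (h v)"
    and v: "v \<in> carrier V" and hv: "h v \<in> frob_space.fixed W FW"
  shows "\<exists>u\<in>fixed. h u = h v"
proof -
  interpret W: frob_space K Fq p r W FW by (rule W)
  have hc: "h x \<in> carrier W" if "x \<in> carrier V" for x using h that by (auto simp: module_hom_def)
  obtain N where N: "N > 0" "(F ^^ N) v = v" using F_periodic[OF v] by blast
  obtain l where l: "l \<in> E N" "tr N l \<noteq> \<zero>" using exists_tr_nonzero[OF N(1)] by blast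
  have lK: "l \<in> carrier K" using l E_carrier by blast
  have m: "tr N l \<in> Fq" by (rule tr_Fq[OF l(1)])
  have mi: "inv (tr N l) \<in> Fq" by (rule Fq_inv[OF m l(2)])
  have mU: "tr N l \<in> Units K" using Fq_carrier[OF m] l(2) by (simp add: field_Units)
  have hpow: "h ((F ^^ n) x) = (FW ^^ n) (h x)" if "x \<in> carrier V" for n x
    using that by (induction n) (auto simp: comm Fpow_closed)
  have lv: "l \<odot>\<^bsub>V\<^esub> v \<in> carrier V" using lK v by simp
  have fx: "Tr N (l \<odot>\<^bsub>V\<^esub> v) \<in> fixed"
    using lv l(1) v N(2) by (intro Tr_fixed Fpow_E_smult)
  have "h (Tr N (l \<odot>\<^bsub>V\<^esub> v)) = (\<Oplus>\<^bsub>W\<^esub>j\<in>{..<N}. h ((F ^^ j) (l \<odot>\<^bsub>V\<^esub> v)))"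
  proof -
    interpret mod_hom K V W h by unfold_locales (rule h)
    have "finite S \<Longrightarrow> g \<in> S \<rightarrow> carrier V \<Longrightarrow> h (\<Oplus>\<^bsub>V\<^esub>j\<in>S. g j) = (\<Oplus>\<^bsub>W\<^esub>j\<in>S. h (g j))"
      for S :: "nat set" and g
      by (induction S rule: finite_induct) (use hc in \<open>auto simp: Pi_def\<close>)
    thus ?thesis unfolding Tr_def using lv Fpow_closed by auto
  qed
  also have "\<dots> = W.Tr N (l \<odot>\<^bsub>W\<^esub> h v)"
    unfolding W.Tr_def using lv lK v h hc hpow
    by (intro W.V.finsum_cong') (auto simp: module_hom_smult[OF h] W.Fpow_closed)
  also have "\<dots> = tr N l \<odot>\<^bsub>W\<^esub> h v" by (rule W.Tr_smult_fixed[OF lK hv])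
  finally have eq: "h (Tr N (l \<odot>\<^bsub>V\<^esub> v)) = tr N l \<odot>\<^bsub>W\<^esub> h v" .
  have "h (inv (tr N l) \<odot>\<^bsub>V\<^esub> Tr N (l \<odot>\<^bsub>V\<^esub> v)) = inv (tr N l) \<odot>\<^bsub>W\<^esub> (tr N l \<odot>\<^bsub>W\<^esub> h v)"
    using module_hom_smult[OF h Fq_carrier[OF mi] fixed_carrier[OF fx]] eq by simp
  also have "\<dots> = h v"
    using mU W.V.smult_assoc1[OF Fq_carrier[OF mi] Fq_carrier[OF m] hc[OF v]] hc[OF v] by simp
  finally show ?thesis using fixed_smult[OF mi fx] by blast
qed

text \<open>Finitely many fixed points form a finite generating set. Conversely, a finite generating
  set can be replaced by a finite set \<open>T\<close> of fixed points, and every fixed point is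
  then a combination of \<open>T\<close> with coefficients in the finite field
  \<open>Fq\<close>.\<close>

lemma fin_dim_iff: "(\<exists>A. finite A \<and> A \<subseteq> carrier V \<and> V.gen_set A) \<longleftrightarrow> finite fixed"
proof
  assume fin: "finite fixed"
  have sub: "fixed \<subseteq> carrier V" using fixed_carrier by blast
  have "v \<in> V.span fixed" if "v \<in> carrier V" for v
    using that
  proof (induction rule: frob_induct)
    case (smult c u)
    thus ?case using V.in_own_span[OF sub] V.span_is_submodule[OF sub]
      by (auto intro: LinearCombinations.submodule.smult_closed)
  next
    case (add x y)
    thus ?case using V.span_is_submodule[OF sub] by (auto intro: LinearCombinations.submodule.m_closed)
  qed
  hence "V.gen_set fixed" using V.span_is_subset2[OF sub] by blast
  thus "\<exists>A. finite A \<and> A \<subseteq> carrier V \<and> V.gen_set A" using fin sub by blast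
next
  assume "\<exists>A. finite A \<and> A \<subseteq> carrier V \<and> V.gen_set A"
  then obtain A where A: "finite A" "A \<subseteq> carrier V" "V.gen_set A" by blast
  obtain n where n: "\<And>a. a \<in> A \<Longrightarrow> n a > 0 \<and> (F ^^ n a) a = a"
    using F_periodic A(2) by (metis subsetD)
  \<comment> \<open>The traces that occur in the trace formula of each generator \<open>a\<close>,
    taken with a period of its own.\<close>
  define T where "T = (\<Union>a\<in>A. (\<lambda>l. Tr (n a) (l \<odot>\<^bsub>V\<^esub> a)) ` (E (n a) - {\<zero>}))"
  have fT: "finite T" unfolding T_def using A(1) n card_E(2) by auto
  have T: "T \<subseteq> fixed"
    unfolding T_def using n A(2) dual_carrier
    by (auto intro!: Tr_fixed Fpow_E_smult)
  hence Tc: "T \<subseteq> carrier V" using fixed_carrier by blast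
  interpret T: LinearCombinations.submodule K "V.span T" V by (rule V.span_is_submodule[OF Tc])
  have "A \<subseteq> V.span T"
  proof
    fix a assume a: "a \<in> A"
    have "(\<Oplus>\<^bsub>V\<^esub>l\<in>E (n a) - {\<zero>}. \<ominus> (inv l) \<odot>\<^bsub>V\<^esub> Tr (n a) (l \<odot>\<^bsub>V\<^esub> a)) \<in> V.span T"
    proof (rule V.finsum_induct)
      fix l assume l: "l \<in> E (n a) - {\<zero>}"
      hence "Tr (n a) (l \<odot>\<^bsub>V\<^esub> a) \<in> T" using a unfolding T_def by blast
      hence "Tr (n a) (l \<odot>\<^bsub>V\<^esub> a) \<in> V.span T" using V.in_own_span[OF Tc] by blast
      thus "\<ominus> (inv l) \<odot>\<^bsub>V\<^esub> Tr (n a) (l \<odot>\<^bsub>V\<^esub> a) \<in> carrier V \<and>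
        \<ominus> (inv l) \<odot>\<^bsub>V\<^esub> Tr (n a) (l \<odot>\<^bsub>V\<^esub> a) \<in> V.span T"
        using dual_carrier[OF l] T.subset by blast
    qed (use n[OF a] card_E(2) in auto)
    thus "a \<in> V.span T" using trace_formula n[OF a] a A(2) by auto
  qed
  hence "V.span A \<subseteq> V.span T" by (rule V.span_is_subset) unfold_locales
  hence spanT: "V.span T = carrier V" using A(3) T.subset by blast
  have "fixed \<subseteq> (\<lambda>c. V.lincomb c T) ` (T \<rightarrow>\<^sub>E Fq)"
  proof
    fix v assume v: "v \<in> fixed"
    hence "v \<in> V.span T" using spanT fixed_carrier by blast
    then obtain c where c: "c \<in> T \<rightarrow> carrier K" "V.lincomb c T = v"
      using V.finite_in_span[OF fT Tc] by blast
    have "finite (c ` T)" "c ` T \<subseteq> carrier K" using fT c by auto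
    then obtain N where N: "N > 0" "c ` T \<subseteq> E N" using E_common by blast
    obtain l where l: "l \<in> E N" "tr N l \<noteq> \<zero>" using exists_tr_nonzero[OF N(1)] by blast
    have lK: "l \<in> carrier K" using l E_carrier by blast
    have m: "tr N l \<in> Fq" by (rule tr_Fq[OF l(1)])
    have mi: "inv (tr N l) \<in> Fq" by (rule Fq_inv[OF m l(2)])
    have miK: "inv (tr N l) \<in> carrier K" by (rule Fq_carrier[OF mi])
    have mU: "tr N l \<in> Units K" using Fq_carrier[OF m] l(2) by (simp add: field_Units)
    \<comment> \<open>Applying \<open>Tr N (l _)\<close> and dividing by \<open>tr N l\<close>
      leaves the fixed vector \<open>v\<close> unchanged, but replaces its coefficients
      \<open>c t\<close> in \<open>K\<close> by \<open>d t\<close> in \<open>Fq\<close>.\<close>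
    define d where "d t = inv (tr N l) \<otimes> tr N (l \<otimes> c t)" for t
    have d: "d t \<in> Fq" if "t \<in> T" for t
    proof -
      have "tr N (l \<otimes> c t) \<in> Fq" by (rule tr_Fq, rule E_mult[OF l(1)]) (use N that in auto)
      thus ?thesis unfolding d_def using mi subringE(6)[OF Fq_subring] by blast
    qed
    have ct: "c t \<in> carrier K" if "t \<in> T" for t using c that by auto
    have tc: "t \<in> carrier V" "t \<in> fixed" if "t \<in> T" for t using T Tc that by auto
    have "tr N l \<odot>\<^bsub>V\<^esub> v = Tr N (l \<odot>\<^bsub>V\<^esub> v)" using Tr_smult_fixed[OF lK v] by simp
    also have "l \<odot>\<^bsub>V\<^esub> v = (\<Oplus>\<^bsub>V\<^esub>t\<in>T. (l \<otimes> c t) \<odot>\<^bsub>V\<^esub> t)"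
      using V.lincomb_smult[OF Tc c(1) lK] c(2) by (simp add: V.lincomb_def)
    also have "Tr N \<dots> = (\<Oplus>\<^bsub>V\<^esub>t\<in>T. Tr N ((l \<otimes> c t) \<odot>\<^bsub>V\<^esub> t))"
    proof -
      have "finite S \<Longrightarrow> g \<in> S \<rightarrow> carrier V \<Longrightarrow> Tr N (\<Oplus>\<^bsub>V\<^esub>t\<in>S. g t) = (\<Oplus>\<^bsub>V\<^esub>t\<in>S. Tr N (g t))"
        for S :: "'v set" and g
      proof (induction S rule: finite_induct)
        case empty
        have "Tr N (\<zero>\<^bsub>V\<^esub>) = \<zero>\<^bsub>V\<^esub>"
          unfolding Tr_def using fixed_Fpow[OF fixed_zero] by simp
        thus ?case by simp
      next
        case (insert x S)
        thus ?case by (simp add: Pi_def Tr_add Tr_closed)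
      qed
      thus ?thesis using fT lK ct tc by auto
    qed
    also have "\<dots> = (\<Oplus>\<^bsub>V\<^esub>t\<in>T. tr N (l \<otimes> c t) \<odot>\<^bsub>V\<^esub> t)"
      using lK ct tc tr_closed by (intro V.finsum_cong') (auto simp: Tr_smult_fixed)
    finally have "inv (tr N l) \<odot>\<^bsub>V\<^esub> (tr N l \<odot>\<^bsub>V\<^esub> v)
        = inv (tr N l) \<odot>\<^bsub>V\<^esub> V.lincomb (\<lambda>t. tr N (l \<otimes> c t)) T"
      by (simp add: V.lincomb_def)
    also have "\<dots> = V.lincomb d T"
      unfolding d_def using Tc miK lK ct tr_closed by (intro V.lincomb_smult[symmetric]) auto
    also have "\<dots> = V.lincomb (restrict d T) T"
      unfolding V.lincomb_def using d Fq_carrier tc by (intro V.finsum_cong') auto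
    also have "inv (tr N l) \<odot>\<^bsub>V\<^esub> (tr N l \<odot>\<^bsub>V\<^esub> v) = v"
      using mU V.smult_assoc1[OF miK Fq_carrier[OF m] fixed_carrier[OF v]] fixed_carrier[OF v] by simp
    finally have "v = V.lincomb (restrict d T) T" .
    moreover have "restrict d T \<in> T \<rightarrow>\<^sub>E Fq" using d by auto
    ultimately show "v \<in> (\<lambda>c. V.lincomb c T) ` (T \<rightarrow>\<^sub>E Fq)" by blast
  qed
  moreover have "finite ((\<lambda>c. V.lincomb c T) ` (T \<rightarrow>\<^sub>E Fq))"
    using fT finite_Fq by (intro finite_imageI finite_PiE) auto
  ultimately show "finite fixed" by (rule finite_subset)
qed

end

section \<open>Equivalences of categories\<close>

lemma (in category) hom_obj:
  assumes "f \<in> homset C U V" shows "U \<in> obj C" "V \<in> obj C"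
  using assms src_obj tgt_obj by (auto simp: homset_def)

text \<open>For each object \<open>P\<close> an isomorphism \<open>e P\<close> from some
  \<open>Fo (Go P)\<close> to \<open>P\<close> is chosen. An arrow of \<open>D\<close> is conjugated
  by these isomorphisms and pulled back along the bijection of hom sets. Every equation between
  arrows of \<open>C\<close> is checked after applying \<open>Fa\<close>, which is enough by
  faithfulness.\<close>

lemma equivalent_categories_of_fully_faithful:
  fixes C :: "('o1, 'm1, 'e1) cat_scheme" and D :: "('o2, 'm2, 'e2) cat_scheme"
  assumes func: "cat_functor C D Fo Fa"
    and ff: "\<And>U V. U \<in> obj C \<Longrightarrow> V \<in> obj C \<Longrightarrow>
      bij_betw Fa (homset C U V) (homset D (Fo U) (Fo V))"
    and es: "\<And>P. P \<in> obj D \<Longrightarrow> \<exists>U\<in>obj C. \<exists>e. iso_arr D (Fo U) P e"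
  shows "equivalent_categories C D"
proof -
  interpret cat_functor C D Fo Fa by (rule func)
  have "\<forall>P\<in>obj D. \<exists>U e e'. U \<in> obj C \<and> e \<in> homset D (Fo U) P \<and> e' \<in> homset D P (Fo U) \<and>
      e' \<cdot>\<^bsub>D\<^esub> e = ident D (Fo U) \<and> e \<cdot>\<^bsub>D\<^esub> e' = ident D P"
    using es unfolding iso_arr_def by blast
  then obtain Go e e' where G: "\<And>P. P \<in> obj D \<Longrightarrow> Go P \<in> obj C"
    and e: "\<And>P. P \<in> obj D \<Longrightarrow> e P \<in> homset D (Fo (Go P)) P"
    and e': "\<And>P. P \<in> obj D \<Longrightarrow> e' P \<in> homset D P (Fo (Go P))"
    and e'e: "\<And>P. P \<in> obj D \<Longrightarrow> e' P \<cdot>\<^bsub>D\<^esub> e P = ident D (Fo (Go P))"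
    and ee': "\<And>P. P \<in> obj D \<Longrightarrow> e P \<cdot>\<^bsub>D\<^esub> e' P = ident D P"
    by metis
  define pre where "pre U V = the_inv_into (homset C U V) Fa" for U V
  have pre: "pre U V g \<in> homset C U V" "Fa (pre U V g) = g"
    if "U \<in> obj C" "V \<in> obj C" "g \<in> homset D (Fo U) (Fo V)" for U V g
    using bij_betwE[OF bij_betw_the_inv_into[OF ff[OF that(1,2)]]] that(3)
      f_the_inv_into_f_bij_betw[OF ff[OF that(1,2)]] unfolding pre_def by auto
  have faithful: "f = f'" if "f \<in> homset C U V" "f' \<in> homset C U V" "Fa f = Fa f'" for f f' U V
    using bij_betw_imp_inj_on[OF ff[OF C.hom_obj[OF that(1)]]] that by (auto dest: inj_onD)
  define conj where "conj P Q f = e' Q \<cdot>\<^bsub>D\<^esub> (f \<cdot>\<^bsub>D\<^esub> e P)" for P Q f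
  define Ga where "Ga f = pre (Go (src D f)) (Go (tgt D f)) (conj (src D f) (tgt D f) f)" for f
  have st: "src D f = P" "tgt D f = Q" if "f \<in> homset D P Q" for f P Q
    using that by (auto simp: homset_def)
  have conj_hom: "conj P Q f \<in> homset D (Fo (Go P)) (Fo (Go Q))" if "f \<in> homset D P Q" for f P Q
    unfolding conj_def using D.hom_obj[OF that]
    by (intro D.comp_hom[OF D.comp_hom[OF e that] e'])
  have Ga: "Ga f \<in> homset C (Go P) (Go Q)" "Fa (Ga f) = conj P Q f" if f: "f \<in> homset D P Q" for f P Q
    unfolding Ga_def st[OF f] using pre[OF G G conj_hom[OF f]] D.hom_obj[OF f] by auto
  have e_conj: "e Q \<cdot>\<^bsub>D\<^esub> conj P Q f = f \<cdot>\<^bsub>D\<^esub> e P" if f: "f \<in> homset D P Q" for f P Q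
  proof -
    note o = D.hom_obj[OF f]
    have fe: "f \<cdot>\<^bsub>D\<^esub> e P \<in> homset D (Fo (Go P)) Q" by (rule D.comp_hom[OF e[OF o(1)] f])
    have "e Q \<cdot>\<^bsub>D\<^esub> conj P Q f = (e Q \<cdot>\<^bsub>D\<^esub> e' Q) \<cdot>\<^bsub>D\<^esub> (f \<cdot>\<^bsub>D\<^esub> e P)"
      unfolding conj_def by (rule D.comp_assoc[OF fe e'[OF o(2)] e[OF o(2)]])
    thus ?thesis using D.ident_left[OF fe] ee'[OF o(2)] by simp
  qed
  have conj_comp: "conj P R (g \<cdot>\<^bsub>D\<^esub> f) = conj Q R g \<cdot>\<^bsub>D\<^esub> conj P Q f"
    if f: "f \<in> homset D P Q" and g: "g \<in> homset D Q R" for f g P Q R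
  proof -
    note o = D.hom_obj[OF f] and o' = D.hom_obj[OF g]
    have ge: "g \<cdot>\<^bsub>D\<^esub> e Q \<in> homset D (Fo (Go Q)) R" by (rule D.comp_hom[OF e[OF o(2)] g])
    have "conj Q R g \<cdot>\<^bsub>D\<^esub> conj P Q f = e' R \<cdot>\<^bsub>D\<^esub> ((g \<cdot>\<^bsub>D\<^esub> e Q) \<cdot>\<^bsub>D\<^esub> conj P Q f)"
      unfolding conj_def[of Q R g] by (rule D.comp_assoc[OF conj_hom[OF f] ge e'[OF o'(2)], symmetric])
    also have "(g \<cdot>\<^bsub>D\<^esub> e Q) \<cdot>\<^bsub>D\<^esub> conj P Q f = g \<cdot>\<^bsub>D\<^esub> (e Q \<cdot>\<^bsub>D\<^esub> conj P Q f)"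
      by (rule D.comp_assoc[OF conj_hom[OF f] e[OF o(2)] g, symmetric])
    also have "\<dots> = (g \<cdot>\<^bsub>D\<^esub> f) \<cdot>\<^bsub>D\<^esub> e P"
      unfolding e_conj[OF f] by (rule D.comp_assoc[OF e[OF o(1)] f g])
    finally show ?thesis unfolding conj_def[of P R] by (rule sym)
  qed
  have conj_id: "conj P P (ident D P) = ident D (Fo (Go P))" if P: "P \<in> obj D" for P
    unfolding conj_def using D.ident_left[OF e[OF P]] e'e[OF P] by simp
  have G_functor: "cat_functor D C Go Ga"
  proof (unfold_locales)
    fix P assume P: "P \<in> obj D"
    show "Go P \<in> obj C" by (rule G[OF P])
    have i: "ident D P \<in> homset D P P" by (rule D.ident_hom[OF P])
    show "Ga (ident D P) = ident C (Go P)"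
      by (rule faithful[OF Ga(1)[OF i] C.ident_hom[OF G[OF P]]])
        (simp add: Ga(2)[OF i] conj_id[OF P] map_ident[OF G[OF P]])
  next
    fix f P Q assume f: "f \<in> homset D P Q"
    show "Ga f \<in> homset C (Go P) (Go Q)" by (rule Ga(1)[OF f])
    fix g R assume g: "g \<in> homset D Q R"
    show "Ga (g \<cdot>\<^bsub>D\<^esub> f) = Ga g \<cdot>\<^bsub>C\<^esub> Ga f"
      by (rule faithful[OF Ga(1)[OF D.comp_hom[OF f g]] C.comp_hom[OF Ga(1)[OF f] Ga(1)[OF g]]])
        (simp add: Ga(2)[OF D.comp_hom[OF f g]] Ga(2)[OF f] Ga(2)[OF g]
          map_comp[OF Ga(1)[OF f] Ga(1)[OF g]] conj_comp[OF f g])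
  qed
  \<comment> \<open>The unit lifts the inverse of the isomorphism chosen for the object
    \<open>Fo U\<close>; the counit is \<open>e\<close> itself.\<close>
  define \<eta> where "\<eta> U = pre U (Go (Fo U)) (e' (Fo U))" for U
  have \<eta>: "\<eta> U \<in> homset C U (Go (Fo U))" "Fa (\<eta> U) = e' (Fo U)" if U: "U \<in> obj C" for U
    unfolding \<eta>_def using pre[OF U G[OF map_obj[OF U]] e'[OF map_obj[OF U]]] by auto
  have "natural_iso C C id id (Go \<circ> Fo) (Ga \<circ> Fa) \<eta>"
    unfolding natural_iso_def
  proof (intro conjI ballI allI)
    fix U assume U: "U \<in> obj C"
    note FU = map_obj[OF U]
    let ?i = "pre (Go (Fo U)) U (e (Fo U))"
    note i = pre[OF G[OF FU] U e[OF FU]]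
    have "?i \<cdot>\<^bsub>C\<^esub> \<eta> U = ident C U"
      by (rule faithful[OF C.comp_hom[OF \<eta>(1)[OF U] i(1)] C.ident_hom[OF U]])
        (simp add: map_comp[OF \<eta>(1)[OF U] i(1)] \<eta>(2)[OF U] i(2) ee'[OF FU] map_ident[OF U])
    moreover have "\<eta> U \<cdot>\<^bsub>C\<^esub> ?i = ident C (Go (Fo U))"
      by (rule faithful[OF C.comp_hom[OF i(1) \<eta>(1)[OF U]] C.ident_hom[OF G[OF FU]]])
        (simp add: map_comp[OF i(1) \<eta>(1)[OF U]] \<eta>(2)[OF U] i(2) e'e[OF FU] map_ident[OF G[OF FU]])
    ultimately show "iso_arr C (id U) ((Go \<circ> Fo) U) (\<eta> U)"
      unfolding iso_arr_def using \<eta>(1)[OF U] i(1) by auto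
  next
    fix U V f assume f: "f \<in> homset C U V"
    note o = C.hom_obj[OF f] and Ff = map_hom[OF f]
    note FU = map_obj[OF o(1)] and FV = map_obj[OF o(2)]
    have fe: "Fa f \<cdot>\<^bsub>D\<^esub> e (Fo U) \<in> homset D (Fo (Go (Fo U))) (Fo V)"
      by (rule D.comp_hom[OF e[OF FU] Ff])
    have "conj (Fo U) (Fo V) (Fa f) \<cdot>\<^bsub>D\<^esub> e' (Fo U)
        = e' (Fo V) \<cdot>\<^bsub>D\<^esub> ((Fa f \<cdot>\<^bsub>D\<^esub> e (Fo U)) \<cdot>\<^bsub>D\<^esub> e' (Fo U))"
      unfolding conj_def by (rule D.comp_assoc[OF e'[OF FU] fe e'[OF FV], symmetric])
    also have "(Fa f \<cdot>\<^bsub>D\<^esub> e (Fo U)) \<cdot>\<^bsub>D\<^esub> e' (Fo U) = Fa f"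
      using D.comp_assoc[OF e'[OF FU] e[OF FU] Ff] ee'[OF FU] D.ident_right[OF Ff] by simp
    finally have "Ga (Fa f) \<cdot>\<^bsub>C\<^esub> \<eta> U = \<eta> V \<cdot>\<^bsub>C\<^esub> f"
      by (intro faithful[OF C.comp_hom[OF \<eta>(1)[OF o(1)] Ga(1)[OF Ff]] C.comp_hom[OF f \<eta>(1)[OF o(2)]]])
        (simp add: map_comp[OF \<eta>(1)[OF o(1)] Ga(1)[OF Ff]] map_comp[OF f \<eta>(1)[OF o(2)]]
          Ga(2)[OF Ff] \<eta>(2)[OF o(1)] \<eta>(2)[OF o(2)])
    thus "(Ga \<circ> Fa) f \<cdot>\<^bsub>C\<^esub> \<eta> U = \<eta> V \<cdot>\<^bsub>C\<^esub> id f" by simp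
  qed
  moreover have "natural_iso D D (Fo \<circ> Go) (Fa \<circ> Ga) id id e"
    unfolding natural_iso_def
  proof (intro conjI ballI allI)
    fix P assume P: "P \<in> obj D"
    show "iso_arr D ((Fo \<circ> Go) P) (id P) (e P)"
      unfolding iso_arr_def using e[OF P] e'[OF P] e'e[OF P] ee'[OF P] by auto
  next
    fix P Q f assume f: "f \<in> homset D P Q"
    show "id f \<cdot>\<^bsub>D\<^esub> e P = e Q \<cdot>\<^bsub>D\<^esub> (Fa \<circ> Ga) f"
      using e_conj[OF f] Ga(2)[OF f] by simp
  qed
  ultimately show ?thesis
    unfolding equivalent_categories_def using func G_functor by blast
qed

section \<open>Left modules\<close>

context left_module
begin

lemma act_zero_right: "a \<in> carrier R \<Longrightarrow> a \<odot>\<^bsub>M\<^esub> \<zero>\<^bsub>M\<^esub> = \<zero>\<^bsub>M\<^esub>"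
  using act_add_right[of a "\<zero>\<^bsub>M\<^esub>" "\<zero>\<^bsub>M\<^esub>"] act_closed[of a "\<zero>\<^bsub>M\<^esub>"] M.add.r_cancel_one' by simp

lemma act_zero_left: "x \<in> carrier M \<Longrightarrow> \<zero>\<^bsub>R\<^esub> \<odot>\<^bsub>M\<^esub> x = \<zero>\<^bsub>M\<^esub>"
  using act_add_left[of "\<zero>\<^bsub>R\<^esub>" "\<zero>\<^bsub>R\<^esub>" x] act_closed[of "\<zero>\<^bsub>R\<^esub>" x] M.add.r_cancel_one' by simp

lemma act_minus_right:
  assumes "a \<in> carrier R" "x \<in> carrier M"
  shows "a \<odot>\<^bsub>M\<^esub> (\<ominus>\<^bsub>M\<^esub> x) = \<ominus>\<^bsub>M\<^esub> (a \<odot>\<^bsub>M\<^esub> x)"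
  using act_add_right[of a "\<ominus>\<^bsub>M\<^esub> x" x] assms act_closed act_zero_right
  by (simp add: M.l_neg M.minus_equality)

lemma act_minus_left:
  assumes "x \<in> carrier M"
  shows "(\<ominus>\<^bsub>R\<^esub> \<one>\<^bsub>R\<^esub>) \<odot>\<^bsub>M\<^esub> x = \<ominus>\<^bsub>M\<^esub> x"
  using act_add_left[of "\<ominus>\<^bsub>R\<^esub> \<one>\<^bsub>R\<^esub>" "\<one>\<^bsub>R\<^esub>" x] assms act_closed act_zero_left act_one
  by (simp add: R.l_neg M.minus_equality)

end

text \<open>Closure under negatives comes from closure under the action of
  \<open>-1\<close>.\<close>

lemma left_module_restrict:
  assumes "left_module R M" "U \<subseteq> carrier M" "\<zero>\<^bsub>M\<^esub> \<in> U"
    "\<And>x y. x \<in> U \<Longrightarrow> y \<in> U \<Longrightarrow> x \<oplus>\<^bsub>M\<^esub> y \<in> U"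
    "\<And>a x. a \<in> carrier R \<Longrightarrow> x \<in> U \<Longrightarrow> a \<odot>\<^bsub>M\<^esub> x \<in> U"
  shows "left_module R (M\<lparr>carrier := U\<rparr>)"
proof -
  interpret left_module R M by fact
  have neg: "\<exists>y\<in>U. y \<oplus>\<^bsub>M\<^esub> x = \<zero>\<^bsub>M\<^esub>" if "x \<in> U" for x
    using assms(5)[of "\<ominus>\<^bsub>R\<^esub> \<one>\<^bsub>R\<^esub>" x] act_minus_left[of x] that assms(2)
    by (intro bexI[of _ "\<ominus>\<^bsub>M\<^esub> x"]) (auto simp: M.l_neg)
  interpret U: abelian_group "M\<lparr>carrier := U\<rparr>"
    by (rule abelian_groupI) (use assms neg in \<open>auto simp: subset_iff M.a_ac\<close>)
  show ?thesis
    by unfold_locales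
      (use assms in \<open>auto simp: subset_iff act_add_left act_add_right act_mult act_one\<close>)
qed

text \<open>One construction for two purposes: an injective \<open>\<pi>\<close> gives an isomorphic
  copy in another type, and a map to coset representatives gives a quotient. Preimages are chosen
  arbitrarily; \<open>module_congruence\<close> is the condition under which the choice does not
  matter.\<close>

definition image_module :: "('x \<Rightarrow> 'y) \<Rightarrow> ('a, 'x, 'd) module_scheme \<Rightarrow> ('a, 'y) module" where
  "image_module \<pi> M = \<lparr>carrier = \<pi> ` carrier M, monoid.mult = undefined, one = undefined,
     zero = \<pi> \<zero>\<^bsub>M\<^esub>,
     add = (\<lambda>x y. \<pi> (inv_into (carrier M) \<pi> x \<oplus>\<^bsub>M\<^esub> inv_into (carrier M) \<pi> y)),
     smult = (\<lambda>a x. \<pi> (a \<odot>\<^bsub>M\<^esub> inv_into (carrier M) \<pi> x))\<rparr>"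

locale module_congruence = left_module R M
  for R :: "('a, 'b) ring_scheme" and M :: "('a, 'x, 'd) module_scheme" +
  fixes \<pi> :: "'x \<Rightarrow> 'y"
  assumes cong_add: "x \<in> carrier M \<Longrightarrow> x' \<in> carrier M \<Longrightarrow> y \<in> carrier M \<Longrightarrow> y' \<in> carrier M \<Longrightarrow>
      \<pi> x = \<pi> x' \<Longrightarrow> \<pi> y = \<pi> y' \<Longrightarrow> \<pi> (x \<oplus>\<^bsub>M\<^esub> y) = \<pi> (x' \<oplus>\<^bsub>M\<^esub> y')"
    and cong_smult: "a \<in> carrier R \<Longrightarrow> x \<in> carrier M \<Longrightarrow> x' \<in> carrier M \<Longrightarrow>
      \<pi> x = \<pi> x' \<Longrightarrow> \<pi> (a \<odot>\<^bsub>M\<^esub> x) = \<pi> (a \<odot>\<^bsub>M\<^esub> x')"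
begin

lemma section_closed: "x \<in> carrier M \<Longrightarrow> inv_into (carrier M) \<pi> (\<pi> x) \<in> carrier M"
  by (simp add: inv_into_into)

lemma image_carrier: "carrier (image_module \<pi> M) = \<pi> ` carrier M"
  by (simp add: image_module_def)

lemma image_zero: "\<zero>\<^bsub>image_module \<pi> M\<^esub> = \<pi> \<zero>\<^bsub>M\<^esub>"
  by (simp add: image_module_def)

lemma image_add:
  "x \<in> carrier M \<Longrightarrow> y \<in> carrier M \<Longrightarrow> \<pi> x \<oplus>\<^bsub>image_module \<pi> M\<^esub> \<pi> y = \<pi> (x \<oplus>\<^bsub>M\<^esub> y)"
  unfolding image_module_def
  by (simp, rule cong_add) (auto intro: section_closed f_inv_into_f)

lemma image_smult:
  "a \<in> carrier R \<Longrightarrow> x \<in> carrier M \<Longrightarrow> a \<odot>\<^bsub>image_module \<pi> M\<^esub> \<pi> x = \<pi> (a \<odot>\<^bsub>M\<^esub> x)"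
  unfolding image_module_def
  by (simp, rule cong_smult) (auto intro: section_closed f_inv_into_f)

lemma image_left_module: "left_module R (image_module \<pi> M)"
proof -
  have neg: "\<exists>y\<in>carrier (image_module \<pi> M). y \<oplus>\<^bsub>image_module \<pi> M\<^esub> \<pi> x = \<zero>\<^bsub>image_module \<pi> M\<^esub>"
    if "x \<in> carrier M" for x
    using that by (intro bexI[of _ "\<pi> (\<ominus>\<^bsub>M\<^esub> x)"]) (auto simp: image_carrier image_add image_zero M.l_neg)
  interpret I: abelian_group "image_module \<pi> M"
    by (rule abelian_groupI) (use neg in \<open>auto simp: image_carrier image_add image_zero M.a_ac\<close>)
  show ?thesis
    by unfold_locales
      (auto simp: image_carrier image_add image_smult act_closed act_add_left act_add_right act_mult act_one)
qed

lemma image_hom: "\<pi> \<in> module_hom R M (image_module \<pi> M)"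
  unfolding module_hom_def by (auto simp: image_carrier image_add image_smult)

end

lemma module_congruence_inj:
  assumes "left_module R M" "inj_on \<pi> (carrier M)"
  shows "module_congruence R M \<pi>"
proof -
  interpret left_module R M by fact
  show ?thesis by unfold_locales (use assms(2) in \<open>auto dest: inj_onD\<close>)
qed

text \<open>Cosets are represented by elements, so that a quotient of a module stays in its type.\<close>

definition coset_rep :: "('a, 'x, 'd) module_scheme \<Rightarrow> 'x set \<Rightarrow> 'x \<Rightarrow> 'x" where
  "coset_rep M U x = (SOME y. y \<in> carrier M \<and> x \<ominus>\<^bsub>M\<^esub> y \<in> U)"

lemma coset_rep_eq_iff:
  assumes "left_module R M" and U: "U \<subseteq> carrier M" "\<zero>\<^bsub>M\<^esub> \<in> U"
    "\<And>x y. x \<in> U \<Longrightarrow> y \<in> U \<Longrightarrow> x \<oplus>\<^bsub>M\<^esub> y \<in> U"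
    "\<And>a x. a \<in> carrier R \<Longrightarrow> x \<in> U \<Longrightarrow> a \<odot>\<^bsub>M\<^esub> x \<in> U"
    and x: "x \<in> carrier M" and y: "y \<in> carrier M"
  shows "coset_rep M U x = coset_rep M U y \<longleftrightarrow> x \<ominus>\<^bsub>M\<^esub> y \<in> U"
proof -
  interpret left_module R M by fact
  have neg: "\<ominus>\<^bsub>M\<^esub> u \<in> U" if "u \<in> U" for u
    using U(4)[of "\<ominus>\<^bsub>R\<^esub> \<one>\<^bsub>R\<^esub>" u] act_minus_left[of u] that U(1) by auto
  have diff: "a \<ominus>\<^bsub>M\<^esub> c \<in> U" if "a \<ominus>\<^bsub>M\<^esub> b \<in> U" "b \<ominus>\<^bsub>M\<^esub> c \<in> U" "a \<in> carrier M" "b \<in> carrier M" "c \<in> carrier M" for a b c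
  proof -
    have "a \<ominus>\<^bsub>M\<^esub> c = (a \<ominus>\<^bsub>M\<^esub> b) \<oplus>\<^bsub>M\<^esub> (b \<ominus>\<^bsub>M\<^esub> c)"
      using that(3-5) by (simp add: a_minus_def M.a_assoc M.r_neg1)
    thus ?thesis using that U(3) by simp
  qed
  have sym: "b \<ominus>\<^bsub>M\<^esub> a \<in> U" if "a \<ominus>\<^bsub>M\<^esub> b \<in> U" "a \<in> carrier M" "b \<in> carrier M" for a b
  proof -
    have "\<ominus>\<^bsub>M\<^esub> (a \<ominus>\<^bsub>M\<^esub> b) = b \<ominus>\<^bsub>M\<^esub> a"
      using that(2,3) by (simp add: a_minus_def M.minus_add M.minus_minus M.a_comm)
    thus ?thesis using neg[OF that(1)] by simp
  qed
  have rep: "coset_rep M U z \<in> carrier M \<and> z \<ominus>\<^bsub>M\<^esub> coset_rep M U z \<in> U" if "z \<in> carrier M" for z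
    unfolding coset_rep_def
    by (rule someI[of _ z]) (use that U(2) in \<open>simp add: a_minus_def M.r_neg\<close>)
  show ?thesis
  proof
    assume "coset_rep M U x = coset_rep M U y"
    thus "x \<ominus>\<^bsub>M\<^esub> y \<in> U" using rep[OF x] rep[OF y] diff sym x y by metis
  next
    assume xy: "x \<ominus>\<^bsub>M\<^esub> y \<in> U"
    \<comment> \<open>The two predicates must be equal as functions, since only then does
      \<open>SOME\<close> pick the same representative.\<close>
    have "(\<lambda>z. z \<in> carrier M \<and> x \<ominus>\<^bsub>M\<^esub> z \<in> U) = (\<lambda>z. z \<in> carrier M \<and> y \<ominus>\<^bsub>M\<^esub> z \<in> U)"
      using diff[OF xy _ x y] diff[OF sym[OF xy x y] _ y x] by auto
    thus "coset_rep M U x = coset_rep M U y" unfolding coset_rep_def by simp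
  qed
qed

lemma coset_rep_congruence:
  assumes M: "left_module R M" and U: "U \<subseteq> carrier M" "\<zero>\<^bsub>M\<^esub> \<in> U"
    "\<And>x y. x \<in> U \<Longrightarrow> y \<in> U \<Longrightarrow> x \<oplus>\<^bsub>M\<^esub> y \<in> U"
    "\<And>a x. a \<in> carrier R \<Longrightarrow> x \<in> U \<Longrightarrow> a \<odot>\<^bsub>M\<^esub> x \<in> U"
  shows "module_congruence R M (coset_rep M U)"
proof -
  interpret left_module R M by fact
  note iff = coset_rep_eq_iff[OF M U]
  show ?thesis
  proof
    fix x x' y y' assume c: "x \<in> carrier M" "x' \<in> carrier M" "y \<in> carrier M" "y' \<in> carrier M"
      and "coset_rep M U x = coset_rep M U x'" "coset_rep M U y = coset_rep M U y'"
    hence "(x \<ominus>\<^bsub>M\<^esub> x') \<oplus>\<^bsub>M\<^esub> (y \<ominus>\<^bsub>M\<^esub> y') \<in> U" using iff U(3) by simp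
    also have "(x \<ominus>\<^bsub>M\<^esub> x') \<oplus>\<^bsub>M\<^esub> (y \<ominus>\<^bsub>M\<^esub> y') = (x \<oplus>\<^bsub>M\<^esub> y) \<ominus>\<^bsub>M\<^esub> (x' \<oplus>\<^bsub>M\<^esub> y')"
      using c by (simp add: a_minus_def M.minus_add M.a_ac)
    finally show "coset_rep M U (x \<oplus>\<^bsub>M\<^esub> y) = coset_rep M U (x' \<oplus>\<^bsub>M\<^esub> y')"
      using iff c by simp
  next
    fix a x x' assume c: "a \<in> carrier R" "x \<in> carrier M" "x' \<in> carrier M"
      and "coset_rep M U x = coset_rep M U x'"
    hence "a \<odot>\<^bsub>M\<^esub> (x \<ominus>\<^bsub>M\<^esub> x') \<in> U" using iff U(4) by simp
    also have "a \<odot>\<^bsub>M\<^esub> (x \<ominus>\<^bsub>M\<^esub> x') = a \<odot>\<^bsub>M\<^esub> x \<ominus>\<^bsub>M\<^esub> a \<odot>\<^bsub>M\<^esub> x'"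
      using c by (simp add: a_minus_def act_add_right act_minus_right)
    finally show "coset_rep M U (a \<odot>\<^bsub>M\<^esub> x) = coset_rep M U (a \<odot>\<^bsub>M\<^esub> x')"
      using iff c act_closed by simp
  qed
qed

definition prod_module :: "('a, 'x, 'd) module_scheme \<Rightarrow> ('a, 'y, 'e) module_scheme \<Rightarrow> ('a, 'x \<times> 'y) module" where
  "prod_module M N = \<lparr>carrier = carrier M \<times> carrier N, monoid.mult = undefined, one = undefined,
     zero = (\<zero>\<^bsub>M\<^esub>, \<zero>\<^bsub>N\<^esub>),
     add = (\<lambda>x y. (fst x \<oplus>\<^bsub>M\<^esub> fst y, snd x \<oplus>\<^bsub>N\<^esub> snd y)),
     smult = (\<lambda>a x. (a \<odot>\<^bsub>M\<^esub> fst x, a \<odot>\<^bsub>N\<^esub> snd x))\<rparr>"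

lemma left_module_prod:
  assumes "left_module R M" "left_module R N"
  shows "left_module R (prod_module M N)"
proof -
  interpret M: left_module R M by fact
  interpret N: left_module R N by fact
  have neg: "\<exists>y\<in>carrier (prod_module M N). y \<oplus>\<^bsub>prod_module M N\<^esub> x = \<zero>\<^bsub>prod_module M N\<^esub>"
    if "x \<in> carrier (prod_module M N)" for x
    using that by (intro bexI[of _ "(\<ominus>\<^bsub>M\<^esub> fst x, \<ominus>\<^bsub>N\<^esub> snd x)"])
      (auto simp: prod_module_def M.M.l_neg N.M.l_neg)
  interpret P: abelian_group "prod_module M N"
    by (rule abelian_groupI)
      (use neg in \<open>auto simp: prod_module_def M.M.a_ac N.M.a_ac\<close>)
  show ?thesis
    by unfold_locales (auto simp: prod_module_def M.act_closed N.act_closed M.act_add_left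
      N.act_add_left M.act_add_right N.act_add_right M.act_mult N.act_mult M.act_one N.act_one)
qed

section \<open>Modules with a Frobenius map\<close>

text \<open>Field and ring are kept general because the lemma is used for \<open>K\<close> acting
  through \<open>A\<close>, for \<open>Fq\<close> acting through \<open>A\<close>, and for
  \<open>Fq\<close> acting through the fixed algebra.\<close>

lemma underlying_vectorspace:
  fixes R :: "('k, 'a, 'c) module_scheme" and M :: "('a, 'v, 'd) module_scheme"
  assumes k: "field k" and u: "(\<lambda>c. c \<odot>\<^bsub>R\<^esub> \<one>\<^bsub>R\<^esub>) \<in> ring_hom k R" and M: "left_module R M"
  shows "vectorspace k (underlying_space R M)"
proof -
  interpret k: field k by (rule k)
  interpret M: left_module R M by (rule M)
  let ?U = "underlying_space R M"
  have uc: "c \<odot>\<^bsub>R\<^esub> \<one>\<^bsub>R\<^esub> \<in> carrier R" if "c \<in> carrier k" for c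
    using ring_hom_closed[OF u that] .
  have "abelian_group ?U"
    by (rule abelian_groupI)
      (auto simp: underlying_space_def M.M.a_ac intro: M.M.l_neg bexI[of _ "\<ominus>\<^bsub>M\<^esub> _"])
  hence "module k ?U"
    by (intro module.intro module_axioms.intro k.is_cring)
      (use uc ring_hom_add[OF u] ring_hom_mult[OF u] ring_hom_one[OF u] in
        \<open>simp_all add: underlying_space_def M.act_closed M.act_add_left M.act_add_right M.act_mult M.act_one\<close>)
  thus ?thesis by (intro vectorspace.intro k)
qed

lemma underlying_module_hom:
  assumes "(\<lambda>c. c \<odot>\<^bsub>R\<^esub> \<one>\<^bsub>R\<^esub>) \<in> ring_hom k R" "h \<in> module_hom R M N"
  shows "h \<in> module_hom k (underlying_space R M) (underlying_space R N)"
  using assms(2) ring_hom_closed[OF assms(1)] by (auto simp: module_hom_def underlying_space_def)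

locale frob_algebra = finite_base K Fq p r + AA: assoc_algebra K A
  for K :: "('k, 'e) ring_scheme" (structure) and Fq p r and A :: "('k, 'a, 'c) module_scheme" +
  fixes FA :: "'a \<Rightarrow> 'a"
  assumes FA: "frobenius_morphism K Fq A FA"
begin

lemma unit_hom: "(\<lambda>c. c \<odot>\<^bsub>A\<^esub> \<one>\<^bsub>A\<^esub>) \<in> ring_hom K A"
proof (rule ring_hom_memI)
  fix x y assume x: "x \<in> carrier K" and y: "y \<in> carrier K"
  show "(x \<otimes> y) \<odot>\<^bsub>A\<^esub> \<one>\<^bsub>A\<^esub> = (x \<odot>\<^bsub>A\<^esub> \<one>\<^bsub>A\<^esub>) \<otimes>\<^bsub>A\<^esub> (y \<odot>\<^bsub>A\<^esub> \<one>\<^bsub>A\<^esub>)"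
    using x y by (simp add: AA.smult_mult_left AA.smult_assoc1)
qed (simp_all add: AA.smult_l_distr)

lemma FA_closed: "a \<in> carrier A \<Longrightarrow> FA a \<in> carrier A"
  and FA_add: "a \<in> carrier A \<Longrightarrow> b \<in> carrier A \<Longrightarrow> FA (a \<oplus>\<^bsub>A\<^esub> b) = FA a \<oplus>\<^bsub>A\<^esub> FA b"
  and FA_mult: "a \<in> carrier A \<Longrightarrow> b \<in> carrier A \<Longrightarrow> FA (a \<otimes>\<^bsub>A\<^esub> b) = FA a \<otimes>\<^bsub>A\<^esub> FA b"
  and FA_one: "FA \<one>\<^bsub>A\<^esub> = \<one>\<^bsub>A\<^esub>"
  using FA by (auto simp: frobenius_morphism_def ring_iso_def ring_hom_def)

lemma FA_smult: "c \<in> carrier K \<Longrightarrow> a \<in> carrier A \<Longrightarrow> FA (c \<odot>\<^bsub>A\<^esub> a) = c [^] q \<odot>\<^bsub>A\<^esub> FA a"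
  and FA_periodic: "a \<in> carrier A \<Longrightarrow> \<exists>n>0. (FA ^^ n) a = a"
  using FA by (auto simp: frobenius_morphism_def frobenius_map_def)

text \<open>This makes induction over fixed points and extension from them available in the algebra
  variable, whatever the dimension of \<open>A\<close>.\<close>

sublocale AF: frob_space K Fq p r A FA
  by unfold_locales (use FA_closed FA_add FA_smult FA_periodic in auto)

lemma FA_zero: "FA \<zero>\<^bsub>A\<^esub> = \<zero>\<^bsub>A\<^esub>" by (rule AF.F_zero)

end

text \<open>An \<open>F\<close>-stable module before any condition on its dimension; that condition
  becomes a count of fixed points in \<open>F_module_iff\<close>.\<close>

locale semilinear_module = frob_algebra K Fq p r A FA + M: left_module A M
  for K :: "('k, 'e) ring_scheme" (structure) and Fq p r and A :: "('k, 'a, 'c) module_scheme"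
    and FA and M :: "('a, 'v) module" +
  fixes F :: "'v \<Rightarrow> 'v"
  assumes FM_closed: "x \<in> carrier M \<Longrightarrow> F x \<in> carrier M"
    and FM_add: "x \<in> carrier M \<Longrightarrow> y \<in> carrier M \<Longrightarrow> F (x \<oplus>\<^bsub>M\<^esub> y) = F x \<oplus>\<^bsub>M\<^esub> F y"
    and FM_act: "a \<in> carrier A \<Longrightarrow> x \<in> carrier M \<Longrightarrow> F (a \<odot>\<^bsub>M\<^esub> x) = FA a \<odot>\<^bsub>M\<^esub> F x"
    and FM_periodic: "x \<in> carrier M \<Longrightarrow> \<exists>n>0. (F ^^ n) x = x"
begin

lemma underlying_simps:
  "carrier (underlying_space A M) = carrier M"
  "\<zero>\<^bsub>underlying_space A M\<^esub> = \<zero>\<^bsub>M\<^esub>"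
  "x \<oplus>\<^bsub>underlying_space A M\<^esub> y = x \<oplus>\<^bsub>M\<^esub> y"
  "c \<odot>\<^bsub>underlying_space A M\<^esub> x = (c \<odot>\<^bsub>A\<^esub> \<one>\<^bsub>A\<^esub>) \<odot>\<^bsub>M\<^esub> x"
  by (simp_all add: underlying_space_def)

sublocale U: vectorspace K "underlying_space A M"
  by (rule underlying_vectorspace[OF field_axioms unit_hom M.left_module_axioms])

sublocale U: frob_space K Fq p r "underlying_space A M" F
  by unfold_locales
    (simp_all add: underlying_simps FM_closed FM_add FM_act FM_periodic FA_smult FA_one)

lemma fixed_eq: "U.fixed = {m \<in> carrier M. F m = m}"
  by (simp add: U.fixed_def underlying_simps)

lemma FM_zero: "F \<zero>\<^bsub>M\<^esub> = \<zero>\<^bsub>M\<^esub>"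
  using U.F_zero by (simp add: underlying_simps)

lemma FM_minus: "x \<in> carrier M \<Longrightarrow> F (\<ominus>\<^bsub>M\<^esub> x) = \<ominus>\<^bsub>M\<^esub> F x"
  using FM_add[of "\<ominus>\<^bsub>M\<^esub> x" x] FM_closed M.M.minus_equality[of "F (\<ominus>\<^bsub>M\<^esub> x)" "F x"]
  by (simp add: M.M.l_neg FM_zero)

lemma FMpow_closed: "x \<in> carrier M \<Longrightarrow> (F ^^ n) x \<in> carrier M"
  by (induction n) (auto simp: FM_closed)

text \<open>Bijectivity of \<open>F\<close> follows from periodicity, linearity over
  \<open>Fq\<close> from \<open>Fq_frob\<close>, and the dimension is handled by
  \<open>fin_dim_iff\<close>. Kernels, quotients and products can then be recognised as objects by
  counting fixed points.\<close>

lemma F_module: "F_module K Fq A FA (M, F) \<longleftrightarrow> finite {m \<in> carrier M. F m = m}"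
proof -
  let ?U = "underlying_space A M"
  interpret Fqf: field "K\<lparr>carrier := Fq\<rparr>" by (rule Fq_field)
  have u: "(\<lambda>c. c \<odot>\<^bsub>A\<^esub> \<one>\<^bsub>A\<^esub>) \<in> ring_hom (K\<lparr>carrier := Fq\<rparr>) A"
    using unit_hom Fq_carrier by (auto simp: ring_hom_def)
  interpret W: vectorspace "K\<lparr>carrier := Fq\<rparr>" ?U
    by (rule underlying_vectorspace[OF Fq_field u M.left_module_axioms])
  have "F \<in> module_hom (K\<lparr>carrier := Fq\<rparr>) ?U ?U"
    unfolding module_hom_def using U.F_closed U.F_add U.F_smult Fq_carrier Fq_frob by auto
  hence lin: "linear_map (K\<lparr>carrier := Fq\<rparr>) ?U ?U F"
    by (intro linear_map.intro mod_hom.intro mod_hom_axioms.intro W.vectorspace_axioms W.module_axioms)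
  have "inj_on F (carrier M)"
  proof (rule inj_onI)
    fix x y assume xy: "x \<in> carrier M" "y \<in> carrier M" "F x = F y"
    obtain n m where n: "n > 0" "(F ^^ n) x = x" "m > 0" "(F ^^ m) y = y"
      using FM_periodic xy by meson
    \<comment> \<open>\<open>F x = F y\<close> yields agreement of the positive iterates only; the
      common period \<open>n * m\<close> is positive, and there the iterates are \<open>x\<close>
      and \<open>y\<close>.\<close>
    have "(F ^^ Suc i) x = (F ^^ Suc i) y" for i by (induction i) (use xy in auto)
    hence "(F ^^ (n * m)) x = (F ^^ (n * m)) y"
      using n by (metis gr0_implies_Suc mult_pos_pos)
    thus "x = y" using U.Fpow_dvd[of n x "n * m"] U.Fpow_dvd[of m y "n * m"] n by simp
  qed
  moreover have "F ` carrier M = carrier M"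
  proof
    show "carrier M \<subseteq> F ` carrier M"
    proof
      fix x assume x: "x \<in> carrier M"
      then obtain n where n: "n > 0" "(F ^^ n) x = x" using FM_periodic by meson
      hence "F ((F ^^ (n - 1)) x) = x" by (cases n) auto
      thus "x \<in> F ` carrier M" using FMpow_closed[OF x, of "n - 1"] by force
    qed
  qed (use FM_closed in auto)
  ultimately have "bij_betw F (carrier M) (carrier M)" by (simp add: bij_betw_def)
  hence "frobenius_map K Fq ?U F"
    unfolding frobenius_map_def using lin U.F_smult U.F_periodic by (auto simp: underlying_simps(1))
  moreover have "U.fin_dim \<longleftrightarrow> finite {m \<in> carrier M. F m = m}"
    unfolding U.fin_dim_def U.fin_dim_iff[unfolded fixed_eq] ..
  ultimately show ?thesis
    unfolding F_module_def fd_left_module_def using M.left_module_axioms FM_act by auto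
qed

end

context frob_algebra
begin

lemma F_module_iff:
  "F_module K Fq A FA (M, F) \<longleftrightarrow>
    semilinear_module K Fq p r A FA M F \<and> finite {m \<in> carrier M. F m = m}"
proof
  assume L: "F_module K Fq A FA (M, F)"
  hence M: "left_module A M" and F: "frobenius_map K Fq (underlying_space A M) F"
    and act: "\<And>a m. a \<in> carrier A \<Longrightarrow> m \<in> carrier M \<Longrightarrow> F (a \<odot>\<^bsub>M\<^esub> m) = FA a \<odot>\<^bsub>M\<^esub> F m"
    unfolding F_module_def fd_left_module_def by auto
  interpret M: left_module A M by (rule M)
  interpret l: linear_map "K\<lparr>carrier := Fq\<rparr>" "underlying_space A M" "underlying_space A M" F
    using F unfolding frobenius_map_def by blast
  have S: "semilinear_module K Fq p r A FA M F"
  proof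
    show "F x \<in> carrier M" if "x \<in> carrier M" for x
      using module_hom_closed[OF l.T_hom] that by (auto simp: underlying_space_def)
    show "F (x \<oplus>\<^bsub>M\<^esub> y) = F x \<oplus>\<^bsub>M\<^esub> F y" if "x \<in> carrier M" "y \<in> carrier M" for x y
      using module_hom_add[OF l.T_hom] that by (auto simp: underlying_space_def)
    show "\<exists>n>0. (F ^^ n) x = x" if "x \<in> carrier M" for x
      using F that by (auto simp: frobenius_map_def underlying_space_def)
  qed (use act in auto)
  thus "semilinear_module K Fq p r A FA M F \<and> finite {m \<in> carrier M. F m = m}"
    using semilinear_module.F_module[OF S] L by blast
next
  assume "semilinear_module K Fq p r A FA M F \<and> finite {m \<in> carrier M. F m = m}"
  thus "F_module K Fq A FA (M, F)" using semilinear_module.F_module by blast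
qed

end

section \<open>Images, submodules, quotients and products of \<open>F\<close>-stable modules\<close>

definition image_map :: "('x \<Rightarrow> 'y) \<Rightarrow> ('a, 'x, 'd) module_scheme \<Rightarrow> ('x \<Rightarrow> 'x) \<Rightarrow> 'y \<Rightarrow> 'y" where
  "image_map \<pi> M F = (\<lambda>y. \<pi> (F (inv_into (carrier M) \<pi> y)))"

context semilinear_module
begin

text \<open>The last claim is the substantial one: that each fixed point of the image comes from a
  fixed point is not formal when \<open>\<pi>\<close> is not injective. It makes quotients finite
  dimensional.\<close>

lemma image_semilinear:
  fixes \<pi> :: "'v \<Rightarrow> 'y"
  assumes cong: "module_congruence A M \<pi>"
    and F_cong: "\<And>x x'. x \<in> carrier M \<Longrightarrow> x' \<in> carrier M \<Longrightarrow> \<pi> x = \<pi> x' \<Longrightarrow> \<pi> (F x) = \<pi> (F x')"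
  shows "semilinear_module K Fq p r A FA (image_module \<pi> M) (image_map \<pi> M F)"
    and "\<And>x. x \<in> carrier M \<Longrightarrow> image_map \<pi> M F (\<pi> x) = \<pi> (F x)"
    and "{y \<in> carrier (image_module \<pi> M). image_map \<pi> M F y = y} = \<pi> ` {x \<in> carrier M. F x = x}"
proof -
  interpret P: module_congruence A M \<pi> by (rule cong)
  interpret I: left_module A "image_module \<pi> M" by (rule P.image_left_module)
  show im: "image_map \<pi> M F (\<pi> x) = \<pi> (F x)" if "x \<in> carrier M" for x
    unfolding image_map_def using that by (intro F_cong) (auto intro: P.section_closed f_inv_into_f)
  have impow: "(image_map \<pi> M F ^^ n) (\<pi> x) = \<pi> ((F ^^ n) x)" if "x \<in> carrier M" for x n
    by (induction n) (use that im FMpow_closed in auto)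
  show S: "semilinear_module K Fq p r A FA (image_module \<pi> M) (image_map \<pi> M F)"
  proof
    show "\<exists>n>0. (image_map \<pi> M F ^^ n) y = y" if yc: "y \<in> carrier (image_module \<pi> M)" for y
    proof -
      obtain x where x: "x \<in> carrier M" "y = \<pi> x" using yc by (auto simp: P.image_carrier)
      obtain n where "n > 0" "(F ^^ n) x = x" using FM_periodic[OF x(1)] by blast
      thus ?thesis using x impow by auto
    qed
  qed (auto simp: P.image_carrier P.image_add P.image_smult im FM_closed FM_add FM_act
        M.act_closed FA_closed)
  interpret S: semilinear_module K Fq p r A FA "image_module \<pi> M" "image_map \<pi> M F" by (rule S)
  show "{y \<in> carrier (image_module \<pi> M). image_map \<pi> M F y = y} = \<pi> ` {x \<in> carrier M. F x = x}"
  proof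
    show "{y \<in> carrier (image_module \<pi> M). image_map \<pi> M F y = y} \<subseteq> \<pi> ` {x \<in> carrier M. F x = x}"
    proof
      fix y assume "y \<in> {y \<in> carrier (image_module \<pi> M). image_map \<pi> M F y = y}"
      then obtain x where x: "x \<in> carrier M" "\<pi> x \<in> S.U.fixed" "y = \<pi> x"
        by (auto simp: P.image_carrier S.fixed_eq)
      \<comment> \<open>The element \<open>x\<close> need not be fixed; \<open>fixed_lift\<close>
        replaces it by a fixed element with the same image.\<close>
      have "\<exists>u\<in>U.fixed. \<pi> u = \<pi> x"
        by (rule U.fixed_lift[OF S.U.frob_space_axioms underlying_module_hom[OF unit_hom P.image_hom]])
          (use x im in \<open>auto simp: underlying_simps\<close>)
      then obtain u where "u \<in> carrier M" "F u = u" "\<pi> u = \<pi> x" by (auto simp: fixed_eq)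
      thus "y \<in> \<pi> ` {x \<in> carrier M. F x = x}" using x by (auto intro: image_eqI[of _ _ u])
    qed
  qed (auto simp: P.image_carrier im)
qed

lemma restrict_semilinear:
  assumes "S \<subseteq> carrier M" "\<zero>\<^bsub>M\<^esub> \<in> S"
    "\<And>x y. x \<in> S \<Longrightarrow> y \<in> S \<Longrightarrow> x \<oplus>\<^bsub>M\<^esub> y \<in> S"
    "\<And>a x. a \<in> carrier A \<Longrightarrow> x \<in> S \<Longrightarrow> a \<odot>\<^bsub>M\<^esub> x \<in> S"
    "\<And>x. x \<in> S \<Longrightarrow> F x \<in> S"
  shows "semilinear_module K Fq p r A FA (M\<lparr>carrier := S\<rparr>) F"
proof -
  interpret S: left_module A "M\<lparr>carrier := S\<rparr>"
    by (rule left_module_restrict[OF M.left_module_axioms assms(1-4)])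
  show ?thesis
    by unfold_locales (use assms FM_add FM_act FM_periodic in \<open>auto simp: subset_iff\<close>)
qed

text \<open>Only a surjection with kernel \<open>S\<close> is exported, so that later arguments do
  not see the representatives by which the quotient is encoded.\<close>

lemma quotient_semilinear:
  assumes S: "S \<subseteq> carrier M" "\<zero>\<^bsub>M\<^esub> \<in> S"
    "\<And>x y. x \<in> S \<Longrightarrow> y \<in> S \<Longrightarrow> x \<oplus>\<^bsub>M\<^esub> y \<in> S"
    "\<And>a x. a \<in> carrier A \<Longrightarrow> x \<in> S \<Longrightarrow> a \<odot>\<^bsub>M\<^esub> x \<in> S"
    and FS: "\<And>x. x \<in> S \<Longrightarrow> F x \<in> S"
    and fin: "finite {m \<in> carrier M. F m = m}"
  shows "\<exists>N G \<pi>. F_module K Fq A FA (N :: ('a, 'v) module, G) \<and>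
    \<pi> \<in> module_hom A M N \<and> (\<forall>x\<in>carrier M. \<pi> (F x) = G (\<pi> x)) \<and>
    \<pi> ` carrier M = carrier N \<and> (\<forall>x\<in>carrier M. \<pi> x = \<zero>\<^bsub>N\<^esub> \<longleftrightarrow> x \<in> S)"
proof -
  let ?\<pi> = "coset_rep M S"
  have iff: "?\<pi> x = ?\<pi> y \<longleftrightarrow> x \<ominus>\<^bsub>M\<^esub> y \<in> S" if "x \<in> carrier M" "y \<in> carrier M" for x y
    using M.left_module_axioms S that by (rule coset_rep_eq_iff)
  have cong: "module_congruence A M ?\<pi>"
    using M.left_module_axioms S by (rule coset_rep_congruence)
  interpret P: module_congruence A M ?\<pi> by (rule cong)
  have F_cong: "?\<pi> (F x) = ?\<pi> (F x')" if "x \<in> carrier M" "x' \<in> carrier M" "?\<pi> x = ?\<pi> x'" for x x'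
  proof -
    have "F (x \<ominus>\<^bsub>M\<^esub> x') \<in> S" using that iff FS by simp
    thus ?thesis using that iff FM_closed by (simp add: a_minus_def FM_add FM_minus)
  qed
  have I2: "image_map ?\<pi> M F (?\<pi> x) = ?\<pi> (F x)" if "x \<in> carrier M" for x
    using cong F_cong that by (rule image_semilinear(2))
  have I3: "{y \<in> carrier (image_module ?\<pi> M). image_map ?\<pi> M F y = y} = ?\<pi> ` {x \<in> carrier M. F x = x}"
    using cong F_cong by (rule image_semilinear(3))
  have sm: "semilinear_module K Fq p r A FA (image_module ?\<pi> M) (image_map ?\<pi> M F)"
    using cong F_cong by (rule image_semilinear(1))
  have "finite (?\<pi> ` {m \<in> carrier M. F m = m})" using fin by (rule finite_imageI)
  hence "finite {y \<in> carrier (image_module ?\<pi> M). image_map ?\<pi> M F y = y}"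
    by (rule ssubst[OF I3])
  hence "F_module K Fq A FA (image_module ?\<pi> M, image_map ?\<pi> M F)"
    using sm by (intro F_module_iff[THEN iffD2] conjI)
  moreover have "?\<pi> x = \<zero>\<^bsub>image_module ?\<pi> M\<^esub> \<longleftrightarrow> x \<in> S" if "x \<in> carrier M" for x
  proof -
    have "\<ominus>\<^bsub>M\<^esub> \<zero>\<^bsub>M\<^esub> = \<zero>\<^bsub>M\<^esub>" by (rule M.M.minus_equality) auto
    hence "x \<ominus>\<^bsub>M\<^esub> \<zero>\<^bsub>M\<^esub> = x" using that unfolding a_minus_def by (simp only: M.M.r_zero)
    thus ?thesis unfolding P.image_zero iff[OF that M.M.zero_closed] by (simp only:)
  qed
  moreover have "\<forall>x\<in>carrier M. ?\<pi> (F x) = image_map ?\<pi> M F (?\<pi> x)"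
    using I2 by simp
  ultimately show ?thesis
    using P.image_hom P.image_carrier
    by (intro exI[of _ "image_module ?\<pi> M"] exI[of _ "image_map ?\<pi> M F"] exI[of _ ?\<pi>] conjI ballI)
      simp_all
qed

end

lemma (in frob_algebra) prod_semilinear:
  assumes "semilinear_module K Fq p r A FA M F" "semilinear_module K Fq p r A FA N G"
  shows "semilinear_module K Fq p r A FA (prod_module M N) (map_prod F G)"
proof -
  interpret M: semilinear_module K Fq p r A FA M F by fact
  interpret N: semilinear_module K Fq p r A FA N G by fact
  interpret P: left_module A "prod_module M N"
    by (rule left_module_prod[OF M.M.left_module_axioms N.M.left_module_axioms])
  have pow: "(map_prod F G ^^ n) (x, y) = ((F ^^ n) x, (G ^^ n) y)" for n x y
    by (induction n) auto
  show ?thesis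
  proof
    show "\<exists>n>0. (map_prod F G ^^ n) z = z" if zc: "z \<in> carrier (prod_module M N)" for z
    proof -
      obtain x y where z: "z = (x, y)" "x \<in> carrier M" "y \<in> carrier N"
        using zc by (auto simp: prod_module_def)
      obtain n where n: "n > 0" "(F ^^ n) x = x" using M.FM_periodic[OF z(2)] by blast
      obtain m where m: "m > 0" "(G ^^ m) y = y" using N.FM_periodic[OF z(3)] by blast
      have "(map_prod F G ^^ (n * m)) z = z"
        using M.U.Fpow_dvd[OF n(2), of "n * m"] N.U.Fpow_dvd[OF m(2), of "n * m"] by (simp add: z pow)
      thus ?thesis using n m by (intro exI[of _ "n * m"]) simp
    qed
  qed (auto simp: prod_module_def M.FM_closed N.FM_closed M.FM_add N.FM_add M.FM_act N.FM_act)
qed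

section \<open>The abelian category of F-stable modules\<close>

context frob_algebra
begin

definition F_hom ::
  "('a, 'v) module \<times> ('v \<Rightarrow> 'v) \<Rightarrow> ('a, 'v) module \<times> ('v \<Rightarrow> 'v) \<Rightarrow> ('v \<Rightarrow> 'v) \<Rightarrow> bool" where
  "F_hom U V \<theta> \<longleftrightarrow> \<theta> \<in> module_hom A (fst U) (fst V) \<and> \<theta> \<in> extensional (carrier (fst U)) \<and>
    (\<forall>m \<in> carrier (fst U). \<theta> (snd U m) = snd V (\<theta> m))"

abbreviation F_obj :: "('a, 'v) module \<times> ('v \<Rightarrow> 'v) \<Rightarrow> bool" where
  "F_obj \<equiv> F_module K Fq A FA"

abbreviation modF :: "(('a, 'v) module \<times> ('v \<Rightarrow> 'v),
    (('a, 'v) module \<times> ('v \<Rightarrow> 'v)) \<times> ('v \<Rightarrow> 'v) \<times> (('a, 'v) module \<times> ('v \<Rightarrow> 'v))) cat" where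
  "modF \<equiv> modF_cat K Fq A FA"

lemma modF_simps:
  "obj modF = {U. F_obj U}"
  "src modF (U, \<theta>, V) = U" "tgt modF (U, \<theta>, V) = V"
  "ident modF U = (U, \<lambda>m \<in> carrier (fst U). m, U)"
  "(U', \<psi>, V') \<cdot>\<^bsub>modF\<^esub> (U, \<theta>, V) = (U, compose (carrier (fst U)) \<psi> \<theta>, V')"
  by (simp_all add: modF_cat_def)

lemma arr_modF: "x \<in> arr modF \<longleftrightarrow> (\<exists>U \<theta> V. x = (U, \<theta>, V) \<and> F_obj U \<and> F_obj V \<and> F_hom U V \<theta>)"
  by (auto simp: modF_cat_def F_hom_def)

lemma homset_modF:
  "x \<in> homset modF U V \<longleftrightarrow> F_obj U \<and> F_obj V \<and> (\<exists>\<theta>. x = (U, \<theta>, V) \<and> F_hom U V \<theta>)"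
  unfolding homset_def using arr_modF[of x] by (cases x; cases U; cases V) (auto simp: modF_simps)

lemma homset_modFI: "F_obj U \<Longrightarrow> F_obj V \<Longrightarrow> F_hom U V \<theta> \<Longrightarrow> (U, \<theta>, V) \<in> homset modF U V"
  by (simp add: homset_modF)

lemma F_objD:
  assumes "F_obj U"
  shows "semilinear_module K Fq p r A FA (fst U) (snd U)"
    and "finite {m \<in> carrier (fst U). snd U m = m}"
  using assms F_module_iff[of "fst U" "snd U"] by auto

lemma F_homI:
  assumes "\<And>x. x \<in> carrier (fst U) \<Longrightarrow> \<theta> x \<in> carrier (fst V)"
    "\<And>x y. x \<in> carrier (fst U) \<Longrightarrow> y \<in> carrier (fst U) \<Longrightarrow>
      \<theta> (x \<oplus>\<^bsub>fst U\<^esub> y) = \<theta> x \<oplus>\<^bsub>fst V\<^esub> \<theta> y"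
    "\<And>a x. a \<in> carrier A \<Longrightarrow> x \<in> carrier (fst U) \<Longrightarrow> \<theta> (a \<odot>\<^bsub>fst U\<^esub> x) = a \<odot>\<^bsub>fst V\<^esub> \<theta> x"
    "\<And>x. x \<in> carrier (fst U) \<Longrightarrow> \<theta> (snd U x) = snd V (\<theta> x)"
    "\<theta> \<in> extensional (carrier (fst U))"
  shows "F_hom U V \<theta>"
  using assms unfolding F_hom_def module_hom_def by auto

lemma F_homD:
  assumes "F_hom U V \<theta>"
  shows "x \<in> carrier (fst U) \<Longrightarrow> \<theta> x \<in> carrier (fst V)"
    "x \<in> carrier (fst U) \<Longrightarrow> y \<in> carrier (fst U) \<Longrightarrow>
      \<theta> (x \<oplus>\<^bsub>fst U\<^esub> y) = \<theta> x \<oplus>\<^bsub>fst V\<^esub> \<theta> y"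
    "a \<in> carrier A \<Longrightarrow> x \<in> carrier (fst U) \<Longrightarrow> \<theta> (a \<odot>\<^bsub>fst U\<^esub> x) = a \<odot>\<^bsub>fst V\<^esub> \<theta> x"
    "x \<in> carrier (fst U) \<Longrightarrow> \<theta> (snd U x) = snd V (\<theta> x)"
    "\<theta> \<in> extensional (carrier (fst U))"
  using assms unfolding F_hom_def module_hom_def by auto

lemma F_hom_zero:
  assumes "F_obj U" "F_obj V" "F_hom U V \<theta>" shows "\<theta> \<zero>\<^bsub>fst U\<^esub> = \<zero>\<^bsub>fst V\<^esub>"
proof -
  interpret U: semilinear_module K Fq p r A FA "fst U" "snd U" by (rule F_objD(1)[OF assms(1)])
  interpret V: semilinear_module K Fq p r A FA "fst V" "snd V" by (rule F_objD(1)[OF assms(2)])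
  have "\<theta> \<zero>\<^bsub>fst U\<^esub> \<oplus>\<^bsub>fst V\<^esub> \<theta> \<zero>\<^bsub>fst U\<^esub> = \<theta> \<zero>\<^bsub>fst U\<^esub>"
    using F_homD(2)[OF assms(3), of "\<zero>\<^bsub>fst U\<^esub>" "\<zero>\<^bsub>fst U\<^esub>"] by simp
  thus ?thesis using F_homD(1)[OF assms(3)] V.M.M.add.r_cancel_one' by simp
qed

lemma F_hom_minus:
  assumes "F_obj U" "F_obj V" "F_hom U V \<theta>" "x \<in> carrier (fst U)"
  shows "\<theta> (\<ominus>\<^bsub>fst U\<^esub> x) = \<ominus>\<^bsub>fst V\<^esub> \<theta> x"
proof -
  interpret U: semilinear_module K Fq p r A FA "fst U" "snd U" by (rule F_objD(1)[OF assms(1)])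
  interpret V: semilinear_module K Fq p r A FA "fst V" "snd V" by (rule F_objD(1)[OF assms(2)])
  have "\<theta> (\<ominus>\<^bsub>fst U\<^esub> x) \<oplus>\<^bsub>fst V\<^esub> \<theta> x = \<zero>\<^bsub>fst V\<^esub>"
    using F_homD(2)[OF assms(3), of "\<ominus>\<^bsub>fst U\<^esub> x" x] assms(4) F_hom_zero[OF assms(1-3)]
    by (simp add: U.M.M.l_neg)
  thus ?thesis
    using F_homD(1)[OF assms(3)] assms(4) V.M.M.minus_equality[of "\<theta> (\<ominus>\<^bsub>fst U\<^esub> x)" "\<theta> x"] by simp
qed

lemma F_hom_inj:
  assumes "F_obj U" "F_obj V" "F_hom U V \<theta>"
    and ker: "\<And>x. x \<in> carrier (fst U) \<Longrightarrow> \<theta> x = \<zero>\<^bsub>fst V\<^esub> \<Longrightarrow> x = \<zero>\<^bsub>fst U\<^esub>"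
  shows "inj_on \<theta> (carrier (fst U))"
proof (rule inj_onI)
  interpret U: semilinear_module K Fq p r A FA "fst U" "snd U" by (rule F_objD(1)[OF assms(1)])
  interpret V: semilinear_module K Fq p r A FA "fst V" "snd V" by (rule F_objD(1)[OF assms(2)])
  fix x y assume xy: "x \<in> carrier (fst U)" "y \<in> carrier (fst U)" "\<theta> x = \<theta> y"
  have "\<theta> (x \<oplus>\<^bsub>fst U\<^esub> \<ominus>\<^bsub>fst U\<^esub> y) = \<zero>\<^bsub>fst V\<^esub>"
    using xy F_homD(1,2)[OF assms(3)] F_hom_minus[OF assms(1-3)] by (simp add: V.M.M.r_neg)
  hence "x \<oplus>\<^bsub>fst U\<^esub> \<ominus>\<^bsub>fst U\<^esub> y = \<zero>\<^bsub>fst U\<^esub>" using ker xy by simp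
  thus "x = y" using xy U.M.M.minus_equality[of x "\<ominus>\<^bsub>fst U\<^esub> y"] by (simp add: U.M.M.minus_minus)
qed

lemma F_hom_ident: "F_obj U \<Longrightarrow> F_hom U U (\<lambda>m \<in> carrier (fst U). m)"
proof (rule F_homI)
  assume "F_obj U"
  then interpret U: semilinear_module K Fq p r A FA "fst U" "snd U" by (rule F_objD(1))
  show "(\<lambda>m \<in> carrier (fst U). m) (a \<odot>\<^bsub>fst U\<^esub> x) = a \<odot>\<^bsub>fst U\<^esub> (\<lambda>m \<in> carrier (fst U). m) x"
    if "a \<in> carrier A" "x \<in> carrier (fst U)" for a x
    using that U.M.act_closed by simp
  show "(\<lambda>m \<in> carrier (fst U). m) (snd U x) = snd U ((\<lambda>m \<in> carrier (fst U). m) x)"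
    if "x \<in> carrier (fst U)" for x
    using that U.FM_closed by simp
  show "(\<lambda>m \<in> carrier (fst U). m) (x \<oplus>\<^bsub>fst U\<^esub> y) =
      (\<lambda>m \<in> carrier (fst U). m) x \<oplus>\<^bsub>fst U\<^esub> (\<lambda>m \<in> carrier (fst U). m) y"
    if "x \<in> carrier (fst U)" "y \<in> carrier (fst U)" for x y
    using that by simp
qed simp_all

lemma F_hom_comp:
  assumes "F_obj U" "F_hom U V \<theta>" "F_hom V W \<psi>"
  shows "F_hom U W (compose (carrier (fst U)) \<psi> \<theta>)"
proof -
  interpret U: semilinear_module K Fq p r A FA "fst U" "snd U" by (rule F_objD(1)[OF assms(1)])
  note t = F_homD[OF assms(2)] and s = F_homD[OF assms(3)]
  show ?thesis
    by (rule F_homI) (simp_all add: compose_eq t(1-4) s(1-4) U.M.act_closed U.FM_closed)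
qed

lemma category_modF: "category (modF :: (('a, 'v) module \<times> ('v \<Rightarrow> 'v), _) cat)"
proof
  fix f :: "(('a, 'v) module \<times> ('v \<Rightarrow> 'v)) \<times> ('v \<Rightarrow> 'v) \<times> (('a, 'v) module \<times> ('v \<Rightarrow> 'v))"
  assume "f \<in> arr modF"
  thus "src modF f \<in> obj modF" "tgt modF f \<in> obj modF"
    by (auto simp: arr_modF modF_simps)
next
  fix U :: "('a, 'v) module \<times> ('v \<Rightarrow> 'v)"
  assume "U \<in> obj modF"
  thus "ident modF U \<in> homset modF U U"
    using F_hom_ident[of U] by (auto simp: modF_simps homset_modF)
next
  fix f g :: "(('a, 'v) module \<times> ('v \<Rightarrow> 'v)) \<times> ('v \<Rightarrow> 'v) \<times> (('a, 'v) module \<times> ('v \<Rightarrow> 'v))"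
    and U V Z
  assume "f \<in> homset modF U V" "g \<in> homset modF V Z"
  then obtain \<theta> \<psi> where "F_obj U" "F_obj Z" "f = (U, \<theta>, V)" "g = (V, \<psi>, Z)" "F_hom U V \<theta>" "F_hom V Z \<psi>"
    by (auto simp: homset_modF)
  thus "g \<cdot>\<^bsub>modF\<^esub> f \<in> homset modF U Z"
    using F_hom_comp[of U V \<theta> Z \<psi>] by (simp add: homset_modF modF_simps)
next
  fix f :: "(('a, 'v) module \<times> ('v \<Rightarrow> 'v)) \<times> ('v \<Rightarrow> 'v) \<times> (('a, 'v) module \<times> ('v \<Rightarrow> 'v))"
    and U V
  assume "f \<in> homset modF U V"
  then obtain \<theta> where f: "f = (U, \<theta>, V)" "F_obj U" "F_obj V" "F_hom U V \<theta>" by (auto simp: homset_modF)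
  interpret U: semilinear_module K Fq p r A FA "fst U" "snd U" by (rule F_objD(1)[OF f(2)])
  show "f \<cdot>\<^bsub>modF\<^esub> ident modF U = f" "ident modF V \<cdot>\<^bsub>modF\<^esub> f = f"
    using F_homD(1,5)[OF f(4)] by (auto simp: f(1) modF_simps compose_def extensional_def restrict_def fun_eq_iff)
next
  fix f g h :: "(('a, 'v) module \<times> ('v \<Rightarrow> 'v)) \<times> ('v \<Rightarrow> 'v) \<times> (('a, 'v) module \<times> ('v \<Rightarrow> 'v))"
    and W U V Z
  assume "f \<in> homset modF W U" "g \<in> homset modF U V" "h \<in> homset modF V Z"
  thus "h \<cdot>\<^bsub>modF\<^esub> (g \<cdot>\<^bsub>modF\<^esub> f) = (h \<cdot>\<^bsub>modF\<^esub> g) \<cdot>\<^bsub>modF\<^esub> f"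
    using F_homD(1)[of W U] by (auto simp: homset_modF modF_simps compose_def restrict_def fun_eq_iff)
qed

section \<open>Additive structure, kernels and cokernels\<close>

definition pl where
  "pl f g = (fst f, \<lambda>m \<in> carrier (fst (fst f)). fst (snd f) m \<oplus>\<^bsub>fst (snd (snd f))\<^esub> fst (snd g) m, snd (snd f))"

definition zr :: "('a, 'v) module \<times> ('v \<Rightarrow> 'v) \<Rightarrow> ('a, 'v) module \<times> ('v \<Rightarrow> 'v) \<Rightarrow>
  (('a, 'v) module \<times> ('v \<Rightarrow> 'v)) \<times> ('v \<Rightarrow> 'v) \<times> (('a, 'v) module \<times> ('v \<Rightarrow> 'v))" where
  "zr U V = (U, \<lambda>m \<in> carrier (fst U). \<zero>\<^bsub>fst V\<^esub>, V)"

lemma pl_simp: "pl (U, \<theta>, V) (U, \<psi>, V) = (U, \<lambda>m \<in> carrier (fst U). \<theta> m \<oplus>\<^bsub>fst V\<^esub> \<psi> m, V)"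
  by (simp add: pl_def)

lemma F_hom_plus:
  assumes "F_obj U" "F_obj V" "F_hom U V \<theta>" "F_hom U V \<psi>"
  shows "F_hom U V (\<lambda>m \<in> carrier (fst U). \<theta> m \<oplus>\<^bsub>fst V\<^esub> \<psi> m)"
proof -
  interpret U: semilinear_module K Fq p r A FA "fst U" "snd U" by (rule F_objD(1)[OF assms(1)])
  interpret V: semilinear_module K Fq p r A FA "fst V" "snd V" by (rule F_objD(1)[OF assms(2)])
  note t = F_homD[OF assms(3)] and s = F_homD[OF assms(4)]
  show ?thesis
    by (rule F_homI)
      (simp_all add: t(1-4) s(1-4) U.M.act_closed U.FM_closed V.M.M.a_ac V.M.act_add_right V.FM_add
        V.M.act_closed V.FM_closed)
qed

lemma F_hom_zero_map:
  assumes "F_obj U" "F_obj V" shows "F_hom U V (\<lambda>m \<in> carrier (fst U). \<zero>\<^bsub>fst V\<^esub>)"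
proof -
  interpret U: semilinear_module K Fq p r A FA "fst U" "snd U" by (rule F_objD(1)[OF assms(1)])
  interpret V: semilinear_module K Fq p r A FA "fst V" "snd V" by (rule F_objD(1)[OF assms(2)])
  show ?thesis
    by (rule F_homI)
      (simp_all add: U.M.act_closed U.FM_closed V.M.act_zero_right V.FM_zero)
qed

lemma F_hom_neg_map:
  assumes "F_obj U" "F_obj V" "F_hom U V \<theta>"
  shows "F_hom U V (\<lambda>m \<in> carrier (fst U). \<ominus>\<^bsub>fst V\<^esub> \<theta> m)"
proof -
  interpret U: semilinear_module K Fq p r A FA "fst U" "snd U" by (rule F_objD(1)[OF assms(1)])
  interpret V: semilinear_module K Fq p r A FA "fst V" "snd V" by (rule F_objD(1)[OF assms(2)])
  note t = F_homD[OF assms(3)]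
  show ?thesis
    by (rule F_homI)
      (simp_all add: t(1-4) U.M.act_closed U.FM_closed V.M.M.minus_add V.M.M.a_comm
        V.M.act_minus_right V.FM_minus)
qed

lemma preadditive_modF:
  "preadditive_category (modF :: (('a, 'v) module \<times> ('v \<Rightarrow> 'v), _) cat) pl zr"
proof (intro preadditive_category.intro category_modF preadditive_category_axioms.intro)
  fix U V :: "('a, 'v) module \<times> ('v \<Rightarrow> 'v)"
  assume "U \<in> obj modF" "V \<in> obj modF"
  hence U: "F_obj U" and V: "F_obj V" by (auto simp: modF_simps)
  interpret V: semilinear_module K Fq p r A FA "fst V" "snd V" by (rule F_objD(1)[OF V])
  let ?H = "\<lparr>carrier = homset modF U V, monoid.mult = pl, one = zr U V\<rparr>"
  show "comm_group ?H"
  proof (rule comm_groupI)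
    show "x \<otimes>\<^bsub>?H\<^esub> y \<in> carrier ?H" if "x \<in> carrier ?H" "y \<in> carrier ?H" for x y
      using that F_hom_plus[OF U V] U V by (auto simp: homset_modF pl_simp)
    show "\<one>\<^bsub>?H\<^esub> \<in> carrier ?H"
      using F_hom_zero_map[OF U V] U V by (auto simp: homset_modF zr_def)
    show "x \<otimes>\<^bsub>?H\<^esub> y \<otimes>\<^bsub>?H\<^esub> z = x \<otimes>\<^bsub>?H\<^esub> (y \<otimes>\<^bsub>?H\<^esub> z)"
      if "x \<in> carrier ?H" "y \<in> carrier ?H" "z \<in> carrier ?H" for x y z
      using that F_homD(1)[of U V] by (auto simp: homset_modF pl_simp V.M.M.a_assoc fun_eq_iff)
    show "x \<otimes>\<^bsub>?H\<^esub> y = y \<otimes>\<^bsub>?H\<^esub> x"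
      if "x \<in> carrier ?H" "y \<in> carrier ?H" for x y
      using that F_homD(1)[of U V] by (auto simp: homset_modF pl_simp V.M.M.a_comm fun_eq_iff)
    show "\<one>\<^bsub>?H\<^esub> \<otimes>\<^bsub>?H\<^esub> x = x" if xc: "x \<in> carrier ?H" for x
    proof -
      obtain \<theta> where x: "x = (U, \<theta>, V)" "F_hom U V \<theta>" using xc by (auto simp: homset_modF)
      have "(\<lambda>m \<in> carrier (fst U). \<zero>\<^bsub>fst V\<^esub> \<oplus>\<^bsub>fst V\<^esub> \<theta> m) = \<theta>"
        by (rule extensionalityI[OF _ F_homD(5)[OF x(2)]]) (use F_homD(1)[OF x(2)] in auto)
      moreover have "(\<lambda>m \<in> carrier (fst U). (\<lambda>m \<in> carrier (fst U). \<zero>\<^bsub>fst V\<^esub>) m \<oplus>\<^bsub>fst V\<^esub> \<theta> m) =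
          (\<lambda>m \<in> carrier (fst U). \<zero>\<^bsub>fst V\<^esub> \<oplus>\<^bsub>fst V\<^esub> \<theta> m)"
        by (rule restrict_ext) simp
      ultimately show ?thesis by (simp add: x(1) zr_def pl_simp)
    qed
    show "\<exists>y\<in>carrier ?H. y \<otimes>\<^bsub>?H\<^esub> x = \<one>\<^bsub>?H\<^esub>" if xc: "x \<in> carrier ?H" for x
    proof -
      obtain \<theta> where x: "x = (U, \<theta>, V)" "F_hom U V \<theta>" using xc by (auto simp: homset_modF)
      show ?thesis
        using F_hom_neg_map[OF U V x(2)] U V F_homD(1)[OF x(2)]
        by (intro bexI[of _ "(U, \<lambda>m \<in> carrier (fst U). \<ominus>\<^bsub>fst V\<^esub> \<theta> m, V)"])
          (auto intro!: homset_modFI simp: x(1) pl_simp zr_def V.M.M.l_neg restrict_def)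
    qed
  qed
next
  fix f g h :: "(('a, 'v) module \<times> ('v \<Rightarrow> 'v)) \<times> ('v \<Rightarrow> 'v) \<times> (('a, 'v) module \<times> ('v \<Rightarrow> 'v))"
    and U V Z
  assume "f \<in> homset modF U V" "g \<in> homset modF V Z" "h \<in> homset modF V Z"
  thus "pl g h \<cdot>\<^bsub>modF\<^esub> f = pl (g \<cdot>\<^bsub>modF\<^esub> f) (h \<cdot>\<^bsub>modF\<^esub> f)"
    using F_homD(1)[of U V] by (auto simp: homset_modF modF_simps pl_simp compose_def fun_eq_iff)
next
  fix f g h :: "(('a, 'v) module \<times> ('v \<Rightarrow> 'v)) \<times> ('v \<Rightarrow> 'v) \<times> (('a, 'v) module \<times> ('v \<Rightarrow> 'v))"
    and U V Z
  assume "f \<in> homset modF U V" "g \<in> homset modF U V" "h \<in> homset modF V Z"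
  thus "h \<cdot>\<^bsub>modF\<^esub> pl f g = pl (h \<cdot>\<^bsub>modF\<^esub> f) (h \<cdot>\<^bsub>modF\<^esub> g)"
    using F_homD(1)[of U V] F_homD(2)[of V Z] by (auto simp: homset_modF modF_simps pl_simp compose_def fun_eq_iff)
qed

text \<open>A map that \<open>\<theta>\<close> kills lands in the image of \<open>\<kappa>\<close>
  and can be divided by \<open>\<kappa>\<close>; injectivity makes the quotient unique and
  compatible with all operations. The criterion is stated for any injection with the right image
  because it serves the inclusion of a kernel as well as an arbitrary monomorphism.\<close>

lemma is_kernelI:
  assumes U: "F_obj U" and V: "F_obj V" and W: "F_obj W"
    and \<theta>: "F_hom V W \<theta>" and \<kappa>: "F_hom U V \<kappa>"
    and inj: "inj_on \<kappa> (carrier (fst U))"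
    and ker: "\<kappa> ` carrier (fst U) = {x \<in> carrier (fst V). \<theta> x = \<zero>\<^bsub>fst W\<^esub>}"
  shows "is_kernel modF zr (V, \<theta>, W) (U, \<kappa>, V)"
proof -
  interpret U: semilinear_module K Fq p r A FA "fst U" "snd U" by (rule F_objD(1)[OF U])
  interpret V: semilinear_module K Fq p r A FA "fst V" "snd V" by (rule F_objD(1)[OF V])
  note kD = F_homD[OF \<kappa>]
  have zero: "(V, \<theta>, W) \<cdot>\<^bsub>modF\<^esub> (U, \<kappa>, V) = zr U W"
    using ker by (auto simp: modF_simps zr_def compose_def fun_eq_iff)
  have univ: "\<exists>!u. u \<in> homset modF T U \<and> (U, \<kappa>, V) \<cdot>\<^bsub>modF\<^esub> u = h"
    if h: "h \<in> homset modF T V" and h0: "(V, \<theta>, W) \<cdot>\<^bsub>modF\<^esub> h = zr T W" for T h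
  proof -
    obtain \<eta> where \<eta>: "F_obj T" "h = (T, \<eta>, V)" "F_hom T V \<eta>" using h by (auto simp: homset_modF)
    interpret T: semilinear_module K Fq p r A FA "fst T" "snd T" by (rule F_objD(1)[OF \<eta>(1)])
    note hD = F_homD[OF \<eta>(3)]
    have "\<theta> (\<eta> x) = \<zero>\<^bsub>fst W\<^esub>" if "x \<in> carrier (fst T)" for x
      using h0 that by (auto simp: \<eta>(2) modF_simps zr_def compose_def fun_eq_iff split: if_splits)
    hence im: "\<eta> x \<in> \<kappa> ` carrier (fst U)" if "x \<in> carrier (fst T)" for x
      using that ker hD(1) by auto
    define u where "u = (\<lambda>x \<in> carrier (fst T). inv_into (carrier (fst U)) \<kappa> (\<eta> x))"
    have u: "u x \<in> carrier (fst U)" "\<kappa> (u x) = \<eta> x" if "x \<in> carrier (fst T)" for x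
      using im[OF that] that by (auto simp: u_def inv_into_into f_inv_into_f)
    have eqI: "x = y" if "x \<in> carrier (fst U)" "y \<in> carrier (fst U)" "\<kappa> x = \<kappa> y" for x y
      using inj that by (auto dest: inj_onD)
    have "F_hom T U u"
    proof (rule F_homI)
      show "u x \<in> carrier (fst U)" if "x \<in> carrier (fst T)" for x using u that by simp
      show "u (x \<oplus>\<^bsub>fst T\<^esub> y) = u x \<oplus>\<^bsub>fst U\<^esub> u y" if "x \<in> carrier (fst T)" "y \<in> carrier (fst T)" for x y
        by (rule eqI) (use that u kD(2) hD(2) in auto)
      show "u (a \<odot>\<^bsub>fst T\<^esub> x) = a \<odot>\<^bsub>fst U\<^esub> u x" if "a \<in> carrier A" "x \<in> carrier (fst T)" for a x
        by (rule eqI) (use that u kD(3) hD(3) T.M.act_closed U.M.act_closed in auto)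
      show "u (snd T x) = snd U (u x)" if "x \<in> carrier (fst T)" for x
        by (rule eqI) (use that u kD(4) hD(4) T.FM_closed U.FM_closed in auto)
    qed (simp add: u_def)
    show ?thesis
    proof (rule ex1I[of _ "(T, u, U)"])
      show "(T, u, U) \<in> homset modF T U \<and> (U, \<kappa>, V) \<cdot>\<^bsub>modF\<^esub> (T, u, U) = h"
        using \<open>F_hom T U u\<close> \<eta>(1) U u hD(5)
        by (auto simp: homset_modF modF_simps \<eta>(2) compose_def fun_eq_iff extensional_def)
      fix w assume w: "w \<in> homset modF T U \<and> (U, \<kappa>, V) \<cdot>\<^bsub>modF\<^esub> w = h"
      then obtain \<omega> where \<omega>: "w = (T, \<omega>, U)" "F_hom T U \<omega>" by (auto simp: homset_modF)
      have "\<omega> x = u x" if x: "x \<in> carrier (fst T)" for x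
      proof (rule eqI[OF F_homD(1)[OF \<omega>(2) x] u(1)[OF x]])
        have "compose (carrier (fst T)) \<kappa> \<omega> = \<eta>" using w by (auto simp: \<omega>(1) modF_simps \<eta>(2))
        hence "\<kappa> (\<omega> x) = \<eta> x" using x by (metis compose_eq)
        thus "\<kappa> (\<omega> x) = \<kappa> (u x)" using u(2)[OF x] by simp
      qed
      hence "\<omega> = u"
        by (intro extensionalityI[OF F_homD(5)[OF \<omega>(2)]]) (simp_all add: u_def)
      thus "w = (T, u, U)" by (simp add: \<omega>(1))
    qed
  qed
  have "(V, \<theta>, W) \<in> arr modF" "(U, \<kappa>, V) \<in> homset modF U V"
    using U V W \<theta> \<kappa> by (auto simp: arr_modF homset_modF)
  thus ?thesis unfolding is_kernel_def modF_simps(2,3) by (intro conjI allI ballI impI zero univ)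
qed

text \<open>If \<open>\<gamma> x = \<gamma> y\<close>, then \<open>x - y\<close> lies in the image
  of \<open>\<theta>\<close> and is killed by any \<open>\<eta>\<close> that vanishes there. So
  composing \<open>\<eta>\<close> with an arbitrary section of \<open>\<gamma>\<close> is well
  defined. As for kernels, the form covers constructed cokernels and arbitrary epimorphisms
  alike.\<close>

lemma is_cokernelI:
  assumes U: "F_obj U" and V: "F_obj V" and W: "F_obj W"
    and \<theta>: "F_hom U V \<theta>" and \<gamma>: "F_hom V W \<gamma>"
    and surj: "\<gamma> ` carrier (fst V) = carrier (fst W)"
    and ker: "\<And>x. x \<in> carrier (fst V) \<Longrightarrow> \<gamma> x = \<zero>\<^bsub>fst W\<^esub> \<longleftrightarrow> x \<in> \<theta> ` carrier (fst U)"
  shows "is_cokernel modF zr (U, \<theta>, V) (V, \<gamma>, W)"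
proof -
  interpret V: semilinear_module K Fq p r A FA "fst V" "snd V" by (rule F_objD(1)[OF V])
  interpret W: semilinear_module K Fq p r A FA "fst W" "snd W" by (rule F_objD(1)[OF W])
  note gD = F_homD[OF \<gamma>] and tD = F_homD[OF \<theta>]
  have zero: "(V, \<gamma>, W) \<cdot>\<^bsub>modF\<^esub> (U, \<theta>, V) = zr U W"
    using ker tD(1) by (auto simp: modF_simps zr_def compose_def fun_eq_iff)
  have univ: "\<exists>!u. u \<in> homset modF W T \<and> u \<cdot>\<^bsub>modF\<^esub> (V, \<gamma>, W) = h"
    if h: "h \<in> homset modF V T" and h0: "h \<cdot>\<^bsub>modF\<^esub> (U, \<theta>, V) = zr U T" for T h
  proof -
    obtain \<eta> where \<eta>: "F_obj T" "h = (V, \<eta>, T)" "F_hom V T \<eta>" using h by (auto simp: homset_modF)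
    interpret T: semilinear_module K Fq p r A FA "fst T" "snd T" by (rule F_objD(1)[OF \<eta>(1)])
    note hD = F_homD[OF \<eta>(3)]
    have h\<theta>: "\<eta> (\<theta> x) = \<zero>\<^bsub>fst T\<^esub>" if "x \<in> carrier (fst U)" for x
      using h0 that by (auto simp: \<eta>(2) modF_simps zr_def compose_def fun_eq_iff split: if_splits)
    have wd: "\<eta> x = \<eta> y" if "x \<in> carrier (fst V)" "y \<in> carrier (fst V)" "\<gamma> x = \<gamma> y" for x y
    proof -
      let ?d = "x \<oplus>\<^bsub>fst V\<^esub> \<ominus>\<^bsub>fst V\<^esub> y"
      have "\<gamma> ?d = \<zero>\<^bsub>fst W\<^esub>"
        using that gD(1,2) F_hom_minus[OF V W \<gamma>] by (simp add: W.M.M.r_neg)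
      hence "?d \<in> \<theta> ` carrier (fst U)" using ker[of ?d] that by simp
      hence "\<eta> ?d = \<zero>\<^bsub>fst T\<^esub>" using h\<theta> by auto
      hence "\<eta> x \<oplus>\<^bsub>fst T\<^esub> \<ominus>\<^bsub>fst T\<^esub> \<eta> y = \<zero>\<^bsub>fst T\<^esub>"
        using that hD(2) F_hom_minus[OF V \<eta>(1) \<eta>(3)] by simp
      thus ?thesis
        using that hD(1) T.M.M.minus_equality[of "\<eta> x" "\<ominus>\<^bsub>fst T\<^esub> \<eta> y"] by (simp add: T.M.M.minus_minus)
    qed
    define u where "u = (\<lambda>y \<in> carrier (fst W). \<eta> (inv_into (carrier (fst V)) \<gamma> y))"
    have u: "u (\<gamma> x) = \<eta> x" if "x \<in> carrier (fst V)" for x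
      unfolding u_def using that gD(1) by (simp, intro wd) (auto intro: inv_into_into f_inv_into_f)
    have W_cases: "\<exists>x. x \<in> carrier (fst V) \<and> y = \<gamma> x" if "y \<in> carrier (fst W)" for y
      using that surj by blast
    have "F_hom W T u"
    proof (rule F_homI)
      fix y assume "y \<in> carrier (fst W)"
      then obtain x where x: "x \<in> carrier (fst V)" "y = \<gamma> x" using W_cases by blast
      show "u y \<in> carrier (fst T)" using u x hD(1) by simp
      show "u (snd W y) = snd T (u y)"
        using x u[of x] u[OF V.FM_closed[OF x(1)]] gD(4) hD(4) by simp
      show "u (a \<odot>\<^bsub>fst W\<^esub> y) = a \<odot>\<^bsub>fst T\<^esub> u y" if "a \<in> carrier A" for a
        using that x u[of x] u[OF V.M.act_closed[OF that x(1)]] gD(3) hD(3) by simp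
      fix y' assume "y' \<in> carrier (fst W)"
      then obtain x' where x': "x' \<in> carrier (fst V)" "y' = \<gamma> x'" using W_cases by blast
      show "u (y \<oplus>\<^bsub>fst W\<^esub> y') = u y \<oplus>\<^bsub>fst T\<^esub> u y'"
        using x x' u[of x] u[of x'] u[of "x \<oplus>\<^bsub>fst V\<^esub> x'"] gD(2) hD(2) by simp
    qed (simp add: u_def)
    show ?thesis
    proof (rule ex1I[of _ "(W, u, T)"])
      show "(W, u, T) \<in> homset modF W T \<and> (W, u, T) \<cdot>\<^bsub>modF\<^esub> (V, \<gamma>, W) = h"
        using \<open>F_hom W T u\<close> \<eta>(1) W u hD(5)
        by (auto simp: homset_modF modF_simps \<eta>(2) compose_def fun_eq_iff extensional_def)
      fix w assume w: "w \<in> homset modF W T \<and> w \<cdot>\<^bsub>modF\<^esub> (V, \<gamma>, W) = h"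
      then obtain \<omega> where \<omega>: "w = (W, \<omega>, T)" "F_hom W T \<omega>" by (auto simp: homset_modF)
      have "\<omega> y = u y" if y: "y \<in> carrier (fst W)" for y
      proof -
        obtain x where x: "x \<in> carrier (fst V)" "y = \<gamma> x" using W_cases[OF y] by blast
        have "compose (carrier (fst V)) \<omega> \<gamma> = \<eta>" using w by (auto simp: \<omega>(1) modF_simps \<eta>(2))
        hence "\<omega> (\<gamma> x) = \<eta> x" using x by (metis compose_eq)
        thus ?thesis using u[OF x(1)] x(2) by simp
      qed
      hence "\<omega> = u"
        by (intro extensionalityI[OF F_homD(5)[OF \<omega>(2)]]) (simp_all add: u_def)
      thus "w = (W, u, T)" by (simp add: \<omega>(1))
    qed
  qed
  have "(U, \<theta>, V) \<in> arr modF" "(V, \<gamma>, W) \<in> homset modF V W"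
    using U V W \<theta> \<gamma> by (auto simp: arr_modF homset_modF)
  thus ?thesis unfolding is_cokernel_def modF_simps(2,3) by (intro conjI allI ballI impI zero univ)
qed

lemma kernel_object:
  assumes V: "F_obj V" and W: "F_obj W" and \<theta>: "F_hom V W \<theta>"
  defines "S \<equiv> {x \<in> carrier (fst V). \<theta> x = \<zero>\<^bsub>fst W\<^esub>}"
  defines "U \<equiv> ((fst V)\<lparr>carrier := S\<rparr>, snd V)"
  shows "F_obj U" and "F_hom U V (\<lambda>x \<in> S. x)"
proof -
  interpret V: semilinear_module K Fq p r A FA "fst V" "snd V" by (rule F_objD(1)[OF V])
  interpret W: semilinear_module K Fq p r A FA "fst W" "snd W" by (rule F_objD(1)[OF W])
  note tD = F_homD[OF \<theta>]
  have S: "S \<subseteq> carrier (fst V)" "\<zero>\<^bsub>fst V\<^esub> \<in> S"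
    "\<And>x y. x \<in> S \<Longrightarrow> y \<in> S \<Longrightarrow> x \<oplus>\<^bsub>fst V\<^esub> y \<in> S"
    "\<And>a x. a \<in> carrier A \<Longrightarrow> x \<in> S \<Longrightarrow> a \<odot>\<^bsub>fst V\<^esub> x \<in> S"
    "\<And>x. x \<in> S \<Longrightarrow> snd V x \<in> S"
    unfolding S_def using F_hom_zero[OF V W \<theta>] tD
    by (auto simp: V.M.act_closed W.M.act_zero_right V.FM_closed W.FM_zero)
  \<comment> \<open>Finite dimension of the kernel is read off its fixed points, which lie among
    those of \<open>V\<close>.\<close>
  have "{m \<in> S. snd V m = m} \<subseteq> {m \<in> carrier (fst V). snd V m = m}" using S(1) by auto
  hence "finite {m \<in> S. snd V m = m}" using F_objD(2)[OF V] by (rule finite_subset)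
  thus "F_obj U" unfolding U_def F_module_iff using V.restrict_semilinear[OF S] by simp
  show "F_hom U V (\<lambda>x \<in> S. x)"
    by (rule F_homI) (use S in \<open>auto simp: U_def\<close>)
qed

lemma cokernel_object:
  fixes U V :: "('a, 'v) module \<times> ('v \<Rightarrow> 'v)"
  assumes U: "F_obj U" and V: "F_obj V" and \<theta>: "F_hom U V \<theta>"
  obtains W \<gamma> where "F_obj W" "F_hom V W \<gamma>" "\<gamma> ` carrier (fst V) = carrier (fst W)"
    "\<And>x. x \<in> carrier (fst V) \<Longrightarrow> \<gamma> x = \<zero>\<^bsub>fst W\<^esub> \<longleftrightarrow> x \<in> \<theta> ` carrier (fst U)"
proof -
  interpret U: semilinear_module K Fq p r A FA "fst U" "snd U" by (rule F_objD(1)[OF U])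
  interpret V: semilinear_module K Fq p r A FA "fst V" "snd V" by (rule F_objD(1)[OF V])
  note tD = F_homD[OF \<theta>]
  let ?S = "\<theta> ` carrier (fst U)"
  have "\<exists>N G \<pi>. F_module K Fq A FA (N :: ('a, 'v) module, G) \<and>
    \<pi> \<in> module_hom A (fst V) N \<and> (\<forall>x\<in>carrier (fst V). \<pi> (snd V x) = G (\<pi> x)) \<and>
    \<pi> ` carrier (fst V) = carrier N \<and> (\<forall>x\<in>carrier (fst V). \<pi> x = \<zero>\<^bsub>N\<^esub> \<longleftrightarrow> x \<in> ?S)"
  proof (rule V.quotient_semilinear)
    show "?S \<subseteq> carrier (fst V)" using tD(1) by auto
    show "\<zero>\<^bsub>fst V\<^esub> \<in> ?S" using F_hom_zero[OF U V \<theta>] by (auto intro: image_eqI[of _ _ "\<zero>\<^bsub>fst U\<^esub>"])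
    show "x \<oplus>\<^bsub>fst V\<^esub> y \<in> ?S" if "x \<in> ?S" "y \<in> ?S" for x y
      using that tD(2)[symmetric] by auto
    show "a \<odot>\<^bsub>fst V\<^esub> x \<in> ?S" if "a \<in> carrier A" "x \<in> ?S" for a x
      using that tD(3)[symmetric] U.M.act_closed by auto
    show "snd V x \<in> ?S" if "x \<in> ?S" for x
      using that tD(4)[symmetric] U.FM_closed by auto
    show "finite {m \<in> carrier (fst V). snd V m = m}" by (rule F_objD(2)[OF V])
  qed
  then obtain N :: "('a, 'v) module" and G \<pi> where N: "F_obj (N, G)" "\<pi> \<in> module_hom A (fst V) N"
    "\<forall>x\<in>carrier (fst V). \<pi> (snd V x) = G (\<pi> x)" "\<pi> ` carrier (fst V) = carrier N"
    "\<forall>x\<in>carrier (fst V). \<pi> x = \<zero>\<^bsub>N\<^esub> \<longleftrightarrow> x \<in> ?S" by blast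
  have "F_hom V (N, G) (restrict \<pi> (carrier (fst V)))"
    using N(2,3) by (intro F_homI) (auto simp: module_hom_def V.M.act_closed V.FM_closed)
  thus thesis
    by (rule that[rotated]) (use N in auto)
qed

section \<open>Zero object, biproducts and the abelian axioms\<close>

lemma zero_object_modF:
  "\<exists>Z. zero_object (modF :: (('a, 'v) module \<times> ('v \<Rightarrow> 'v), _) cat) Z"
proof -
  \<comment> \<open>The zero module needs one element of the type, and any element will do.\<close>
  define z :: 'v where "z = undefined"
  define M :: "('a, 'v) module" where "M = \<lparr>carrier = {z}, monoid.mult = \<lambda>_ _. z, one = z,
     zero = z, add = \<lambda>_ _. z, smult = \<lambda>_ _. z\<rparr>"
  define Z where "Z = (M, \<lambda>x::'v. x)"
  interpret M: abelian_group M by (rule abelian_groupI) (auto simp: M_def)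
  interpret M: left_module A M by unfold_locales (auto simp: M_def)
  have per: "\<exists>n>0. ((\<lambda>x::'v. x) ^^ n) x = x" for x by (rule exI[of _ 1]) simp
  have "semilinear_module K Fq p r A FA M (\<lambda>x. x)"
    by unfold_locales (use per in \<open>auto simp: M_def\<close>)
  hence Z: "F_obj Z" unfolding Z_def F_module_iff by (simp add: M_def)
  have cZ: "carrier (fst Z) = {z}" and zZ: "\<zero>\<^bsub>fst Z\<^esub> = z" by (simp_all add: Z_def M_def)
  have "(\<exists>!f. f \<in> homset modF U Z) \<and> (\<exists>!f. f \<in> homset modF Z U)" if U: "F_obj U" for U
  proof
    have "f = zr U Z" if "f \<in> homset modF U Z" for f
      using that F_homD(1,5)[of U Z] cZ zZ by (auto simp: homset_modF zr_def fun_eq_iff extensional_def)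
    moreover have "zr U Z \<in> homset modF U Z"
      using F_hom_zero_map[OF U Z] U Z by (auto simp: homset_modF zr_def)
    ultimately show "\<exists>!f. f \<in> homset modF U Z" by blast
    have "f = zr Z U" if "f \<in> homset modF Z U" for f
      using that F_homD(5)[of Z U] F_hom_zero[OF Z U] cZ zZ by (auto simp: homset_modF zr_def fun_eq_iff extensional_def)
    moreover have "zr Z U \<in> homset modF Z U"
      using F_hom_zero_map[OF Z U] U Z by (auto simp: homset_modF zr_def)
    ultimately show "\<exists>!f. f \<in> homset modF Z U" by blast
  qed
  thus ?thesis using Z unfolding zero_object_def modF_simps by blast
qed

text \<open>The product is formed on pairs and then carried back into \<open>'v\<close>, so that it
  is an object of the same category; this is where the type has to be infinite.\<close>

lemma biproduct_modF:
  fixes U V :: "('a, 'v) module \<times> ('v \<Rightarrow> 'v)"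
  assumes inf: "infinite (UNIV :: 'v set)" and U: "F_obj U" and V: "F_obj V"
  shows "\<exists>P i\<^sub>1 i\<^sub>2 p\<^sub>1 p\<^sub>2. biproduct modF pl U V P i\<^sub>1 i\<^sub>2 p\<^sub>1 p\<^sub>2"
proof -
  interpret U: semilinear_module K Fq p r A FA "fst U" "snd U" by (rule F_objD(1)[OF U])
  interpret V: semilinear_module K Fq p r A FA "fst V" "snd V" by (rule F_objD(1)[OF V])
  \<comment> \<open>An infinite set is equipotent with its square.\<close>
  obtain j :: "'v \<times> 'v \<Rightarrow> 'v" where j: "inj j"
    using card_of_Times_same_infinite[OF inf, unfolded card_of_ordIso[symmetric]]
    by (auto simp: bij_betw_def)
  let ?M = "prod_module (fst U) (fst V)" and ?F = "map_prod (snd U) (snd V)"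
  interpret P: semilinear_module K Fq p r A FA ?M ?F
    by (rule prod_semilinear[OF U.semilinear_module_axioms V.semilinear_module_axioms])
  have cong: "module_congruence A ?M j"
    by (rule module_congruence_inj[OF P.M.left_module_axioms inj_on_subset[OF j]]) simp
  interpret I: module_congruence A ?M j by (rule cong)
  have F_cong: "j (?F x) = j (?F x')" if "j x = j x'" for x x' using that j by (auto dest: injD)
  let ?N = "image_module j ?M" and ?G = "image_map j ?M ?F"
  have sm: "semilinear_module K Fq p r A FA ?N ?G"
    using cong by (rule P.image_semilinear(1)) (rule F_cong)
  have G: "?G (j x) = j (?F x)" if "x \<in> carrier ?M" for x
    using cong _ that by (rule P.image_semilinear(2)) (rule F_cong)
  have fx: "{y \<in> carrier ?N. ?G y = y} = j ` {x \<in> carrier ?M. ?F x = x}"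
    using cong by (rule P.image_semilinear(3)) (rule F_cong)
  have "{x \<in> carrier ?M. ?F x = x} \<subseteq>
    {x \<in> carrier (fst U). snd U x = x} \<times> {x \<in> carrier (fst V). snd V x = x}"
    by (auto simp: prod_module_def)
  hence "finite {x \<in> carrier ?M. ?F x = x}"
    by (rule finite_subset) (intro finite_cartesian_product F_objD(2) U V)
  hence N: "F_obj (?N, ?G)" unfolding F_module_iff using sm fx by simp
  have cM: "carrier ?M = carrier (fst U) \<times> carrier (fst V)" by (simp add: prod_module_def)
  have cN: "carrier ?N = j ` (carrier (fst U) \<times> carrier (fst V))" by (simp add: I.image_carrier cM)
  have jinv: "inv_into UNIV j (j x) = x" for x by (rule inv_f_f[OF j])
  have add: "j (x, y) \<oplus>\<^bsub>?N\<^esub> j (x', y') = j (x \<oplus>\<^bsub>fst U\<^esub> x', y \<oplus>\<^bsub>fst V\<^esub> y')"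
    if "x \<in> carrier (fst U)" "y \<in> carrier (fst V)" "x' \<in> carrier (fst U)" "y' \<in> carrier (fst V)" for x y x' y'
    using I.image_add[of "(x, y)" "(x', y')"] that by (simp add: prod_module_def)
  have act: "a \<odot>\<^bsub>?N\<^esub> j (x, y) = j (a \<odot>\<^bsub>fst U\<^esub> x, a \<odot>\<^bsub>fst V\<^esub> y)"
    if "a \<in> carrier A" "x \<in> carrier (fst U)" "y \<in> carrier (fst V)" for a x y
    using I.image_smult[of a "(x, y)"] that by (simp add: prod_module_def)
  have G': "?G (j (x, y)) = j (snd U x, snd V y)" if "x \<in> carrier (fst U)" "y \<in> carrier (fst V)" for x y
    using G[of "(x, y)"] that by (simp add: cM)
  let ?i1 = "\<lambda>x \<in> carrier (fst U). j (x, \<zero>\<^bsub>fst V\<^esub>)"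
  let ?i2 = "\<lambda>y \<in> carrier (fst V). j (\<zero>\<^bsub>fst U\<^esub>, y)"
  let ?p1 = "\<lambda>z \<in> carrier ?N. fst (inv_into UNIV j z)" and ?p2 = "\<lambda>z \<in> carrier ?N. snd (inv_into UNIV j z)"
  have i1: "F_hom U (?N, ?G) ?i1"
    by (rule F_homI) (auto simp: cN add act G' U.M.act_closed U.FM_closed V.M.act_zero_right V.FM_zero)
  have i2: "F_hom V (?N, ?G) ?i2"
    by (rule F_homI) (auto simp: cN add act G' V.M.act_closed V.FM_closed U.M.act_zero_right U.FM_zero)
  have p1: "F_hom (?N, ?G) U ?p1"
    by (rule F_homI) (auto simp: cN add act G' jinv inj_eq[OF j] U.M.act_closed U.FM_closed V.M.act_closed V.FM_closed)
  have p2: "F_hom (?N, ?G) V ?p2"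
    by (rule F_homI) (auto simp: cN add act G' jinv inj_eq[OF j] U.M.act_closed U.FM_closed V.M.act_closed V.FM_closed)
  have "biproduct modF pl U V (?N, ?G) (U, ?i1, (?N, ?G)) (V, ?i2, (?N, ?G)) ((?N, ?G), ?p1, U) ((?N, ?G), ?p2, V)"
    unfolding biproduct_def
    by (intro conjI homset_modFI N U V i1 i2 p1 p2)
      (auto simp: N modF_simps pl_simp compose_def fun_eq_iff cN jinv add)
  thus ?thesis by blast
qed

text \<open>A monomorphism is injective because it cannot distinguish the inclusion of its kernel
  from the zero arrow. An epimorphism is surjective because its cokernel projection and the zero
  arrow agree after it. Then a monomorphism is the kernel of its cokernel, and an epimorphism the
  cokernel of its kernel.\<close>

lemma abelian_modF:
  assumes inf: "infinite (UNIV :: 'v set)"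
  shows "abelian_category (modF :: (('a, 'v) module \<times> ('v \<Rightarrow> 'v), _) cat)"
proof -
  let ?C = "modF :: (('a, 'v) module \<times> ('v \<Rightarrow> 'v), _) cat"
  have kernel: "is_kernel ?C zr (V, \<theta>, W) (((fst V)\<lparr>carrier := {x \<in> carrier (fst V). \<theta> x = \<zero>\<^bsub>fst W\<^esub>}\<rparr>, snd V),
      (\<lambda>x \<in> {x \<in> carrier (fst V). \<theta> x = \<zero>\<^bsub>fst W\<^esub>}. x), V)"
    if V: "F_obj V" and W: "F_obj W" and \<theta>: "F_hom V W \<theta>" for V W \<theta>
    by (rule is_kernelI[OF kernel_object(1)[OF V W \<theta>] V W \<theta> kernel_object(2)[OF V W \<theta>]])
      (auto simp: inj_on_def)
  have mono: "inj_on \<theta> (carrier (fst V))"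
    if V: "F_obj V" and W: "F_obj W" and \<theta>: "F_hom V W \<theta>" and m: "mono_arr ?C (V, \<theta>, W)" for V W \<theta>
  proof (rule F_hom_inj[OF V W \<theta>])
    let ?S = "{x \<in> carrier (fst V). \<theta> x = \<zero>\<^bsub>fst W\<^esub>}"
    let ?U = "((fst V)\<lparr>carrier := ?S\<rparr>, snd V)"
    note U = kernel_object[OF V W \<theta>]
    have i: "(?U, (\<lambda>x \<in> ?S. x), V) \<in> homset ?C ?U V" using U V by (auto simp: homset_modF)
    have z: "zr ?U V \<in> homset ?C ?U V"
      using F_hom_zero_map[OF U(1) V] U(1) V by (auto simp: homset_modF zr_def)
    have "(V, \<theta>, W) \<cdot>\<^bsub>?C\<^esub> (?U, (\<lambda>x \<in> ?S. x), V) = (V, \<theta>, W) \<cdot>\<^bsub>?C\<^esub> zr ?U V"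
      using F_hom_zero[OF V W \<theta>] by (auto simp: modF_simps zr_def compose_def fun_eq_iff)
    hence "(?U, (\<lambda>x \<in> ?S. x), V) = zr ?U V"
      by (rule m[unfolded mono_arr_def modF_simps(2,3), THEN conjunct2, rule_format, OF i z])
    thus "x = \<zero>\<^bsub>fst V\<^esub>" if "x \<in> carrier (fst V)" "\<theta> x = \<zero>\<^bsub>fst W\<^esub>" for x
      using that by (auto simp: zr_def fun_eq_iff split: if_splits)
  qed
  have epi: "\<theta> ` carrier (fst V) = carrier (fst W)"
    if V: "F_obj V" and W: "F_obj W" and \<theta>: "F_hom V W \<theta>" and e: "epi_arr ?C (V, \<theta>, W)" for V W \<theta>
  proof
    show "\<theta> ` carrier (fst V) \<subseteq> carrier (fst W)" using F_homD(1)[OF \<theta>] by auto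
    obtain T \<gamma> where T: "F_obj T" "F_hom W T \<gamma>" "\<gamma> ` carrier (fst W) = carrier (fst T)"
      "\<And>x. x \<in> carrier (fst W) \<Longrightarrow> \<gamma> x = \<zero>\<^bsub>fst T\<^esub> \<longleftrightarrow> x \<in> \<theta> ` carrier (fst V)"
      by (rule cokernel_object[OF V W \<theta>]) (rule that, simp_all)
    have g: "(W, \<gamma>, T) \<in> homset ?C W T" using T W by (auto simp: homset_modF)
    have z: "zr W T \<in> homset ?C W T"
      using F_hom_zero_map[OF W T(1)] T(1) W by (auto simp: homset_modF zr_def)
    have "(W, \<gamma>, T) \<cdot>\<^bsub>?C\<^esub> (V, \<theta>, W) = zr W T \<cdot>\<^bsub>?C\<^esub> (V, \<theta>, W)"
      using T(4) F_homD(1)[OF \<theta>] by (auto simp: modF_simps zr_def compose_def fun_eq_iff)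
    hence "(W, \<gamma>, T) = zr W T"
      by (rule e[unfolded epi_arr_def modF_simps(2,3), THEN conjunct2, rule_format, OF g z])
    thus "carrier (fst W) \<subseteq> \<theta> ` carrier (fst V)"
      using T(4) by (auto simp: zr_def fun_eq_iff)
  qed
  show ?thesis
    unfolding abelian_category_def
  proof (intro exI[of _ pl] exI[of _ zr] conjI ballI allI impI)
    show "preadditive_category ?C pl zr" by (rule preadditive_modF)
    show "\<exists>Z. zero_object ?C Z" by (rule zero_object_modF)
    show "\<exists>P i\<^sub>1 i\<^sub>2 p\<^sub>1 p\<^sub>2. biproduct ?C pl U V P i\<^sub>1 i\<^sub>2 p\<^sub>1 p\<^sub>2" if "U \<in> obj ?C" "V \<in> obj ?C" for U V
      using that biproduct_modF[OF inf] by (simp add: modF_simps)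
    show "\<exists>\<kappa>. is_kernel ?C zr f \<kappa>" if "f \<in> arr ?C" for f
      using that kernel unfolding arr_modF by blast
    show "\<exists>\<gamma>. is_cokernel ?C zr f \<gamma>" if fa: "f \<in> arr ?C" for f
    proof -
      obtain U \<theta> V where f: "f = (U, \<theta>, V)" "F_obj U" "F_obj V" "F_hom U V \<theta>"
        using fa unfolding arr_modF by blast
      obtain W \<gamma> where W: "F_obj W" "F_hom V W \<gamma>" "\<gamma> ` carrier (fst V) = carrier (fst W)"
        "\<And>x. x \<in> carrier (fst V) \<Longrightarrow> \<gamma> x = \<zero>\<^bsub>fst W\<^esub> \<longleftrightarrow> x \<in> \<theta> ` carrier (fst U)"
        by (rule cokernel_object[OF f(2-4)]) (rule that, simp_all)
      show ?thesis unfolding f(1) by (rule exI, rule is_cokernelI[OF f(2,3) W(1) f(4) W(2-4)])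
    qed
    show "\<exists>f. is_kernel ?C zr f m" if m: "mono_arr ?C m" for m
    proof -
      obtain U \<theta> V where f: "m = (U, \<theta>, V)" "F_obj U" "F_obj V" "F_hom U V \<theta>"
        using m unfolding mono_arr_def arr_modF by blast
      obtain W \<gamma> where W: "F_obj W" "F_hom V W \<gamma>" "\<gamma> ` carrier (fst V) = carrier (fst W)"
        "\<And>x. x \<in> carrier (fst V) \<Longrightarrow> \<gamma> x = \<zero>\<^bsub>fst W\<^esub> \<longleftrightarrow> x \<in> \<theta> ` carrier (fst U)"
        by (rule cokernel_object[OF f(2-4)]) (rule that, simp_all)
      have "is_kernel ?C zr (V, \<gamma>, W) (U, \<theta>, V)"
        by (rule is_kernelI[OF f(2,3) W(1,2) f(4) mono[OF f(2-4) m[unfolded f(1)]]])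
          (use W(4) F_homD(1)[OF f(4)] in auto)
      thus ?thesis using f(1) by blast
    qed
    show "\<exists>f. is_cokernel ?C zr f e" if e: "epi_arr ?C e" for e
    proof -
      obtain V \<theta> W where f: "e = (V, \<theta>, W)" "F_obj V" "F_obj W" "F_hom V W \<theta>"
        using e unfolding epi_arr_def arr_modF by blast
      note U = kernel_object[OF f(2-4)]
      have "is_cokernel ?C zr (((fst V)\<lparr>carrier := {x \<in> carrier (fst V). \<theta> x = \<zero>\<^bsub>fst W\<^esub>}\<rparr>, snd V),
        (\<lambda>x \<in> {x \<in> carrier (fst V). \<theta> x = \<zero>\<^bsub>fst W\<^esub>}. x), V) (V, \<theta>, W)"
        by (rule is_cokernelI[OF U(1) f(2,3) U(2) f(4) epi[OF f(2-4) e[unfolded f(1)]]]) auto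
      thus ?thesis using f(1) by blast
    qed
  qed
qed

end

section \<open>The fixed-point functor\<close>

definition mod_hom_on where
  "mod_hom_on R P Q \<phi> \<longleftrightarrow> \<phi> \<in> module_hom R P Q \<and> \<phi> \<in> extensional (carrier P)"

lemma mod_cat_simps:
  "obj (mod_cat k R) = {M. fd_left_module k R M}"
  "src (mod_cat k R) (P, \<theta>, Q) = P" "tgt (mod_cat k R) (P, \<theta>, Q) = Q"
  "ident (mod_cat k R) P = (P, \<lambda>m \<in> carrier P. m, P)"
  "(P', \<psi>, Q') \<cdot>\<^bsub>mod_cat k R\<^esub> (P, \<theta>, Q) = (P, compose (carrier P) \<psi> \<theta>, Q')"
  by (simp_all add: mod_cat_def)

lemma homset_mod_cat:
  "x \<in> homset (mod_cat k R) P Q \<longleftrightarrow> fd_left_module k R P \<and> fd_left_module k R Q \<and>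
    (\<exists>\<theta>. x = (P, \<theta>, Q) \<and> mod_hom_on R P Q \<theta>)"
  unfolding homset_def mod_cat_def mod_hom_on_def by auto

lemma category_mod_cat:
  fixes k :: "('k, 'b) ring_scheme" and R :: "('k, 'a, 'c) module_scheme"
  shows "category (mod_cat k R :: (('a, 'w) module, _) cat)"
proof
  fix f :: "('a, 'w) module \<times> ('w \<Rightarrow> 'w) \<times> ('a, 'w) module"
  assume "f \<in> arr (mod_cat k R)"
  thus "src (mod_cat k R) f \<in> obj (mod_cat k R)" "tgt (mod_cat k R) f \<in> obj (mod_cat k R)"
    by (auto simp: mod_cat_def)
next
  fix P :: "('a, 'w) module"
  assume P: "P \<in> obj (mod_cat k R)"
  hence "left_module R P" by (simp add: mod_cat_simps fd_left_module_def)
  then interpret P: left_module R P .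
  have "mod_hom_on R P P (\<lambda>m \<in> carrier P. m)"
    by (auto simp: mod_hom_on_def module_hom_def P.act_closed)
  thus "ident (mod_cat k R) P \<in> homset (mod_cat k R) P P"
    using P by (simp add: mod_cat_simps homset_mod_cat)
next
  fix f g :: "('a, 'w) module \<times> ('w \<Rightarrow> 'w) \<times> ('a, 'w) module" and P Q S
  assume f: "f \<in> homset (mod_cat k R) P Q" and g: "g \<in> homset (mod_cat k R) Q S"
  obtain \<theta> where \<theta>: "f = (P, \<theta>, Q)" "mod_hom_on R P Q \<theta>" "fd_left_module k R P" using f by (auto simp: homset_mod_cat)
  obtain \<psi> where \<psi>: "g = (Q, \<psi>, S)" "mod_hom_on R Q S \<psi>" "fd_left_module k R S" using g by (auto simp: homset_mod_cat)
  interpret P: left_module R P using \<theta>(3) by (simp add: fd_left_module_def)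
  have "mod_hom_on R P S (compose (carrier P) \<psi> \<theta>)"
    using \<theta>(2) \<psi>(2) by (auto simp: mod_hom_on_def module_hom_def compose_eq P.act_closed Pi_iff)
  thus "g \<cdot>\<^bsub>mod_cat k R\<^esub> f \<in> homset (mod_cat k R) P S"
    using \<theta> \<psi> by (simp add: mod_cat_simps homset_mod_cat)
next
  fix f :: "('a, 'w) module \<times> ('w \<Rightarrow> 'w) \<times> ('a, 'w) module" and P Q
  assume "f \<in> homset (mod_cat k R) P Q"
  then obtain \<theta> where \<theta>: "f = (P, \<theta>, Q)" "mod_hom_on R P Q \<theta>" by (auto simp: homset_mod_cat)
  show "f \<cdot>\<^bsub>mod_cat k R\<^esub> ident (mod_cat k R) P = f" "ident (mod_cat k R) Q \<cdot>\<^bsub>mod_cat k R\<^esub> f = f"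
    using \<theta>(2) by (auto simp: \<theta>(1) mod_cat_simps mod_hom_on_def module_hom_def compose_def
      extensional_def restrict_def fun_eq_iff)
next
  fix f g h :: "('a, 'w) module \<times> ('w \<Rightarrow> 'w) \<times> ('a, 'w) module" and W P Q S
  assume "f \<in> homset (mod_cat k R) W P" "g \<in> homset (mod_cat k R) P Q" "h \<in> homset (mod_cat k R) Q S"
  thus "h \<cdot>\<^bsub>mod_cat k R\<^esub> (g \<cdot>\<^bsub>mod_cat k R\<^esub> f) = (h \<cdot>\<^bsub>mod_cat k R\<^esub> g) \<cdot>\<^bsub>mod_cat k R\<^esub> f"
    by (auto simp: homset_mod_cat mod_hom_on_def module_hom_def mod_cat_simps compose_def restrict_def fun_eq_iff)
qed

context semilinear_module
begin

text \<open>Both identities express that \<open>c . 1\<close> is central in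
  \<open>A\<close>.\<close>

lemma scalar_act:
  assumes "c \<in> carrier K" "a \<in> carrier A" "x \<in> carrier M"
  shows "(c \<odot>\<^bsub>A\<^esub> a) \<odot>\<^bsub>M\<^esub> x = (c \<odot>\<^bsub>A\<^esub> \<one>\<^bsub>A\<^esub>) \<odot>\<^bsub>M\<^esub> (a \<odot>\<^bsub>M\<^esub> x)"
    and "a \<odot>\<^bsub>M\<^esub> ((c \<odot>\<^bsub>A\<^esub> \<one>\<^bsub>A\<^esub>) \<odot>\<^bsub>M\<^esub> x) = (c \<odot>\<^bsub>A\<^esub> \<one>\<^bsub>A\<^esub>) \<odot>\<^bsub>M\<^esub> (a \<odot>\<^bsub>M\<^esub> x)"
proof -
  have "c \<odot>\<^bsub>A\<^esub> \<one>\<^bsub>A\<^esub> \<otimes>\<^bsub>A\<^esub> a = c \<odot>\<^bsub>A\<^esub> a" "a \<otimes>\<^bsub>A\<^esub> (c \<odot>\<^bsub>A\<^esub> \<one>\<^bsub>A\<^esub>) = c \<odot>\<^bsub>A\<^esub> a"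
    using assms by (simp_all add: AA.smult_mult_left AA.smult_mult_right)
  thus "(c \<odot>\<^bsub>A\<^esub> a) \<odot>\<^bsub>M\<^esub> x = (c \<odot>\<^bsub>A\<^esub> \<one>\<^bsub>A\<^esub>) \<odot>\<^bsub>M\<^esub> (a \<odot>\<^bsub>M\<^esub> x)"
    "a \<odot>\<^bsub>M\<^esub> ((c \<odot>\<^bsub>A\<^esub> \<one>\<^bsub>A\<^esub>) \<odot>\<^bsub>M\<^esub> x) = (c \<odot>\<^bsub>A\<^esub> \<one>\<^bsub>A\<^esub>) \<odot>\<^bsub>M\<^esub> (a \<odot>\<^bsub>M\<^esub> x)"
    using assms M.act_mult[of "c \<odot>\<^bsub>A\<^esub> \<one>\<^bsub>A\<^esub>" a x] M.act_mult[of a "c \<odot>\<^bsub>A\<^esub> \<one>\<^bsub>A\<^esub>" x] by simp_all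
qed

lemma semilinear_induct [consumes 1, case_names smult add]:
  assumes v: "v \<in> carrier M"
    and sm: "\<And>c u. c \<in> carrier K \<Longrightarrow> u \<in> carrier M \<Longrightarrow> F u = u \<Longrightarrow> P ((c \<odot>\<^bsub>A\<^esub> \<one>\<^bsub>A\<^esub>) \<odot>\<^bsub>M\<^esub> u)"
    and ad: "\<And>x y. x \<in> carrier M \<Longrightarrow> y \<in> carrier M \<Longrightarrow> P x \<Longrightarrow> P y \<Longrightarrow> P (x \<oplus>\<^bsub>M\<^esub> y)"
  shows "P v"
  using v by (intro U.frob_induct[of v P]) (auto simp: underlying_simps fixed_eq intro: sm ad)

end

section \<open>The fixed algebra, and maps determined on fixed points\<close>

context frob_algebra
begin

abbreviation B :: "('k, 'a, 'c) module_scheme" where "B \<equiv> fixed_algebra A FA"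

lemma B_simps:
  "carrier B = {a \<in> carrier A. FA a = a}" "\<one>\<^bsub>B\<^esub> = \<one>\<^bsub>A\<^esub>" "\<zero>\<^bsub>B\<^esub> = \<zero>\<^bsub>A\<^esub>"
  "a \<oplus>\<^bsub>B\<^esub> b = a \<oplus>\<^bsub>A\<^esub> b" "a \<otimes>\<^bsub>B\<^esub> b = a \<otimes>\<^bsub>A\<^esub> b" "c \<odot>\<^bsub>B\<^esub> a = c \<odot>\<^bsub>A\<^esub> a"
  by (simp_all add: fixed_algebra_def)

lemma carrier_B: "carrier B = AF.fixed"
  by (simp add: B_simps AF.fixed_def)

lemma ring_B: "ring B"
proof -
  have neg: "FA (\<ominus>\<^bsub>A\<^esub> a) = \<ominus>\<^bsub>A\<^esub> a" if "a \<in> carrier A" "FA a = a" for a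
  proof -
    note G = ring.is_abelian_group[OF AA.A.ring_axioms]
    have "\<ominus>\<^bsub>A\<^esub> a \<in> carrier A" using that by simp
    hence "FA (\<ominus>\<^bsub>A\<^esub> a) \<oplus>\<^bsub>A\<^esub> a = \<zero>\<^bsub>A\<^esub>" "FA (\<ominus>\<^bsub>A\<^esub> a) \<in> carrier A"
      using FA_add[of "\<ominus>\<^bsub>A\<^esub> a" a] FA_closed that abelian_group.l_neg[OF G that(1)]
      by (simp_all add: FA_zero)
    thus ?thesis
      using abelian_group.minus_equality[OF G, of "FA (\<ominus>\<^bsub>A\<^esub> a)" a] that by simp
  qed
  have "subring {a \<in> carrier A. FA a = a} A"
    by (rule AA.A.subringI) (use neg in \<open>auto simp: FA_one FA_mult FA_add\<close>)
  thus ?thesis unfolding fixed_algebra_def by (rule AA.A.subring_is_ring)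
qed

lemma unit_hom_B: "(\<lambda>c. c \<odot>\<^bsub>B\<^esub> \<one>\<^bsub>B\<^esub>) \<in> ring_hom (K\<lparr>carrier := Fq\<rparr>) B"
proof (rule ring_hom_memI)
  fix c assume "c \<in> carrier (K\<lparr>carrier := Fq\<rparr>)"
  hence c: "c \<in> Fq" "c \<in> carrier K" using Fq_carrier by auto
  show "c \<odot>\<^bsub>B\<^esub> \<one>\<^bsub>B\<^esub> \<in> carrier B"
    using AF.fixed_smult[OF c(1), of "\<one>\<^bsub>A\<^esub>"] by (simp add: carrier_B B_simps(2,6) AF.fixed_def FA_one)
  fix d assume "d \<in> carrier (K\<lparr>carrier := Fq\<rparr>)"
  hence d: "d \<in> carrier K" using Fq_carrier by auto
  show "(c \<otimes>\<^bsub>K\<lparr>carrier := Fq\<rparr>\<^esub> d) \<odot>\<^bsub>B\<^esub> \<one>\<^bsub>B\<^esub> = (c \<odot>\<^bsub>B\<^esub> \<one>\<^bsub>B\<^esub>) \<otimes>\<^bsub>B\<^esub> (d \<odot>\<^bsub>B\<^esub> \<one>\<^bsub>B\<^esub>)"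
    using ring_hom_mult[OF unit_hom c(2) d] by (simp add: B_simps)
  show "(c \<oplus>\<^bsub>K\<lparr>carrier := Fq\<rparr>\<^esub> d) \<odot>\<^bsub>B\<^esub> \<one>\<^bsub>B\<^esub> = c \<odot>\<^bsub>B\<^esub> \<one>\<^bsub>B\<^esub> \<oplus>\<^bsub>B\<^esub> d \<odot>\<^bsub>B\<^esub> \<one>\<^bsub>B\<^esub>"
    using ring_hom_add[OF unit_hom c(2) d] by (simp add: B_simps)
next
  show "\<one>\<^bsub>K\<lparr>carrier := Fq\<rparr>\<^esub> \<odot>\<^bsub>B\<^esub> \<one>\<^bsub>B\<^esub> = \<one>\<^bsub>B\<^esub>" by (simp add: B_simps)
qed

text \<open>Over the finite field \<open>Fq\<close>, a generating set \<open>S\<close> yields at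
  most \<open>q^card S\<close> vectors. Hence the objects on this side are finite sets and fit into
  any infinite type.\<close>

lemma fd_module_B_iff:
  "fd_left_module (K\<lparr>carrier := Fq\<rparr>) B N \<longleftrightarrow> left_module B N \<and> finite (carrier N)"
proof (cases "left_module B N")
  case True
  let ?U = "underlying_space B N"
  interpret N: vectorspace "K\<lparr>carrier := Fq\<rparr>" ?U
    by (rule underlying_vectorspace[OF Fq_field unit_hom_B True])
  have cU: "carrier ?U = carrier N" by (simp add: underlying_space_def)
  have "N.fin_dim \<longleftrightarrow> finite (carrier N)"
  proof
    assume "N.fin_dim"
    then obtain S where S: "finite S" "S \<subseteq> carrier ?U" "N.span S = carrier ?U"
      unfolding N.fin_dim_def by blast
    have "N.span S \<subseteq> (\<lambda>c. N.lincomb c S) ` (S \<rightarrow>\<^sub>E Fq)"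
    proof
      fix v assume "v \<in> N.span S"
      then obtain c where c: "c \<in> S \<rightarrow> Fq" "N.lincomb c S = v"
        using N.finite_in_span[OF S(1,2)] by auto
      have "N.lincomb (restrict c S) S = N.lincomb c S"
        using S c(1) by (intro N.lincomb_cong) auto
      thus "v \<in> (\<lambda>c. N.lincomb c S) ` (S \<rightarrow>\<^sub>E Fq)" using c by (intro image_eqI[of _ _ "restrict c S"]) auto
    qed
    moreover have "finite ((\<lambda>c. N.lincomb c S) ` (S \<rightarrow>\<^sub>E Fq))"
      using S(1) finite_Fq by (intro finite_imageI finite_PiE) auto
    ultimately show "finite (carrier N)" using S(3) cU finite_subset by metis
  next
    assume "finite (carrier N)"
    thus "N.fin_dim"
      unfolding N.fin_dim_def cU[symmetric]
      using N.in_own_span[of "carrier ?U"] N.span_is_subset2[of "carrier ?U"] by blast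
  qed
  thus ?thesis using True by (simp add: fd_left_module_def)
qed (simp add: fd_left_module_def)

definition Fix :: "('a, 'v) module \<times> ('v \<Rightarrow> 'v) \<Rightarrow> 'v set" where
  "Fix U = {m \<in> carrier (fst U). snd U m = m}"

lemma fixed_left_module:
  assumes U: "semilinear_module K Fq p r A FA (fst U) (snd U)"
  shows "left_module B ((fst U)\<lparr>carrier := Fix U\<rparr>)"
proof -
  interpret semilinear_module K Fq p r A FA "fst U" "snd U" by (rule U)
  interpret B: ring B by (rule ring_B)
  have neg: "\<exists>y\<in>Fix U. y \<oplus>\<^bsub>fst U\<^esub> x = \<zero>\<^bsub>fst U\<^esub>" if "x \<in> Fix U" for x
    using that by (intro bexI[of _ "\<ominus>\<^bsub>fst U\<^esub> x"]) (auto simp: Fix_def M.M.l_neg FM_minus)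
  interpret G: abelian_group "(fst U)\<lparr>carrier := Fix U\<rparr>"
    by (rule abelian_groupI) (use neg in \<open>auto simp: Fix_def M.M.a_ac FM_add FM_zero\<close>)
  show ?thesis
    by unfold_locales
      (auto simp: Fix_def B_simps M.act_closed FM_act M.act_add_left M.act_add_right M.act_mult M.act_one)
qed

text \<open>Faithfulness of the fixed-point functor: fixed points span.\<close>

lemma F_hom_eqI:
  assumes U: "F_obj U" and \<theta>: "F_hom U V \<theta>" and \<psi>: "F_hom U V \<psi>"
    and eq: "\<And>u. u \<in> Fix U \<Longrightarrow> \<theta> u = \<psi> u"
  shows "\<theta> = \<psi>"
proof (rule extensionalityI[OF F_homD(5)[OF \<theta>] F_homD(5)[OF \<psi>]])
  interpret U: semilinear_module K Fq p r A FA "fst U" "snd U" by (rule F_objD(1)[OF U])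
  fix x assume "x \<in> carrier (fst U)"
  thus "\<theta> x = \<psi> x"
  proof (induction rule: U.semilinear_induct)
    case (smult c u)
    have "c \<odot>\<^bsub>A\<^esub> \<one>\<^bsub>A\<^esub> \<in> carrier A" using smult by simp
    thus ?case using smult eq[of u] F_homD(3)[OF \<theta>] F_homD(3)[OF \<psi>] by (simp add: Fix_def)
  next
    case (add x y)
    thus ?case using F_homD(2)[OF \<theta>] F_homD(2)[OF \<psi>] by simp
  qed
qed

text \<open>Fullness of the fixed-point functor. The linear extension is already available; that it
  commutes with Frobenius and with \<open>A\<close> is checked on multiples of fixed points.\<close>

lemma F_hom_of_fixed:
  assumes U: "F_obj U" and V: "F_obj V"
    and f: "\<And>u. u \<in> Fix U \<Longrightarrow> f u \<in> Fix V"
    and f_add: "\<And>u v. u \<in> Fix U \<Longrightarrow> v \<in> Fix U \<Longrightarrow> f (u \<oplus>\<^bsub>fst U\<^esub> v) = f u \<oplus>\<^bsub>fst V\<^esub> f v"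
    and f_act: "\<And>a u. a \<in> carrier B \<Longrightarrow> u \<in> Fix U \<Longrightarrow> f (a \<odot>\<^bsub>fst U\<^esub> u) = a \<odot>\<^bsub>fst V\<^esub> f u"
  shows "\<exists>\<theta>. F_hom U V \<theta> \<and> (\<forall>u\<in>Fix U. \<theta> u = f u)"
proof -
  interpret U: semilinear_module K Fq p r A FA "fst U" "snd U" by (rule F_objD(1)[OF U])
  interpret V: semilinear_module K Fq p r A FA "fst V" "snd V" by (rule F_objD(1)[OF V])
  interpret FU: left_module B "(fst U)\<lparr>carrier := Fix U\<rparr>"
    by (rule fixed_left_module[OF U.semilinear_module_axioms])
  have FixU: "U.U.fixed = Fix U" by (simp add: U.fixed_eq Fix_def)
  have unit: "c \<odot>\<^bsub>A\<^esub> \<one>\<^bsub>A\<^esub> \<in> carrier A" if "c \<in> carrier K" for c using that by simp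
  \<comment> \<open>Linearity of \<open>f\<close> over \<open>Fq\<close> is the case
    \<open>a = c . 1\<close> of \<open>f_act\<close>.\<close>
  have unitB: "c \<odot>\<^bsub>A\<^esub> \<one>\<^bsub>A\<^esub> \<in> carrier B" if "c \<in> Fq" for c
    using ring_hom_closed[OF unit_hom_B, of c] that by (simp add: B_simps(2,6))
  have "\<exists>g. g \<in> module_hom K (underlying_space A (fst U)) (underlying_space A (fst V)) \<and>
      (\<forall>u\<in>U.U.fixed. g u = f u)"
    by (rule U.U.extend_from_fixed[OF V.U.module_axioms])
      (use f f_add f_act unitB in \<open>auto simp: FixU U.underlying_simps V.underlying_simps Fix_def\<close>)
  then obtain g where g: "g \<in> module_hom K (underlying_space A (fst U)) (underlying_space A (fst V))"
    and gf: "\<And>u. u \<in> Fix U \<Longrightarrow> g u = f u" unfolding FixU by blast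
  have g_closed: "g x \<in> carrier (fst V)" if "x \<in> carrier (fst U)" for x
    using module_hom_closed[OF g] that by (auto simp: U.underlying_simps V.underlying_simps)
  have g_add: "g (x \<oplus>\<^bsub>fst U\<^esub> y) = g x \<oplus>\<^bsub>fst V\<^esub> g y" if "x \<in> carrier (fst U)" "y \<in> carrier (fst U)" for x y
    using module_hom_add[OF g] that by (auto simp: U.underlying_simps V.underlying_simps)
  have g_smult: "g ((c \<odot>\<^bsub>A\<^esub> \<one>\<^bsub>A\<^esub>) \<odot>\<^bsub>fst U\<^esub> x) = (c \<odot>\<^bsub>A\<^esub> \<one>\<^bsub>A\<^esub>) \<odot>\<^bsub>fst V\<^esub> g x"
    if "c \<in> carrier K" "x \<in> carrier (fst U)" for c x
    using module_hom_smult[OF g] that by (auto simp: U.underlying_simps V.underlying_simps)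
  have g_F: "g (snd U x) = snd V (g x)" if "x \<in> carrier (fst U)" for x
    using that
  proof (induction rule: U.semilinear_induct)
    case (smult c u)
    have u: "u \<in> Fix U" "g u \<in> Fix V" using smult gf f by (auto simp: Fix_def)
    have cq: "c [^] q \<in> carrier K" using smult by simp
    have "snd U ((c \<odot>\<^bsub>A\<^esub> \<one>\<^bsub>A\<^esub>) \<odot>\<^bsub>fst U\<^esub> u) = (c [^] q \<odot>\<^bsub>A\<^esub> \<one>\<^bsub>A\<^esub>) \<odot>\<^bsub>fst U\<^esub> u"
      using smult unit by (simp add: U.FM_act FA_smult FA_one)
    moreover have "snd V ((c \<odot>\<^bsub>A\<^esub> \<one>\<^bsub>A\<^esub>) \<odot>\<^bsub>fst V\<^esub> g u) = (c [^] q \<odot>\<^bsub>A\<^esub> \<one>\<^bsub>A\<^esub>) \<odot>\<^bsub>fst V\<^esub> g u"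
      using smult unit u by (simp add: V.FM_act FA_smult FA_one Fix_def)
    ultimately show ?case using smult cq by (simp add: g_smult)
  next
    case (add x y)
    thus ?case by (simp add: U.FM_add V.FM_add g_add g_closed U.FM_closed)
  qed
  \<comment> \<open>Linearity over \<open>A\<close> takes two inductions: here the vector becomes
    arbitrary while \<open>a\<close> stays fixed under \<open>FA\<close>, and afterwards
    \<open>a\<close> becomes arbitrary.\<close>
  have g_act_fixed: "g (a \<odot>\<^bsub>fst U\<^esub> x) = a \<odot>\<^bsub>fst V\<^esub> g x" if a: "a \<in> carrier B" and x: "x \<in> carrier (fst U)" for a x
    using x
  proof (induction rule: U.semilinear_induct)
    case (smult c u)
    have aA: "a \<in> carrier A" using a by (simp add: B_simps)
    have u: "u \<in> Fix U" using smult by (simp add: Fix_def)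
    have au: "a \<odot>\<^bsub>fst U\<^esub> u \<in> Fix U" using FU.act_closed[OF a] u by simp
    have "g (a \<odot>\<^bsub>fst U\<^esub> ((c \<odot>\<^bsub>A\<^esub> \<one>\<^bsub>A\<^esub>) \<odot>\<^bsub>fst U\<^esub> u)) = (c \<odot>\<^bsub>A\<^esub> \<one>\<^bsub>A\<^esub>) \<odot>\<^bsub>fst V\<^esub> g (a \<odot>\<^bsub>fst U\<^esub> u)"
      using smult aA U.M.act_closed by (simp add: U.scalar_act(2) g_smult)
    also have "g (a \<odot>\<^bsub>fst U\<^esub> u) = a \<odot>\<^bsub>fst V\<^esub> g u" using gf[OF au] gf[OF u] f_act[OF a u] by simp
    finally show ?case using smult aA g_closed by (simp add: V.scalar_act(2) g_smult)
  next
    case (add x y)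
    have aA: "a \<in> carrier A" using a by (simp add: B_simps)
    show ?case using add aA by (simp add: U.M.act_add_right V.M.act_add_right U.M.act_closed g_add g_closed)
  qed
  have g_act: "g (a \<odot>\<^bsub>fst U\<^esub> x) = a \<odot>\<^bsub>fst V\<^esub> g x" if a: "a \<in> carrier A" and x: "x \<in> carrier (fst U)" for a x
    using a
  proof (induction rule: AF.frob_induct)
    case (smult c u)
    have u: "u \<in> carrier B" "u \<in> carrier A" using smult carrier_B AF.fixed_carrier by auto
    show ?case
      using smult(1) x u U.M.act_closed g_closed
      by (simp add: U.scalar_act(1)[of c u] V.scalar_act(1)[of c u] g_smult g_act_fixed)
  next
    case (add a b)
    thus ?case using x by (simp add: U.M.act_add_left V.M.act_add_left U.M.act_closed g_add g_closed)
  qed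
  have "F_hom U V (restrict g (carrier (fst U)))"
    by (rule F_homI) (auto simp: g_closed g_add g_act g_F U.M.act_closed U.FM_closed)
  moreover have "\<forall>u\<in>Fix U. restrict g (carrier (fst U)) u = f u" using gf by (simp add: Fix_def)
  ultimately show ?thesis by blast
qed

end

text \<open>The fixed points of an object form a finite set, which is moved into the type \<open>'w\<close>.\<close>

locale fixed_functor = frob_algebra K Fq p r A FA
  for K :: "('k, 'e) ring_scheme" (structure) and Fq p r and A :: "('k, 'a, 'c) module_scheme" and FA +
  fixes j :: "('a, 'v) module \<times> ('v \<Rightarrow> 'v) \<Rightarrow> 'v \<Rightarrow> 'w"
  assumes j: "F_obj U \<Longrightarrow> inj_on (j U) (Fix U)"
begin

abbreviation modB :: "(('a, 'w) module, ('a, 'w) module \<times> ('w \<Rightarrow> 'w) \<times> ('a, 'w) module) cat" where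
  "modB \<equiv> mod_cat (K\<lparr>carrier := Fq\<rparr>) B"

definition Fo :: "('a, 'v) module \<times> ('v \<Rightarrow> 'v) \<Rightarrow> ('a, 'w) module" where
  "Fo U = image_module (j U) ((fst U)\<lparr>carrier := Fix U\<rparr>)"

definition fmap where
  "fmap U V \<theta> = (\<lambda>y \<in> carrier (Fo U). j V (\<theta> (inv_into (Fix U) (j U) y)))"

definition Fa where "Fa = (\<lambda>(U, \<theta>, V). (Fo U, fmap U V \<theta>, Fo V))"

lemma Fa_simp: "Fa (U, \<theta>, V) = (Fo U, fmap U V \<theta>, Fo V)" by (simp add: Fa_def)

lemma carrier_Fo: "carrier (Fo U) = j U ` Fix U" by (simp add: Fo_def image_module_def)

lemma Fo_congruence:
  assumes "F_obj U" shows "module_congruence B ((fst U)\<lparr>carrier := Fix U\<rparr>) (j U)"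
  by (rule module_congruence_inj[OF fixed_left_module[OF F_objD(1)[OF assms]]])
    (simp add: j[OF assms])

lemma Fo_add:
  "F_obj U \<Longrightarrow> u \<in> Fix U \<Longrightarrow> v \<in> Fix U \<Longrightarrow> j U u \<oplus>\<^bsub>Fo U\<^esub> j U v = j U (u \<oplus>\<^bsub>fst U\<^esub> v)"
  using module_congruence.image_add[OF Fo_congruence[of U], of u v] by (simp add: Fo_def)

lemma Fo_act:
  "F_obj U \<Longrightarrow> a \<in> carrier B \<Longrightarrow> u \<in> Fix U \<Longrightarrow> a \<odot>\<^bsub>Fo U\<^esub> j U u = j U (a \<odot>\<^bsub>fst U\<^esub> u)"
  using module_congruence.image_smult[OF Fo_congruence[of U], of a u] by (simp add: Fo_def)

lemma Fo_obj: assumes U: "F_obj U" shows "fd_left_module (K\<lparr>carrier := Fq\<rparr>) B (Fo U)"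
proof -
  have "left_module B (Fo U)"
    unfolding Fo_def by (rule module_congruence.image_left_module[OF Fo_congruence[OF U]])
  moreover have "finite (Fix U)" unfolding Fix_def by (rule F_objD(2)[OF U])
  ultimately show ?thesis by (simp add: fd_module_B_iff carrier_Fo)
qed

lemma Fix_closed:
  assumes U: "F_obj U"
  shows "u \<in> Fix U \<Longrightarrow> v \<in> Fix U \<Longrightarrow> u \<oplus>\<^bsub>fst U\<^esub> v \<in> Fix U"
    and "a \<in> carrier B \<Longrightarrow> u \<in> Fix U \<Longrightarrow> a \<odot>\<^bsub>fst U\<^esub> u \<in> Fix U"
    and "u \<in> Fix U \<Longrightarrow> u \<in> carrier (fst U)"
proof -
  interpret left_module B "(fst U)\<lparr>carrier := Fix U\<rparr>" by (rule fixed_left_module[OF F_objD(1)[OF U]])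
  show "u \<in> Fix U \<Longrightarrow> v \<in> Fix U \<Longrightarrow> u \<oplus>\<^bsub>fst U\<^esub> v \<in> Fix U" using M.a_closed by simp
  show "a \<in> carrier B \<Longrightarrow> u \<in> Fix U \<Longrightarrow> a \<odot>\<^bsub>fst U\<^esub> u \<in> Fix U" using act_closed by simp
  show "u \<in> Fix U \<Longrightarrow> u \<in> carrier (fst U)" by (simp add: Fix_def)
qed

lemma F_hom_Fix: "F_hom U V \<theta> \<Longrightarrow> u \<in> Fix U \<Longrightarrow> \<theta> u \<in> Fix V"
  using F_homD(1,4)[of U V \<theta> u] by (simp add: Fix_def)

lemma fmap_j: "F_obj U \<Longrightarrow> u \<in> Fix U \<Longrightarrow> fmap U V \<theta> (j U u) = j V (\<theta> u)"
  using j[of U] by (simp add: fmap_def carrier_Fo)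

lemma fmap_hom:
  assumes U: "F_obj U" and V: "F_obj V" and \<theta>: "F_hom U V \<theta>"
  shows "mod_hom_on B (Fo U) (Fo V) (fmap U V \<theta>)"
proof -
  note tD = F_homD[OF \<theta>] and c = Fix_closed[OF U] and tF = F_hom_Fix[OF \<theta>]
  have act: "fmap U V \<theta> (a \<odot>\<^bsub>Fo U\<^esub> j U u) = a \<odot>\<^bsub>Fo V\<^esub> fmap U V \<theta> (j U u)"
    if "a \<in> carrier B" "u \<in> Fix U" for a u
    using that c tF tD(3)[of a u] by (simp add: Fo_act[OF U] Fo_act[OF V] fmap_j[OF U] B_simps(1))
  have add: "fmap U V \<theta> (j U u \<oplus>\<^bsub>Fo U\<^esub> j U v) = fmap U V \<theta> (j U u) \<oplus>\<^bsub>Fo V\<^esub> fmap U V \<theta> (j U v)"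
    if "u \<in> Fix U" "v \<in> Fix U" for u v
    using that c tF tD(2)[of u v] by (simp add: Fo_add[OF U] Fo_add[OF V] fmap_j[OF U])
  have "fmap U V \<theta> (j U u) \<in> carrier (Fo V)" if "u \<in> Fix U" for u
    using that tF by (simp add: fmap_j[OF U] carrier_Fo)
  moreover have "fmap U V \<theta> \<in> extensional (carrier (Fo U))" by (simp add: fmap_def)
  ultimately show ?thesis
    using act add unfolding mod_hom_on_def module_hom_def carrier_Fo by auto
qed

lemma fixed_cat_functor: "cat_functor modF modB Fo Fa"
proof (intro cat_functor.intro category_modF category_mod_cat cat_functor_axioms.intro)
  fix U :: "('a, 'v) module \<times> ('v \<Rightarrow> 'v)" assume "U \<in> obj modF"
  hence U: "F_obj U" by (simp add: modF_simps)
  show "Fo U \<in> obj modB" using Fo_obj[OF U] by (simp add: mod_cat_simps)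
  have "fmap U U (\<lambda>m \<in> carrier (fst U). m) = (\<lambda>y \<in> carrier (Fo U). y)"
  proof (rule extensionalityI[of _ "carrier (Fo U)"])
    show "fmap U U (\<lambda>m \<in> carrier (fst U). m) y = (\<lambda>y \<in> carrier (Fo U). y) y" if "y \<in> carrier (Fo U)" for y
      using that fmap_j[OF U, of _ U] Fix_closed(3)[OF U] by (auto simp: carrier_Fo)
  qed (simp_all add: fmap_def)
  thus "Fa (ident modF U) = ident modB (Fo U)" by (simp add: modF_simps mod_cat_simps Fa_simp)
next
  fix f and U V :: "('a, 'v) module \<times> ('v \<Rightarrow> 'v)" assume "f \<in> homset modF U V"
  then obtain \<theta> where \<theta>: "F_obj U" "F_obj V" "f = (U, \<theta>, V)" "F_hom U V \<theta>" by (auto simp: homset_modF)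
  show "Fa f \<in> homset modB (Fo U) (Fo V)"
    using Fo_obj[OF \<theta>(1)] Fo_obj[OF \<theta>(2)] fmap_hom[OF \<theta>(1,2,4)] by (simp add: \<theta>(3) Fa_simp homset_mod_cat)
  fix g Z assume "g \<in> homset modF V Z"
  then obtain \<psi> where \<psi>: "F_obj Z" "g = (V, \<psi>, Z)" "F_hom V Z \<psi>" by (auto simp: homset_modF)
  have "fmap U Z (compose (carrier (fst U)) \<psi> \<theta>) = compose (carrier (Fo U)) (fmap V Z \<psi>) (fmap U V \<theta>)"
  proof (rule extensionalityI[of _ "carrier (Fo U)"])
    fix y assume "y \<in> carrier (Fo U)"
    then obtain u where u: "u \<in> Fix U" "y = j U u" by (auto simp: carrier_Fo)
    show "fmap U Z (compose (carrier (fst U)) \<psi> \<theta>) y = compose (carrier (Fo U)) (fmap V Z \<psi>) (fmap U V \<theta>) y"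
      using u F_hom_Fix[OF \<theta>(4) u(1)] Fix_closed(3)[OF \<theta>(1) u(1)]
      by (simp add: compose_eq carrier_Fo fmap_j[OF \<theta>(1)] fmap_j[OF \<theta>(2)])
  qed (simp_all add: fmap_def)
  thus "Fa (g \<cdot>\<^bsub>modF\<^esub> f) = Fa g \<cdot>\<^bsub>modB\<^esub> Fa f"
    by (simp add: \<theta>(3) \<psi>(2) modF_simps mod_cat_simps Fa_simp)
qed

text \<open>Conjugation with the injections \<open>j\<close> reduces injectivity to
  \<open>F_hom_eqI\<close> and surjectivity to \<open>F_hom_of_fixed\<close>.\<close>

lemma fixed_fully_faithful:
  assumes U: "F_obj U" and V: "F_obj V"
  shows "bij_betw Fa (homset modF U V) (homset modB (Fo U) (Fo V))"
  unfolding bij_betw_def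
proof
  note jV = inj_onD[OF j[OF V]]
  show "inj_on Fa (homset modF U V)"
  proof (rule inj_onI)
    fix f g assume "f \<in> homset modF U V" "g \<in> homset modF U V" and eq: "Fa f = Fa g"
    then obtain \<theta> \<psi> where f: "f = (U, \<theta>, V)" "F_hom U V \<theta>" and g: "g = (U, \<psi>, V)" "F_hom U V \<psi>"
      by (auto simp: homset_modF)
    have "fmap U V \<theta> = fmap U V \<psi>" using eq by (simp add: f(1) g(1) Fa_simp)
    hence "j V (\<theta> u) = j V (\<psi> u)" if "u \<in> Fix U" for u using fmap_j[OF U that] by metis
    hence "\<theta> u = \<psi> u" if "u \<in> Fix U" for u
      using jV that F_hom_Fix[OF f(2) that] F_hom_Fix[OF g(2) that] by blast
    hence "\<theta> = \<psi>" by (rule F_hom_eqI[OF U f(2) g(2)])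
    thus "f = g" by (simp add: f(1) g(1))
  qed
  show "Fa ` homset modF U V = homset modB (Fo U) (Fo V)"
  proof
    show "Fa ` homset modF U V \<subseteq> homset modB (Fo U) (Fo V)"
      using cat_functor.map_hom[OF fixed_cat_functor] by blast
    show "homset modB (Fo U) (Fo V) \<subseteq> Fa ` homset modF U V"
    proof
      fix h assume "h \<in> homset modB (Fo U) (Fo V)"
      then obtain \<phi> where h: "h = (Fo U, \<phi>, Fo V)" and \<phi>: "mod_hom_on B (Fo U) (Fo V) \<phi>"
        by (auto simp: homset_mod_cat)
      \<comment> \<open>This is \<open>\<phi>\<close> read back along \<open>j U\<close> and
        \<open>j V\<close>, so that it acts on the fixed points themselves.\<close>
      define f where "f u = inv_into (Fix V) (j V) (\<phi> (j U u))" for u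
      have "\<phi> (j U u) \<in> j V ` Fix V" if "u \<in> Fix U" for u
        using \<phi> that unfolding mod_hom_on_def module_hom_def carrier_Fo by auto
      hence f: "f u \<in> Fix V" "j V (f u) = \<phi> (j U u)" if "u \<in> Fix U" for u
        using that unfolding f_def by (auto intro: inv_into_into f_inv_into_f)
      have "\<exists>\<theta>. F_hom U V \<theta> \<and> (\<forall>u\<in>Fix U. \<theta> u = f u)"
      proof (rule F_hom_of_fixed[OF U V])
        show "f u \<in> Fix V" if "u \<in> Fix U" for u by (rule f(1)[OF that])
        show "f (u \<oplus>\<^bsub>fst U\<^esub> v) = f u \<oplus>\<^bsub>fst V\<^esub> f v" if uv: "u \<in> Fix U" "v \<in> Fix U" for u v
        proof (rule jV)
          have "\<phi> (j U u \<oplus>\<^bsub>Fo U\<^esub> j U v) = \<phi> (j U u) \<oplus>\<^bsub>Fo V\<^esub> \<phi> (j U v)"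
            using \<phi> uv unfolding mod_hom_on_def module_hom_def carrier_Fo by auto
          thus "j V (f (u \<oplus>\<^bsub>fst U\<^esub> v)) = j V (f u \<oplus>\<^bsub>fst V\<^esub> f v)"
            using uv f Fix_closed(1)[OF U] by (simp add: Fo_add[OF U] Fo_add[OF V, symmetric])
        qed (use uv f Fix_closed[OF U] Fix_closed[OF V] in auto)
        show "f (a \<odot>\<^bsub>fst U\<^esub> u) = a \<odot>\<^bsub>fst V\<^esub> f u" if au: "a \<in> carrier B" "u \<in> Fix U" for a u
        proof (rule jV)
          have "\<phi> (a \<odot>\<^bsub>Fo U\<^esub> j U u) = a \<odot>\<^bsub>Fo V\<^esub> \<phi> (j U u)"
            using \<phi> au unfolding mod_hom_on_def module_hom_def carrier_Fo by auto
          thus "j V (f (a \<odot>\<^bsub>fst U\<^esub> u)) = j V (a \<odot>\<^bsub>fst V\<^esub> f u)"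
            using au f Fix_closed(2)[OF U] by (simp add: Fo_act[OF U] Fo_act[OF V, symmetric])
        qed (use au f Fix_closed[OF U] Fix_closed[OF V] in auto)
      qed
      then obtain \<theta> where \<theta>: "F_hom U V \<theta>" "\<And>u. u \<in> Fix U \<Longrightarrow> \<theta> u = f u" by blast
      have "fmap U V \<theta> = \<phi>"
      proof (rule extensionalityI[of _ "carrier (Fo U)"])
        show "fmap U V \<theta> y = \<phi> y" if "y \<in> carrier (Fo U)" for y
          using that \<theta>(2) f(2) fmap_j[OF U, of _ V] by (auto simp: carrier_Fo)
        show "fmap U V \<theta> \<in> extensional (carrier (Fo U))" by (simp add: fmap_def)
        show "\<phi> \<in> extensional (carrier (Fo U))" using \<phi> by (simp add: mod_hom_on_def)
      qed
      hence "h = Fa (U, \<theta>, V)" by (simp add: h Fa_simp)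
      thus "h \<in> Fa ` homset modF U V" using homset_modFI[OF U V \<theta>(1)] by blast
    qed
  qed
qed

end

section \<open>Base change\<close>

context finite_base
begin

definition coord_frob :: "'i set \<Rightarrow> ('i \<Rightarrow> 'a) \<Rightarrow> 'i \<Rightarrow> 'a" where
  "coord_frob S \<phi> = (\<lambda>i \<in> S. \<phi> i [^] q)"

lemma func_space_simps:
  "carrier (func_space S) = S \<rightarrow>\<^sub>E carrier K"
  "\<phi> \<oplus>\<^bsub>func_space S\<^esub> \<psi> = (\<lambda>i \<in> S. \<phi> i \<oplus> \<psi> i)"
  "c \<odot>\<^bsub>func_space S\<^esub> \<phi> = (\<lambda>i \<in> S. c \<otimes> \<phi> i)"
  by (simp_all add: func_space_def)

text \<open>\<open>K\<close> is the union of the finite fields \<open>E N\<close>, and finitely many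
  coordinates lie in a common one. Countability is what allows the extended module to be moved into
  an arbitrary infinite type.\<close>

lemma countable_func_space:
  assumes S: "finite S" shows "countable (carrier (func_space S))"
proof -
  have "S \<rightarrow>\<^sub>E carrier K = (\<Union>N\<in>{0<..}. S \<rightarrow>\<^sub>E E N)"
  proof
    show "S \<rightarrow>\<^sub>E carrier K \<subseteq> (\<Union>N\<in>{0<..}. S \<rightarrow>\<^sub>E E N)"
    proof
      fix \<phi> assume \<phi>: "\<phi> \<in> S \<rightarrow>\<^sub>E carrier K"
      hence "finite (\<phi> ` S)" "\<phi> ` S \<subseteq> carrier K" using S by auto
      then obtain N where "N > 0" "\<phi> ` S \<subseteq> E N" using E_common by blast
      thus "\<phi> \<in> (\<Union>N\<in>{0<..}. S \<rightarrow>\<^sub>E E N)" using \<phi> by (auto simp: PiE_iff)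
    qed
  qed (use E_carrier in \<open>auto simp: PiE_iff\<close>)
  moreover have "countable (S \<rightarrow>\<^sub>E E N)" if "N > 0" for N
    using S card_E(2)[OF that] by (intro countable_finite finite_PiE)
  ultimately show ?thesis unfolding func_space_simps by (auto intro!: countable_UN)
qed

text \<open>Finitely many coordinates have a common period, which gives periodicity; the fixed
  points are found coordinatewise from \<open>Fq = E 1\<close>.\<close>

lemma frob_space_coord:
  assumes S: "finite S"
  shows "frob_space K Fq p r (func_space S) (coord_frob S)"
    and "frob_space.fixed (func_space S) (coord_frob S) = (S \<rightarrow>\<^sub>E Fq)"
proof -
  interpret W: module K "func_space S" by (rule func_space_is_module)
  have pow: "(coord_frob S ^^ n) \<phi> = (\<lambda>i \<in> S. \<phi> i [^] (q ^ n))" if \<phi>: "\<phi> \<in> S \<rightarrow>\<^sub>E carrier K" for n \<phi>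
  proof (induction n)
    case 0
    show ?case using \<phi> by (auto simp: PiE_def extensional_def fun_eq_iff restrict_def Pi_iff)
  next
    case (Suc n)
    have "(\<phi> i [^] (q ^ n)) [^] q = \<phi> i [^] (q ^ Suc n)" if "i \<in> S" for i
    proof -
      have "\<phi> i \<in> carrier K" using \<phi> that by auto
      from frob_frob[OF this, of n 1] show ?thesis by simp
    qed
    thus ?case using Suc by (auto simp: coord_frob_def fun_eq_iff)
  qed
  have per: "\<exists>n>0. (coord_frob S ^^ n) \<phi> = \<phi>" if \<phi>: "\<phi> \<in> S \<rightarrow>\<^sub>E carrier K" for \<phi>
  proof -
    have "finite (\<phi> ` S)" "\<phi> ` S \<subseteq> carrier K" using S \<phi> by auto
    then obtain N where N: "N > 0" "\<phi> ` S \<subseteq> E N" using E_common by blast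
    have "(\<lambda>i \<in> S. \<phi> i [^] (q ^ N)) = \<phi>"
    proof (rule extensionalityI[of _ S])
      show "(\<lambda>i \<in> S. \<phi> i [^] (q ^ N)) i = \<phi> i" if "i \<in> S" for i
        using N(2) that by (auto simp: E_def)
    qed (use \<phi> in \<open>auto simp: PiE_def\<close>)
    thus ?thesis using N(1) pow[OF \<phi>, of N] by auto
  qed
  show fs: "frob_space K Fq p r (func_space S) (coord_frob S)"
  proof
    fix \<phi> assume p1: "\<phi> \<in> carrier (func_space S)"
    hence \<phi>: "\<phi> \<in> S \<rightarrow>\<^sub>E carrier K" by (simp add: func_space_simps)
    show "coord_frob S \<phi> \<in> carrier (func_space S)"
      using \<phi> by (auto simp: func_space_simps coord_frob_def)
    show "\<exists>n>0. (coord_frob S ^^ n) \<phi> = \<phi>" by (rule per[OF \<phi>])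
    show "coord_frob S (c \<odot>\<^bsub>func_space S\<^esub> \<phi>) = c [^] q \<odot>\<^bsub>func_space S\<^esub> coord_frob S \<phi>" if "c \<in> carrier K" for c
      unfolding func_space_simps coord_frob_def
      by (rule restrict_ext) (use that \<phi> in \<open>auto intro!: nat_pow_distrib\<close>)
    fix \<psi> assume "\<psi> \<in> carrier (func_space S)"
    hence \<psi>: "\<psi> \<in> S \<rightarrow>\<^sub>E carrier K" by (simp add: func_space_simps)
    show "coord_frob S (\<phi> \<oplus>\<^bsub>func_space S\<^esub> \<psi>) = coord_frob S \<phi> \<oplus>\<^bsub>func_space S\<^esub> coord_frob S \<psi>"
      unfolding func_space_simps coord_frob_def
    proof (rule restrict_ext)
      fix i assume i: "i \<in> S"
      have "\<phi> i \<in> carrier K" "\<psi> i \<in> carrier K" using \<phi> \<psi> i by auto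
      from frob_add[OF this, of 1] i
      show "(\<lambda>i \<in> S. \<phi> i \<oplus> \<psi> i) i [^] q = (\<lambda>i \<in> S. \<phi> i [^] q) i \<oplus> (\<lambda>i \<in> S. \<psi> i [^] q) i" by simp
    qed
  qed
  interpret F: frob_space K Fq p r "func_space S" "coord_frob S" by (rule fs)
  have E1: "x \<in> Fq \<longleftrightarrow> x \<in> carrier K \<and> x [^] q = x" for x
    unfolding Fq_iff by (simp add: E_def)
  show "F.fixed = (S \<rightarrow>\<^sub>E Fq)"
  proof
    show "F.fixed \<subseteq> S \<rightarrow>\<^sub>E Fq"
    proof
      fix \<phi> assume "\<phi> \<in> F.fixed"
      hence \<phi>: "\<phi> \<in> S \<rightarrow>\<^sub>E carrier K" "coord_frob S \<phi> = \<phi>"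
        by (auto simp: F.fixed_def func_space_simps)
      have "\<phi> i \<in> Fq" if "i \<in> S" for i
        using \<phi>(1) that fun_cong[OF \<phi>(2), of i] unfolding E1 by (auto simp: coord_frob_def)
      thus "\<phi> \<in> S \<rightarrow>\<^sub>E Fq" using \<phi>(1) by auto
    qed
    show "S \<rightarrow>\<^sub>E Fq \<subseteq> F.fixed"
    proof
      fix \<phi> assume \<phi>: "\<phi> \<in> S \<rightarrow>\<^sub>E Fq"
      have "coord_frob S \<phi> = \<phi>"
      proof (rule extensionalityI[of _ S])
        fix i assume i: "i \<in> S"
        hence "\<phi> i \<in> Fq" using \<phi> by auto
        thus "coord_frob S \<phi> i = \<phi> i" using i Fq_frob by (simp add: coord_frob_def)
      qed (use \<phi> in \<open>auto simp: coord_frob_def PiE_def\<close>)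
      moreover have "\<phi> \<in> S \<rightarrow>\<^sub>E carrier K" using \<phi> Fq_carrier by (auto simp: PiE_iff)
      ultimately show "\<phi> \<in> F.fixed" by (simp add: F.fixed_def func_space_simps)
    qed
  qed
qed

end

context frob_algebra
begin

text \<open>Twice extending from fixed points, first in the vector and then in the algebra, turns an
  action of the fixed algebra on the fixed points of a Frobenius space into an action of \<open>A\<close>.\<close>

lemma extend_action:
  fixes V :: "('k, 'x) module"
  assumes V: "frob_space K Fq p r V F"
    and b_closed: "\<And>a u. a \<in> carrier B \<Longrightarrow> u \<in> frob_space.fixed V F \<Longrightarrow> b a u \<in> frob_space.fixed V F"
    and b_add_right: "\<And>a u v. a \<in> carrier B \<Longrightarrow> u \<in> frob_space.fixed V F \<Longrightarrow> v \<in> frob_space.fixed V F \<Longrightarrow>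
      b a (u \<oplus>\<^bsub>V\<^esub> v) = b a u \<oplus>\<^bsub>V\<^esub> b a v"
    and b_add_left: "\<And>a a' u. a \<in> carrier B \<Longrightarrow> a' \<in> carrier B \<Longrightarrow> u \<in> frob_space.fixed V F \<Longrightarrow>
      b (a \<oplus>\<^bsub>A\<^esub> a') u = b a u \<oplus>\<^bsub>V\<^esub> b a' u"
    and b_mult: "\<And>a a' u. a \<in> carrier B \<Longrightarrow> a' \<in> carrier B \<Longrightarrow> u \<in> frob_space.fixed V F \<Longrightarrow>
      b (a \<otimes>\<^bsub>A\<^esub> a') u = b a (b a' u)"
    and b_one: "\<And>u. u \<in> frob_space.fixed V F \<Longrightarrow> b \<one>\<^bsub>A\<^esub> u = u"
    and b_smult_left: "\<And>c a u. c \<in> Fq \<Longrightarrow> a \<in> carrier B \<Longrightarrow> u \<in> frob_space.fixed V F \<Longrightarrow>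
      b (c \<odot>\<^bsub>A\<^esub> a) u = c \<odot>\<^bsub>V\<^esub> b a u"
    and b_smult_right: "\<And>c a u. c \<in> Fq \<Longrightarrow> a \<in> carrier B \<Longrightarrow> u \<in> frob_space.fixed V F \<Longrightarrow>
      b a (c \<odot>\<^bsub>V\<^esub> u) = c \<odot>\<^bsub>V\<^esub> b a u"
  shows "\<exists>M :: ('a, 'x) module. semilinear_module K Fq p r A FA M F \<and> carrier M = carrier V \<and>
    add M = add V \<and> (\<forall>a\<in>carrier B. \<forall>u\<in>frob_space.fixed V F. a \<odot>\<^bsub>M\<^esub> u = b a u)"
proof -
  interpret V: frob_space K Fq p r V F by (rule V)
  \<comment> \<open>For each \<open>a\<close> in the fixed algebra, \<open>b a\<close> extends from
    fixed vectors to a \<open>K\<close>-linear map \<open>\<rho> a\<close> on \<open>V\<close>. The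
    laws of \<open>b\<close> then pass to \<open>\<rho>\<close> by induction over the
    vector.\<close>
  have "\<forall>a\<in>carrier B. \<exists>g. g \<in> module_hom K V V \<and> (\<forall>u\<in>V.fixed. g u = b a u)"
    by (intro ballI V.extend_from_fixed V.V.module_axioms)
      (use b_closed b_add_right b_smult_right V.fixed_carrier in auto)
  then obtain \<rho> where \<rho>: "\<And>a. a \<in> carrier B \<Longrightarrow> \<rho> a \<in> module_hom K V V"
    and \<rho>_fixed: "\<And>a u. a \<in> carrier B \<Longrightarrow> u \<in> V.fixed \<Longrightarrow> \<rho> a u = b a u" by metis
  have \<rho>_closed: "\<rho> a x \<in> carrier V" if "a \<in> carrier B" "x \<in> carrier V" for a x
    using module_hom_closed[OF \<rho>[OF that(1)]] that(2) by blast
  note \<rho>_add = module_hom_add[OF \<rho>] and \<rho>_smult = module_hom_smult[OF \<rho>]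
  have B_closed: "a \<oplus>\<^bsub>A\<^esub> a' \<in> carrier B" "a \<otimes>\<^bsub>A\<^esub> a' \<in> carrier B" if "a \<in> carrier B" "a' \<in> carrier B" for a a'
    using that by (auto simp: B_simps FA_add FA_mult)
  have B_one: "\<one>\<^bsub>A\<^esub> \<in> carrier B" by (simp add: B_simps FA_one)
  have B_smult: "c \<odot>\<^bsub>A\<^esub> a \<in> carrier B" if "c \<in> Fq" "a \<in> carrier B" for c a
    using that AF.fixed_smult by (simp add: carrier_B)
  have BA: "a \<in> carrier A" if "a \<in> carrier B" for a using that by (simp add: B_simps)
  have \<rho>_add_left: "\<rho> (a \<oplus>\<^bsub>A\<^esub> a') x = \<rho> a x \<oplus>\<^bsub>V\<^esub> \<rho> a' x"
    if a: "a \<in> carrier B" "a' \<in> carrier B" and x: "x \<in> carrier V" for a a' x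
    using x
  proof (induction rule: V.frob_induct)
    case (smult c u)
    thus ?case using a B_closed b_add_left b_closed V.fixed_carrier
      by (simp add: \<rho>_smult \<rho>_fixed V.V.smult_r_distr)
  next
    case (add x y)
    thus ?case using a B_closed \<rho>_closed by (simp add: \<rho>_add V.V.a_ac)
  qed
  have \<rho>_smult_left: "\<rho> (d \<odot>\<^bsub>A\<^esub> a) x = d \<odot>\<^bsub>V\<^esub> \<rho> a x"
    if d: "d \<in> Fq" and a: "a \<in> carrier B" and x: "x \<in> carrier V" for d a x
    using x
  proof (induction rule: V.frob_induct)
    case (smult c u)
    have dK: "d \<in> carrier K" by (rule Fq_carrier[OF d])
    have ba: "b a u \<in> carrier V" using b_closed[OF a] smult V.fixed_carrier by blast
    have "\<rho> (d \<odot>\<^bsub>A\<^esub> a) (c \<odot>\<^bsub>V\<^esub> u) = c \<odot>\<^bsub>V\<^esub> (d \<odot>\<^bsub>V\<^esub> b a u)"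
      using smult a d B_smult b_smult_left V.fixed_carrier by (simp add: \<rho>_smult \<rho>_fixed)
    also have "\<dots> = d \<odot>\<^bsub>V\<^esub> (c \<odot>\<^bsub>V\<^esub> b a u)"
      using smult(1) dK ba V.V.smult_assoc1[of c d "b a u"] V.V.smult_assoc1[of d c "b a u"] by (simp add: m_comm)
    finally show ?case using smult a V.fixed_carrier by (simp add: \<rho>_smult \<rho>_fixed)
  next
    case (add x y)
    thus ?case using a d B_smult \<rho>_closed Fq_carrier by (simp add: \<rho>_add V.V.smult_r_distr)
  qed
  have \<rho>_mult: "\<rho> (a \<otimes>\<^bsub>A\<^esub> a') x = \<rho> a (\<rho> a' x)"
    if a: "a \<in> carrier B" "a' \<in> carrier B" and x: "x \<in> carrier V" for a a' x
    using x
  proof (induction rule: V.frob_induct)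
    case (smult c u)
    thus ?case using a B_closed b_mult b_closed V.fixed_carrier by (simp add: \<rho>_smult \<rho>_fixed)
  next
    case (add x y)
    thus ?case using a B_closed \<rho>_closed by (simp add: \<rho>_add)
  qed
  have \<rho>_one: "\<rho> \<one>\<^bsub>A\<^esub> x = x" if "x \<in> carrier V" for x
    using that
  proof (induction rule: V.frob_induct)
    case (smult c u)
    thus ?case using B_one b_one V.fixed_carrier by (simp add: \<rho>_smult \<rho>_fixed)
  next
    case (add x y)
    thus ?case using B_one by (simp add: \<rho>_add)
  qed
  \<comment> \<open>On \<open>c u\<close> with \<open>u\<close> fixed, \<open>b a u\<close> is fixed
    too, so both sides are \<open>c^q\<close> times \<open>b a u\<close>.\<close>
  have \<rho>_F: "F (\<rho> a x) = \<rho> a (F x)" if a: "a \<in> carrier B" and x: "x \<in> carrier V" for a x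
    using x
  proof (induction rule: V.frob_induct)
    case (smult c u)
    have u: "F u = u" "u \<in> carrier V" "F (b a u) = b a u" "b a u \<in> carrier V"
      using smult b_closed[OF a] by (auto simp: V.fixed_def)
    show ?case using smult a u by (simp add: \<rho>_smult \<rho>_fixed V.F_smult)
  next
    case (add x y)
    thus ?case using a \<rho>_closed V.F_closed by (simp add: \<rho>_add V.F_add)
  qed
  \<comment> \<open>Now the vector \<open>x\<close> is held and the algebra element varies, so
    \<open>\<sigma> x\<close> extends \<open>a \<mapsto> \<rho> a x\<close> from the fixed algebra
    to \<open>A\<close>. This explains the order of arguments in
    \<open>\<sigma> x a\<close>.\<close>
  have "\<forall>x\<in>carrier V. \<exists>g. g \<in> module_hom K A V \<and> (\<forall>a\<in>AF.fixed. g a = \<rho> a x)"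
    by (intro ballI AF.extend_from_fixed V.V.module_axioms)
      (use \<rho>_closed \<rho>_add_left \<rho>_smult_left in \<open>auto simp: carrier_B\<close>)
  then obtain \<sigma> where \<sigma>: "\<And>x. x \<in> carrier V \<Longrightarrow> \<sigma> x \<in> module_hom K A V"
    and \<sigma>_fixed: "\<And>a x. a \<in> carrier B \<Longrightarrow> x \<in> carrier V \<Longrightarrow> \<sigma> x a = \<rho> a x"
    unfolding carrier_B by metis
  have \<sigma>_closed: "\<sigma> x a \<in> carrier V" if "a \<in> carrier A" "x \<in> carrier V" for a x
    using module_hom_closed[OF \<sigma>[OF that(2)]] that(1) by blast
  note \<sigma>_add = module_hom_add[OF \<sigma>] and \<sigma>_smult = module_hom_smult[OF \<sigma>]
  have \<sigma>_add_right: "\<sigma> (x \<oplus>\<^bsub>V\<^esub> y) a = \<sigma> x a \<oplus>\<^bsub>V\<^esub> \<sigma> y a"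
    if a: "a \<in> carrier A" and xy: "x \<in> carrier V" "y \<in> carrier V" for a x y
    using a
  proof (induction rule: AF.frob_induct)
    case (smult c u)
    hence u: "u \<in> carrier B" by (simp add: carrier_B)
    show ?case using smult u xy BA \<rho>_closed
      by (simp add: \<sigma>_smult \<sigma>_fixed \<rho>_add V.V.smult_r_distr)
  next
    case (add a a')
    thus ?case using xy \<sigma>_closed by (simp add: \<sigma>_add V.V.a_ac)
  qed
  have \<sigma>_smult_right: "\<sigma> (d \<odot>\<^bsub>V\<^esub> x) a = d \<odot>\<^bsub>V\<^esub> \<sigma> x a"
    if a: "a \<in> carrier A" and d: "d \<in> carrier K" and x: "x \<in> carrier V" for a d x
    using a
  proof (induction rule: AF.frob_induct)
    case (smult c u)
    hence u: "u \<in> carrier B" by (simp add: carrier_B)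
    have ux: "\<rho> u x \<in> carrier V" by (rule \<rho>_closed[OF u x])
    show ?case using smult u x d BA ux V.V.smult_assoc1[of c d "\<rho> u x"] V.V.smult_assoc1[of d c "\<rho> u x"]
      by (simp add: \<sigma>_smult \<sigma>_fixed \<rho>_smult m_comm)
  next
    case (add a a')
    thus ?case using x d \<sigma>_closed by (simp add: \<sigma>_add V.V.smult_r_distr)
  qed
  \<comment> \<open>Multiplicativity is reached in two steps: the right factor is freed here by
    induction while the left one is fixed, and the left factor is freed next.\<close>
  have \<sigma>_mult_fixed: "\<sigma> x (u \<otimes>\<^bsub>A\<^esub> a) = \<rho> u (\<sigma> x a)"
    if u: "u \<in> carrier B" and a: "a \<in> carrier A" and x: "x \<in> carrier V" for u a x
    using a
  proof (induction rule: AF.frob_induct)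
    case (smult c v)
    hence v: "v \<in> carrier B" by (simp add: carrier_B)
    have "u \<otimes>\<^bsub>A\<^esub> (c \<odot>\<^bsub>A\<^esub> v) = c \<odot>\<^bsub>A\<^esub> (u \<otimes>\<^bsub>A\<^esub> v)"
      using smult u v BA by (simp add: AA.smult_mult_right)
    thus ?case using smult u v x BA B_closed \<rho>_closed
      by (simp add: \<sigma>_smult \<sigma>_fixed \<rho>_smult \<rho>_mult)
  next
    case (add a a')
    thus ?case using u x BA \<sigma>_closed by (simp add: AA.A.r_distr \<sigma>_add \<rho>_add)
  qed
  have \<sigma>_mult: "\<sigma> x (a \<otimes>\<^bsub>A\<^esub> a') = \<sigma> (\<sigma> x a') a"
    if a: "a \<in> carrier A" and a': "a' \<in> carrier A" and x: "x \<in> carrier V" for a a' x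
    using a
  proof (induction rule: AF.frob_induct)
    case (smult c u)
    hence u: "u \<in> carrier B" by (simp add: carrier_B)
    have "(c \<odot>\<^bsub>A\<^esub> u) \<otimes>\<^bsub>A\<^esub> a' = c \<odot>\<^bsub>A\<^esub> (u \<otimes>\<^bsub>A\<^esub> a')"
      using smult u a' BA by (simp add: AA.smult_mult_left)
    thus ?case using smult u x a' BA \<sigma>_closed
      by (simp add: \<sigma>_smult \<sigma>_fixed \<sigma>_mult_fixed)
  next
    case (add a b)
    thus ?case using x a' \<sigma>_closed by (simp add: AA.A.l_distr \<sigma>_add)
  qed
  have \<sigma>_F: "F (\<sigma> x a) = \<sigma> (F x) (FA a)" if a: "a \<in> carrier A" and x: "x \<in> carrier V" for a x
    using a
  proof (induction rule: AF.frob_induct)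
    case (smult c u)
    hence u: "u \<in> carrier B" "FA u = u" by (auto simp: carrier_B AF.fixed_def)
    show ?case using smult u x BA \<rho>_closed V.F_closed
      by (simp add: \<sigma>_smult \<sigma>_fixed FA_smult V.F_smult \<rho>_F)
  next
    case (add a a')
    thus ?case using x \<sigma>_closed V.F_closed FA_closed by (simp add: \<sigma>_add V.F_add FA_add)
  qed
  define M :: "('a, 'x) module" where "M = \<lparr>carrier = carrier V, monoid.mult = undefined, one = undefined,
    zero = zero V, add = add V, smult = (\<lambda>a x. \<sigma> x a)\<rparr>"
  have M_simps: "carrier M = carrier V" "add M = add V" "zero M = zero V" "smult M = (\<lambda>a x. \<sigma> x a)"
    by (simp_all add: M_def)
  have neg: "\<exists>y\<in>carrier V. y \<oplus>\<^bsub>V\<^esub> x = \<zero>\<^bsub>V\<^esub>" if "x \<in> carrier V" for x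
    using that by (intro bexI[of _ "\<ominus>\<^bsub>V\<^esub> x"]) (auto simp: V.V.M.l_neg)
  interpret M: abelian_group M
    by (rule abelian_groupI) (use neg in \<open>auto simp: M_simps V.V.a_ac\<close>)
  interpret M: left_module A M
    by unfold_locales
      (auto simp: M_simps \<sigma>_closed \<sigma>_add \<sigma>_add_right \<sigma>_mult \<sigma>_fixed[OF B_one] \<rho>_one)
  have "semilinear_module K Fq p r A FA M F"
    by unfold_locales (auto simp: M_simps V.F_closed V.F_add \<sigma>_F V.F_periodic)
  moreover have "\<forall>a\<in>carrier B. \<forall>u\<in>V.fixed. a \<odot>\<^bsub>M\<^esub> u = b a u"
    using V.fixed_carrier by (simp add: M_simps \<sigma>_fixed \<rho>_fixed)
  ultimately show ?thesis using M_simps by blast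
qed

text \<open>The scalar extension of \<open>N\<close> from \<open>Fq\<close> to \<open>K\<close>,
  realised as the space \<open>K^S\<close> of coordinates with respect to a basis \<open>S\<close>
  of \<open>N\<close>, whose fixed points \<open>Fq^S\<close> are a copy of \<open>N\<close>. The
  result is finally moved into \<open>'v\<close>.\<close>

lemma base_change:
  fixes N :: "('a, 'w) module"
  assumes inf: "infinite (UNIV :: 'v set)" and N: "left_module B N" and fin: "finite (carrier N)"
  shows "\<exists>(U :: ('a, 'v) module \<times> ('v \<Rightarrow> 'v)) \<iota>. F_obj U \<and> bij_betw \<iota> (Fix U) (carrier N) \<and>
    (\<forall>u\<in>Fix U. \<forall>v\<in>Fix U. \<iota> (u \<oplus>\<^bsub>fst U\<^esub> v) = \<iota> u \<oplus>\<^bsub>N\<^esub> \<iota> v) \<and>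
    (\<forall>a\<in>carrier B. \<forall>u\<in>Fix U. \<iota> (a \<odot>\<^bsub>fst U\<^esub> u) = a \<odot>\<^bsub>N\<^esub> \<iota> u)"
proof -
  let ?L = "K\<lparr>carrier := Fq\<rparr>" and ?N = "underlying_space B N"
  interpret N: left_module B N by (rule N)
  interpret NV: vectorspace ?L ?N by (rule underlying_vectorspace[OF Fq_field unit_hom_B N])
  have N_simps: "carrier ?N = carrier N" "add ?N = add N" "c \<odot>\<^bsub>?N\<^esub> x = (c \<odot>\<^bsub>A\<^esub> \<one>\<^bsub>A\<^esub>) \<odot>\<^bsub>N\<^esub> x" for c x
    by (simp_all add: underlying_space_def B_simps)
  have "fd_left_module ?L B N" using N fin by (simp add: fd_module_B_iff)
  hence "NV.fin_dim" by (simp add: fd_left_module_def)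
  then obtain S where S: "finite S" "NV.basis S" using NV.finite_basis_exists by blast
  have SN: "S \<subseteq> carrier ?N" using S(2) unfolding NV.basis_def by blast
  define \<kappa> where "\<kappa> \<phi> = NV.lincomb \<phi> S" for \<phi>
  interpret V: frob_space K Fq p r "func_space S" "coord_frob S" by (rule frob_space_coord(1)[OF S(1)])
  have fx: "V.fixed = (S \<rightarrow>\<^sub>E Fq)" by (rule frob_space_coord(2)[OF S(1)])
  interpret \<kappa>: mod_hom ?L "NV.func_space S" ?N \<kappa>
    unfolding \<kappa>_def by (rule NV.lincomb_is_mod_hom[OF S(1) SN])
  \<comment> \<open>Replacing the carrier of \<open>K\<close> by \<open>Fq\<close> leaves the
    operations alone, so the coordinate spaces over \<open>Fq\<close> and over \<open>K\<close>
    share addition and scalar action.\<close>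
  have fs: "carrier (NV.func_space S) = (S \<rightarrow>\<^sub>E Fq)" "add (NV.func_space S) = add (func_space S)"
    "smult (NV.func_space S) = smult (func_space S)"
    by (simp_all add: NV.func_space_def func_space_def)
  have ex1: "\<exists>!\<phi>. \<phi> \<in> S \<rightarrow>\<^sub>E Fq \<and> \<kappa> \<phi> = n" if "n \<in> carrier N" for n
    using NV.basis_criterion[OF S(1) SN] S(2) that by (simp add: N_simps \<kappa>_def)
  have \<kappa>_closed: "\<kappa> \<phi> \<in> carrier N" if "\<phi> \<in> V.fixed" for \<phi>
    using \<kappa>.f_im[of \<phi>] that by (simp add: fs fx N_simps)
  have \<kappa>_add: "\<kappa> (\<phi> \<oplus>\<^bsub>func_space S\<^esub> \<psi>) = \<kappa> \<phi> \<oplus>\<^bsub>N\<^esub> \<kappa> \<psi>" if "\<phi> \<in> V.fixed" "\<psi> \<in> V.fixed" for \<phi> \<psi>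
    using module_hom_add[OF \<kappa>.f_hom, of \<phi> \<psi>] that by (simp add: fs fx N_simps)
  have \<kappa>_smult: "\<kappa> (c \<odot>\<^bsub>func_space S\<^esub> \<phi>) = (c \<odot>\<^bsub>A\<^esub> \<one>\<^bsub>A\<^esub>) \<odot>\<^bsub>N\<^esub> \<kappa> \<phi>" if "c \<in> Fq" "\<phi> \<in> V.fixed" for c \<phi>
    using module_hom_smult[OF \<kappa>.f_hom, of c \<phi>] that by (simp add: fs fx N_simps)
  have bij: "bij_betw \<kappa> V.fixed (carrier N)"
    unfolding bij_betw_def
  proof
    show "inj_on \<kappa> V.fixed"
      using ex1 \<kappa>_closed unfolding fx by (intro inj_onI) metis
    show "\<kappa> ` V.fixed = carrier N"
    proof
      show "carrier N \<subseteq> \<kappa> ` V.fixed" using ex1 unfolding fx by blast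
    qed (use \<kappa>_closed in blast)
  qed
  define coords where "coords = inv_into V.fixed \<kappa>"
  have coords: "coords n \<in> V.fixed" "\<kappa> (coords n) = n" if "n \<in> carrier N" for n
    using that bij unfolding coords_def bij_betw_def by (simp_all add: inv_into_into f_inv_into_f)
  have coordsI: "coords n = \<phi>" if "\<phi> \<in> V.fixed" "\<kappa> \<phi> = n" for \<phi> n
    using that bij unfolding coords_def bij_betw_def by auto
  \<comment> \<open>The action on \<open>N\<close> written in coordinates; this is the input for
    \<open>extend_action\<close>.\<close>
  define b where "b a u = coords (a \<odot>\<^bsub>N\<^esub> \<kappa> u)" for a u
  have b: "b a u \<in> V.fixed" "\<kappa> (b a u) = a \<odot>\<^bsub>N\<^esub> \<kappa> u" if "a \<in> carrier B" "u \<in> V.fixed" for a u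
    unfolding b_def using coords N.act_closed that \<kappa>_closed by auto
  have uB: "c \<odot>\<^bsub>A\<^esub> \<one>\<^bsub>A\<^esub> \<in> carrier B" if "c \<in> Fq" for c
    using ring_hom_closed[OF unit_hom_B, of c] that by (simp add: B_simps(2,6))
  have BA: "a \<in> carrier A" if "a \<in> carrier B" for a using that by (simp add: B_simps)
  have "\<exists>M :: ('a, 'w \<Rightarrow> 'k) module. semilinear_module K Fq p r A FA M (coord_frob S) \<and>
    carrier M = carrier (func_space S) \<and> add M = add (func_space S) \<and>
    (\<forall>a\<in>carrier B. \<forall>u\<in>V.fixed. a \<odot>\<^bsub>M\<^esub> u = b a u)"
  proof (rule extend_action[OF V.frob_space_axioms])
    fix a u assume a: "a \<in> carrier B" and u: "u \<in> V.fixed"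
    show "b a u \<in> V.fixed" by (rule b(1)[OF a u])
    show "b a (u \<oplus>\<^bsub>func_space S\<^esub> v) = b a u \<oplus>\<^bsub>func_space S\<^esub> b a v" if v: "v \<in> V.fixed" for v
      unfolding b_def[of a "u \<oplus>\<^bsub>func_space S\<^esub> v"] using a u v b
      by (intro coordsI V.fixed_add) (simp_all add: \<kappa>_add N.act_add_right \<kappa>_closed)
    show "b (a \<oplus>\<^bsub>A\<^esub> a') u = b a u \<oplus>\<^bsub>func_space S\<^esub> b a' u" if a': "a' \<in> carrier B" for a'
      unfolding b_def[of "a \<oplus>\<^bsub>A\<^esub> a'"] using a u a' b N.act_add_left[of a a' "\<kappa> u"]
      by (intro coordsI V.fixed_add) (simp_all add: \<kappa>_add \<kappa>_closed B_simps(4))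
    show "b (a \<otimes>\<^bsub>A\<^esub> a') u = b a (b a' u)" if a': "a' \<in> carrier B" for a'
      unfolding b_def[of "a \<otimes>\<^bsub>A\<^esub> a'"] using a u a' b N.act_mult[of a a' "\<kappa> u"]
      by (intro coordsI) (simp_all add: \<kappa>_closed B_simps(5))
    show "b (c \<odot>\<^bsub>A\<^esub> a) u = c \<odot>\<^bsub>func_space S\<^esub> b a u" if c: "c \<in> Fq" for c
    proof -
      \<comment> \<open>A scalar acts on \<open>N\<close> as the element \<open>c . 1\<close> of the
        fixed algebra, so compatibility with scalars is an instance of multiplicativity.\<close>
      have "c \<odot>\<^bsub>A\<^esub> a = (c \<odot>\<^bsub>A\<^esub> \<one>\<^bsub>A\<^esub>) \<otimes>\<^bsub>B\<^esub> a"
        using Fq_carrier[OF c] BA[OF a] by (simp add: B_simps(5) AA.smult_mult_left)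
      thus ?thesis
        unfolding b_def[of "c \<odot>\<^bsub>A\<^esub> a"] using a u c b uB[OF c]
        by (intro coordsI V.fixed_smult) (simp_all add: \<kappa>_smult N.act_mult \<kappa>_closed)
    qed
    show "b a (c \<odot>\<^bsub>func_space S\<^esub> u) = c \<odot>\<^bsub>func_space S\<^esub> b a u" if c: "c \<in> Fq" for c
    proof -
      have "a \<otimes>\<^bsub>B\<^esub> (c \<odot>\<^bsub>A\<^esub> \<one>\<^bsub>A\<^esub>) = (c \<odot>\<^bsub>A\<^esub> \<one>\<^bsub>A\<^esub>) \<otimes>\<^bsub>B\<^esub> a"
        using Fq_carrier[OF c] BA[OF a] by (simp add: B_simps(5) AA.smult_mult_left AA.smult_mult_right)
      thus ?thesis
        unfolding b_def[of a "c \<odot>\<^bsub>func_space S\<^esub> u"] using a u c b uB[OF c]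
        by (intro coordsI V.fixed_smult) (simp_all add: \<kappa>_smult N.act_mult[symmetric] \<kappa>_closed)
    qed
  next
    show "b \<one>\<^bsub>A\<^esub> u = u" if u: "u \<in> V.fixed" for u
      unfolding b_def using u N.act_one[of "\<kappa> u"] by (intro coordsI) (simp_all add: \<kappa>_closed B_simps(2))
  qed
  then obtain M :: "('a, 'w \<Rightarrow> 'k) module" where M: "semilinear_module K Fq p r A FA M (coord_frob S)"
    and cM: "carrier M = carrier (func_space S)" and aM: "add M = add (func_space S)"
    and actM: "\<And>a u. a \<in> carrier B \<Longrightarrow> u \<in> V.fixed \<Longrightarrow> a \<odot>\<^bsub>M\<^esub> u = b a u" by blast
  interpret M: semilinear_module K Fq p r A FA M "coord_frob S" by (rule M)
  have MF: "{m \<in> carrier M. coord_frob S m = m} = V.fixed" by (simp add: V.fixed_def cM)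
  have "countable (carrier M)"
    unfolding cM by (rule countable_func_space[OF S(1)])
  \<comment> \<open>The carrier of \<open>M\<close> consists of functions into \<open>K\<close>;
    being countable, it is numbered and the numbers are sent into \<open>'v\<close>.\<close>
  moreover obtain e :: "nat \<Rightarrow> 'v" where e: "inj e"
    using infinite_countable_subset[OF inf] by blast
  ultimately have j: "inj_on (e \<circ> to_nat_on (carrier M)) (carrier M)"
    by (intro comp_inj_on inj_on_to_nat_on inj_on_subset[OF e]) auto
  define j where "j = e \<circ> to_nat_on (carrier M)"
  have inj: "inj_on j (carrier M)" unfolding j_def by (rule j)
  have cong: "module_congruence A M j" by (rule module_congruence_inj[OF M.M.left_module_axioms inj])
  interpret J: module_congruence A M j by (rule cong)
  have F_cong: "j (coord_frob S x) = j (coord_frob S x')" if "x \<in> carrier M" "x' \<in> carrier M" "j x = j x'" for x x'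
    using inj_onD[OF inj that(3,1,2)] by simp
  define U where "U = (image_module j M, image_map j M (coord_frob S))"
  have sm: "semilinear_module K Fq p r A FA (fst U) (snd U)"
    unfolding U_def fst_conv snd_conv using cong F_cong by (rule M.image_semilinear(1))
  have FixU: "Fix U = j ` V.fixed"
    unfolding Fix_def U_def fst_conv snd_conv MF[symmetric] using cong F_cong by (rule M.image_semilinear(3))
  have "finite (Fix U)" unfolding FixU fx using S(1) finite_Fq by (intro finite_imageI finite_PiE) auto
  hence U: "F_obj U" using sm F_module_iff[of "fst U" "snd U"] by (simp add: Fix_def)
  define \<iota> where "\<iota> y = \<kappa> (inv_into (carrier M) j y)" for y
  have vM: "u \<in> carrier M" if "u \<in> V.fixed" for u using that MF by blast
  have \<iota>: "\<iota> (j u) = \<kappa> u" if "u \<in> V.fixed" for u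
    unfolding \<iota>_def using inj vM[OF that] by simp
  have "bij_betw \<iota> (j ` V.fixed) (carrier N)"
  proof -
    have "bij_betw j V.fixed (j ` V.fixed)"
      using inj vM by (auto intro!: inj_on_imp_bij_betw intro: inj_on_subset)
    moreover have "bij_betw (\<iota> \<circ> j) V.fixed (carrier N)"
      using bij by (subst bij_betw_cong[of _ _ \<kappa>]) (auto simp: \<iota>)
    ultimately show ?thesis using bij_betw_comp_iff by blast
  qed
  moreover have "\<iota> (j u \<oplus>\<^bsub>fst U\<^esub> j v) = \<iota> (j u) \<oplus>\<^bsub>N\<^esub> \<iota> (j v)" if "u \<in> V.fixed" "v \<in> V.fixed" for u v
    using J.image_add[OF vM[OF that(1)] vM[OF that(2)]] that V.fixed_add[OF that]
    by (simp add: U_def \<iota> \<kappa>_add aM)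
  moreover have "\<iota> (a \<odot>\<^bsub>fst U\<^esub> j u) = a \<odot>\<^bsub>N\<^esub> \<iota> (j u)" if "a \<in> carrier B" "u \<in> V.fixed" for a u
    using J.image_smult[OF BA[OF that(1)] vM[OF that(2)]] that b[OF that]
    by (simp add: U_def \<iota> actM)
  ultimately show ?thesis
    using U unfolding FixU by (intro exI[of _ U] exI[of _ \<iota>]) (auto simp: FixU)
qed

end

context fixed_functor
begin

lemma fixed_essentially_surjective:
  assumes inf: "infinite (UNIV :: 'v set)" and N: "N \<in> obj modB"
  shows "\<exists>U\<in>obj modF. \<exists>e. iso_arr modB (Fo U) N e"
proof -
  have fdN: "fd_left_module (K\<lparr>carrier := Fq\<rparr>) B N" using N by (simp add: mod_cat_simps)
  hence lN: "left_module B N" "finite (carrier N)" by (simp_all add: fd_module_B_iff)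
  interpret N: left_module B N by (rule lN(1))
  obtain U :: "('a, 'v) module \<times> ('v \<Rightarrow> 'v)" and \<iota> where U: "F_obj U" and bij: "bij_betw \<iota> (Fix U) (carrier N)"
    and \<iota>_add: "\<And>u v. u \<in> Fix U \<Longrightarrow> v \<in> Fix U \<Longrightarrow> \<iota> (u \<oplus>\<^bsub>fst U\<^esub> v) = \<iota> u \<oplus>\<^bsub>N\<^esub> \<iota> v"
    and \<iota>_act: "\<And>a u. a \<in> carrier B \<Longrightarrow> u \<in> Fix U \<Longrightarrow> \<iota> (a \<odot>\<^bsub>fst U\<^esub> u) = a \<odot>\<^bsub>N\<^esub> \<iota> u"
    using base_change[OF inf lN] by blast
  note c = Fix_closed[OF U]
  have \<iota>c: "\<iota> u \<in> carrier N" if "u \<in> Fix U" for u using bij that by (auto simp: bij_betw_def)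
  \<comment> \<open>\<open>base_change\<close> yields fixed points inside \<open>'v\<close>, whereas
    \<open>Fo U\<close> is their copy in \<open>'w\<close>. The isomorphism therefore undoes
    \<open>j U\<close> before it applies \<open>\<iota>\<close>.\<close>
  define e where "e = (\<lambda>y \<in> carrier (Fo U). \<iota> (inv_into (Fix U) (j U) y))"
  define e' where "e' = (\<lambda>n \<in> carrier N. j U (inv_into (Fix U) \<iota> n))"
  have e: "e (j U u) = \<iota> u" if "u \<in> Fix U" for u
    using that j[OF U] by (simp add: e_def carrier_Fo)
  have e': "e' (\<iota> u) = j U u" if "u \<in> Fix U" for u
    using that bij \<iota>c by (simp add: e'_def bij_betw_def)
  have N_cases: "\<exists>u\<in>Fix U. n = \<iota> u" if "n \<in> carrier N" for n
    using bij that by (auto simp: bij_betw_def)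
  have "mod_hom_on B (Fo U) N e"
    unfolding mod_hom_on_def module_hom_def
    by (auto simp: carrier_Fo e Fo_add[OF U] Fo_act[OF U] c \<iota>_add \<iota>_act \<iota>c) (simp add: e_def carrier_Fo)
  hence eh: "(Fo U, e, N) \<in> homset modB (Fo U) N"
    using Fo_obj[OF U] fdN by (simp add: homset_mod_cat)
  have add': "e' (m \<oplus>\<^bsub>N\<^esub> n) = e' m \<oplus>\<^bsub>Fo U\<^esub> e' n" if mn: "m \<in> carrier N" "n \<in> carrier N" for m n
  proof -
    obtain u v where uv: "u \<in> Fix U" "v \<in> Fix U" "m = \<iota> u" "n = \<iota> v" using N_cases mn by meson
    thus ?thesis using e'[OF c(1)[OF uv(1,2)]] by (simp add: e' Fo_add[OF U] \<iota>_add)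
  qed
  have act': "e' (a \<odot>\<^bsub>N\<^esub> n) = a \<odot>\<^bsub>Fo U\<^esub> e' n" if an: "a \<in> carrier B" "n \<in> carrier N" for a n
  proof -
    obtain u where u: "u \<in> Fix U" "n = \<iota> u" using N_cases an by meson
    thus ?thesis using e'[OF c(2)[OF an(1) u(1)]] an(1) by (simp add: e' Fo_act[OF U] \<iota>_act)
  qed
  have "e' n \<in> carrier (Fo U)" if "n \<in> carrier N" for n
    using N_cases[OF that] by (auto simp: e' carrier_Fo)
  hence "mod_hom_on B N (Fo U) e'"
    unfolding mod_hom_on_def module_hom_def using add' act' by (auto simp: e'_def)
  hence e'h: "(N, e', Fo U) \<in> homset modB N (Fo U)"
    using Fo_obj[OF U] fdN by (simp add: homset_mod_cat)
  have "compose (carrier (Fo U)) e' e = (\<lambda>y \<in> carrier (Fo U). y)"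
    by (rule extensionalityI[of _ "carrier (Fo U)"]) (auto simp: carrier_Fo compose_eq e e')
  moreover have "compose (carrier N) e e' = (\<lambda>n \<in> carrier N. n)"
  proof (rule extensionalityI[of _ "carrier N"])
    fix n assume n: "n \<in> carrier N"
    then obtain u where "u \<in> Fix U" "n = \<iota> u" using N_cases by blast
    thus "compose (carrier N) e e' n = (\<lambda>n \<in> carrier N. n) n" using n by (simp add: compose_eq e e')
  qed simp_all
  ultimately have "iso_arr modB (Fo U) N (Fo U, e, N)"
    unfolding iso_arr_def using eh e'h
    by (intro conjI bexI[of _ "(N, e', Fo U)"]) (simp_all add: mod_cat_simps)
  moreover have "U \<in> obj modF" using U by (simp add: modF_simps)
  ultimately show ?thesis by blast
qed

end

theorem theorem3p2:
  fixes p r :: nat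
    and K :: "('k, 'b) ring_scheme" and Fq :: "'k set"
    and A :: "('k, 'a, 'c) module_scheme" and FA :: "'a \<Rightarrow> 'a"
  assumes "Factorial_Ring.prime p" and "r > 0" and "card Fq = p ^ r"
    and "algebraic_closure K Fq"
    and "assoc_algebra K A"
    and "frobenius_morphism K Fq A FA"
    and "infinite (UNIV :: 'v set)" and "infinite (UNIV :: 'w set)"
  shows "abelian_category
      (modF_cat K Fq A FA :: (('a, 'v) module \<times> ('v \<Rightarrow> 'v), _) cat) \<and>
    equivalent_categories
      (modF_cat K Fq A FA :: (('a, 'v) module \<times> ('v \<Rightarrow> 'v), _) cat)
      (mod_cat (K\<lparr>carrier := Fq\<rparr>) (fixed_algebra A FA) :: (('a, 'w) module, _) cat)"
proof
  interpret frob_algebra K Fq p r A FA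
    by (intro frob_algebra.intro finite_base.intro finite_base_axioms.intro frob_algebra_axioms.intro assms)
  show "abelian_category (modF_cat K Fq A FA :: (('a, 'v) module \<times> ('v \<Rightarrow> 'v), _) cat)"
    by (rule abelian_modF[OF assms(7)])
  \<comment> \<open>The types \<open>'v\<close> and \<open>'w\<close> are compared only on the
    finite sets of fixed points, one object at a time. The family \<open>j\<close> of injections is
    then obtained by choice.\<close>
  have "\<exists>i :: 'v \<Rightarrow> 'w. inj_on i (Fix U)" if U: "F_obj U" for U :: "('a, 'v) module \<times> ('v \<Rightarrow> 'v)"
  proof -
    have "finite (Fix U)" unfolding Fix_def by (rule F_objD(2)[OF U])
    moreover obtain e :: "nat \<Rightarrow> 'w" where "inj e" using infinite_countable_subset[OF assms(8)] by blast
    ultimately have "inj_on (e \<circ> to_nat_on (Fix U)) (Fix U)"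
      by (intro comp_inj_on inj_on_to_nat_on countable_finite) (auto intro: inj_on_subset)
    thus ?thesis by blast
  qed
  then obtain j :: "('a, 'v) module \<times> ('v \<Rightarrow> 'v) \<Rightarrow> 'v \<Rightarrow> 'w"
    where j: "\<And>U. F_obj U \<Longrightarrow> inj_on (j U) (Fix U)" by metis
  interpret fixed_functor K Fq p r A FA j by unfold_locales (rule j)
  show "equivalent_categories
      (modF_cat K Fq A FA :: (('a, 'v) module \<times> ('v \<Rightarrow> 'v), _) cat)
      (mod_cat (K\<lparr>carrier := Fq\<rparr>) (fixed_algebra A FA) :: (('a, 'w) module, _) cat)"
    by (rule equivalent_categories_of_fully_faithful[OF fixed_cat_functor])
      (use fixed_fully_faithful fixed_essentially_surjective[OF assms(7)] in \<open>auto simp: modF_simps\<close>)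
qed

end
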